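(* Let $\mu\in[0,1)$ be fixed and consider Async-MSGD for streaming PCA started around the saddle point $e_2$, i.e. with $(H^{\eta,2}(0))^2\ge1-\delta^2$ (see context). Given a pre-specified $\nu\in(0,1)$, $\eta\asymp\epsilon(\lambda_1-\lambda_2)/\phi$ and $\delta\asymp\sqrt{\eta}$, and given that the maximal delay $\tau=\max_k\tau_k$ (the number of workers allowed to work simultaneously) satisfies $$\tau\asymp\frac{(1-\mu)^2}{(\lambda_1+C_d)\,\eta^{\frac12-\gamma}}\quad\text{for some }\gamma\in(0,0.5],$$ then with $$T_1=\frac{1-\mu}{2(\lambda_1-\lambda_2)}\log\left(\frac{2(1-\mu)\eta^{-1}\delta^2(\lambda_1-\lambda_2)}{\Phi^{-1}\left(\frac{1+\nu/2}{2}\right)^2\alpha_{1,2}^2}+1\right)$$ one has, asymptotically (as $\epsilon\to0$, so $\eta\to0$), $\big(H^{\eta,2}(T_1)\big)^2\le1-\delta^2$ with probability at least $1-\nu$, where $\Phi$ is the CDF of the standard normal distribution.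
   Context: Data: $\{X_k\}$ are drawn independently from a distribution $\mathcal{D}$ on $\mathbb{R}^d$ with $\mathbb{E}[X]=0$, $\mathbb{E}[XX^\top]=\Sigma$ and $\|X\|\le C_d$ for a constant $C_d$ (possibly depending on $d$). $\Sigma$ is positive definite with eigenvalues $\lambda_1>\lambda_2\ge\dots\ge\lambda_d>0$ and $\Sigma=Q\Lambda Q^\top$ with $\Lambda=\mathrm{diag}(\lambda_1,\dots,\lambda_d)$, $Q^\top Q=I$. $\mathbb{S}$ is the unit sphere of $\mathbb{R}^d$; $e_i$ is the $i$-th standard basis vector. Async-MSGD: with step size $\eta>0$, momentum $\mu\in[0,1)$ and delays $\tau_k\in\mathbb{Z}_{+}$ (nonnegative integers), $$v_{k+1}=v_k+\mu(v_k-v_{k-1})+\eta\,(I-v_{k-\tau_k}v_{k-\tau_k}^{\top})X_kX_k^{\top}v_{k-\tau_k},$$ with $v_{-i}=v_0=v_1\in\mathbb{S}$ for all $i>0$. Iterates and delays depend on $\eta$. Rotated interpolation: $H^{\eta}(t)=Q^\top v_k^{\eta}$ for $t\in[k\eta,k\eta+\eta)$, and $H^{\eta,i}$ is its $i$-th coordinate. With $Y=Q^\top X$, $\alpha_{i,j}=\sqrt{\mathbb{E}[(Y^{(i)})^2(Y^{(j)})^2]}$ and $\phi=\sum_j\alpha_{1,j}^2$. Here $\epsilon>0$ is a small target accuracy, through which the step size is chosen. The symbol $\asymp$ means asymptotically equal (of the same order).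
   Formalization: δ ≍ √η is read as δ of order √η with implied constant at least some c0 depending only on the distribution, μ and ν, since the claim fails for small constants (norm excess of order η); α_{1,2} > 0 is assumed so that T_1 is defined. *)

theory Defs
  imports "HOL-Probability.Probability" "HOL-Library.Landau_Symbols"
begin

definition outer :: "real^'n \<Rightarrow> real^'n \<Rightarrow> real^'n^'n" where
  "outer u v = (\<chi> i j. u $ i * v $ j)"

definition diag_mat :: "('n \<Rightarrow> real) \<Rightarrow> real^'n^'n" where
  "diag_mat l = (\<chi> i j. if i = j then l i else 0)"

(* x k is the k-th sample, tau k the delay used in the step from k to k + 1 (k \<ge> 1).
   Subtraction on nat is truncated, so for tau k > k the delayed iterate is the 0-th one:
   this is the convention v_(-i) = v_0 for i > 0. *)
fun async_msgd ::
  "real \<Rightarrow> real \<Rightarrow> (nat \<Rightarrow> nat) \<Rightarrow> (nat \<Rightarrow> real^'n) \<Rightarrow> real^'n \<Rightarrow> nat \<Rightarrow> real^'n" where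
  "async_msgd eta mu tau x v0 0 = v0"
| "async_msgd eta mu tau x v0 (Suc 0) = v0"
| "async_msgd eta mu tau x v0 (Suc (Suc m)) =
     (let k = Suc m;
          v = async_msgd eta mu tau x v0 k;
          v' = async_msgd eta mu tau x v0 m;
          w = async_msgd eta mu tau x v0 (k - tau k)
      in v + mu *\<^sub>R (v - v') + eta *\<^sub>R ((mat 1 - outer w w) *v (outer (x k) (x k) *v w)))"

definition rot_interp :: "real^'n^'n \<Rightarrow> real \<Rightarrow> (nat \<Rightarrow> real^'n) \<Rightarrow> real \<Rightarrow> real^'n" where
  "rot_interp Q eta v t = transpose Q *v v (nat \<lfloor>t / eta\<rfloor>)"

definition alpha :: "(real^'n) measure \<Rightarrow> real^'n^'n \<Rightarrow> 'n \<Rightarrow> 'n \<Rightarrow> real" where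
  "alpha D Q i j =
     sqrt (LINT x|D. ((transpose Q *v x) $ i)\<^sup>2 * ((transpose Q *v x) $ j)\<^sup>2)"

definition std_normal_quantile :: "real \<Rightarrow> real" where
  "std_normal_quantile q = (THE z. cdf std_normal_distribution z = q)"

(* Meaningful only for alpha12 \<noteq> 0.

   In the theorem, delta is of order sqrt eta with an implied constant bounded below by some c0 that
   depends only on the distribution, mu and nu. The threshold cannot be dropped. The iterates are not
   renormalized, and starting near e_2 their squared norm exceeds 1 by an amount of order eta, hence
   of order delta^2. If delta = K sqrt eta with K small, this excess is comparable with the squared
   first coordinate at time T1: for d = 2, independent symmetric coordinates X_i = +- sqrt lambda_i,
   mu = 0 and start e_2, the probability of (H^2(T1))^2 \<le> 1 - delta^2 tends (as eta \<rightarrow> 0 and then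
   K \<rightarrow> 0) to P(N^2 \<ge> 1 + z^2) < 0.32 for N standard normal and z the quantile used below. *)
definition T1 :: "real \<Rightarrow> real \<Rightarrow> real \<Rightarrow> real \<Rightarrow> real \<Rightarrow> real \<Rightarrow> real \<Rightarrow> real" where
  "T1 mu nu lam1 lam2 alpha12 eta delta =
     (1 - mu) / (2 * (lam1 - lam2)) *
     ln (2 * (1 - mu) * inverse eta * delta\<^sup>2 * (lam1 - lam2) /
         ((std_normal_quantile ((1 + nu / 2) / 2))\<^sup>2 * alpha12\<^sup>2) + 1)"

end

theory Submission
  imports Defs
begin

text \<open>Let \<open>Z k\<close> be the heavy-ball average of the iterates; it performs a momentum-free stochastic gradient recursion with
  step \<open>eta / (1 - mu)\<close>. The delay bound makes the stale iterate differ from \<open>Z k\<close> by \<open>o(sqrt eta)\<close> along every path, so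
  the delay is invisible on the diffusion scale \<open>sqrt eta\<close>.

  Up to the time horizon, \<open>Z k\<close> stays within distance of order \<open>sqrt eta\<close> of the saddle in mean square. Hence the first
  coordinate is, up to \<open>o(sqrt eta)\<close>, an unstable linear recursion driven by the independent noise
  \<open>(X k \<bullet> q1) * (X k \<bullet> q2)\<close>, and its value at \<open>T1\<close> is asymptotically normal: the standard deviation is \<open>delta / z\<close>, and
  shifting the mean away from \<open>0\<close> only decreases the probability of a centred interval. Instead of following the second
  coordinate one uses \<open>(q1 \<bullet> v)\<^sup>2 + (q2 \<bullet> v)\<^sup>2 \<le> (norm v)\<^sup>2\<close>. The excess of the squared norm over \<open>1\<close> is at most of
  order \<open>eta * (1 + T1)\<close>, and \<open>T1\<close> grows only logarithmically in \<open>delta\<^sup>2 / eta\<close>, so for \<open>delta \<ge> c0 * sqrt eta\<close> with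
  \<open>c0\<close> large the excess costs a small part of the slack \<open>nu / 2\<close> that the quantile in \<open>T1\<close> leaves.\<close>

section \<open>The update and bounds along a path\<close>

text \<open>The constant \<open>c0\<close> is fixed before \<open>delta\<close>, so it must not
  depend on the upper constant \<open>R\<close> in \<open>delta \<le> R * sqrt eta\<close>: every
  bound that involves \<open>R\<close> has to carry a factor tending to 0. The delicate quantity is
  the excess of the squared norm. The time \<open>rho = eta * (m + 1)\<close> spanned by the largest
  delay \<open>m\<close> is \<open>o(sqrt eta)\<close>, but may be far larger than
  \<open>eta\<close>, and a pathwise bound on the excess is only of order \<open>rho\<close>. Order
  \<open>eta\<close> is reached in expectation, after splitting off the martingale part of the
  staleness error, which is of order \<open>rho * sqrt eta = o(eta)\<close>. The leading term
  \<open>6 * kap ^ 3 * G\<^sup>2 * T * eta\<close> is then free of \<open>R\<close>, apart from a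
  horizon \<open>T\<close> that grows at most linearly in \<open>delta / sqrt eta\<close> and is
  absorbed by completing a square.

  The failure probability \<open>nu\<close> is spent as \<open>nu / 2\<close> on the Gaussian
  interval and \<open>nu / 8\<close> each on the norm excess, the linearisation remainders, the
  widening of the interval by \<open>(1 + h)\<^sup>2\<close> and the normal approximation.\<close>

definition oja :: "'b::real_inner \<Rightarrow> 'b \<Rightarrow> 'b" where
  "oja w y = (y \<bullet> w) *\<^sub>R y - (y \<bullet> w)\<^sup>2 *\<^sub>R w"

lemma outer_mult_vec: "outer u v *v w = (v \<bullet> w) *\<^sub>R u"
  by (simp add: vec_eq_iff outer_def matrix_vector_mult_def inner_vec_def sum_distrib_left
      sum_distrib_right mult_ac)

lemma oja_eq_outer: "(mat 1 - outer w w) *v (outer y y *v w) = oja w y"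
  by (simp add: oja_def outer_mult_vec matrix_vector_mult_diff_rdistrib
      power2_eq_square inner_commute)

text \<open>Tested against a fixed vector the update is a product of two linear forms in
  \<open>y\<close>, so its mean is a value of the covariance form.\<close>

lemma inner_oja: "a \<bullet> oja w y = (y \<bullet> w) * (y \<bullet> (a - (w \<bullet> a) *\<^sub>R w))"
  by (simp add: oja_def inner_simps inner_commute power2_eq_square algebra_simps)

lemma async_msgd_Suc:
  "1 \<le> k \<Longrightarrow> async_msgd eta mu tau x v0 (Suc k) = async_msgd eta mu tau x v0 k
    + mu *\<^sub>R (async_msgd eta mu tau x v0 k - async_msgd eta mu tau x v0 (k - 1))
    + eta *\<^sub>R oja (async_msgd eta mu tau x v0 (k - tau k)) (x k)"
  by (cases k) (simp_all add: oja_eq_outer Let_def)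

text \<open>Only samples with index below \<open>N\<close> are required, so the lemma yields
  measurability both with respect to the history before step \<open>N\<close> and on the whole
  space.\<close>

lemma borel_measurable_async_msgd:
  assumes "\<And>k. k < N \<Longrightarrow> X k \<in> borel_measurable M"
  shows "(\<lambda>\<omega>. async_msgd eta mu tau (\<lambda>k. X k \<omega>) v0 N) \<in> borel_measurable M"
  using assms
proof (induction N rule: less_induct)
  case (less N)
  show ?case
  proof (cases "N \<le> 1")
    case True
    then have "N = 0 \<or> N = Suc 0" by auto
    then show ?thesis by auto
  next
    case False
    then obtain k where k: "N = Suc k" "1 \<le> k" by (cases N) auto
    have IH: "(\<lambda>\<omega>. async_msgd eta mu tau (\<lambda>k. X k \<omega>) v0 j) \<in> borel_measurable M" if "j \<le> k" for j
      using less.prems k that by (intro less.IH) auto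
    note [measurable] = IH[OF order_refl] IH[OF diff_le_self[of k 1]] IH[OF diff_le_self[of k "tau k"]]
    have [measurable]: "X k \<in> borel_measurable M"
      using less.prems k by auto
    show ?thesis
      unfolding k(1) async_msgd_Suc[OF k(2)] oja_def by measurable
  qed
qed

lemma bessel_two:
  fixes a b x :: "'a::real_inner"
  assumes "norm a = 1" "norm b = 1" "a \<bullet> b = 0"
  shows "(a \<bullet> x)\<^sup>2 + (b \<bullet> x)\<^sup>2 \<le> (norm x)\<^sup>2"
proof -
  define r where "r = x - (a \<bullet> x) *\<^sub>R a - (b \<bullet> x) *\<^sub>R b"
  have ab: "a \<bullet> a = 1" "b \<bullet> b = 1" "b \<bullet> a = 0"
    using assms by (simp_all add: power2_norm_eq_inner[symmetric] inner_commute[of b])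
  have "r \<bullet> r = x \<bullet> x - (a \<bullet> x)\<^sup>2 - (b \<bullet> x)\<^sup>2"
    unfolding r_def
    by (simp add: inner_simps inner_commute[of x a] inner_commute[of x b] ab assms(3) power2_eq_square)
  then show ?thesis
    using inner_ge_zero[of r] by (simp add: power2_norm_eq_inner)
qed

lemma norm_oja_le:
  assumes "norm w \<le> 2" "norm y \<le> C"
  shows "norm (oja w y) \<le> 10 * C\<^sup>2"
proof -
  have C: "0 \<le> C"
    using assms(2) norm_ge_zero order_trans by blast
  have yw: "\<bar>y \<bullet> w\<bar> \<le> C * 2"
    by (rule order_trans[OF Cauchy_Schwarz_ineq2 mult_mono]) (use assms C in auto)
  have "norm (oja w y) \<le> \<bar>y \<bullet> w\<bar> * norm y + (y \<bullet> w)\<^sup>2 * norm w"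
    unfolding oja_def by (rule order_trans[OF norm_triangle_ineq4]) simp
  also have "\<dots> \<le> (C * 2) * C + (C * 2)\<^sup>2 * 2"
    using assms C yw power2_le_iff_abs_le[of "C * 2" "y \<bullet> w"] by (intro add_mono mult_mono) auto
  also have "\<dots> = 10 * C\<^sup>2"
    by (simp add: power2_eq_square)
  finally show ?thesis .
qed

text \<open>The difference of the cubic terms is split into
  \<open>(y \<bullet> w)\<^sup>2 * (w - w')\<close> and a difference of squares times
  \<open>w'\<close>. The computation gives 13; with 20 the Lipschitz constant is exactly
  \<open>2 * G\<close>.\<close>

lemma norm_oja_diff_le:
  assumes "norm w \<le> 2" "norm w' \<le> 2" "norm y \<le> C"
  shows "norm (oja w y - oja w' y) \<le> 20 * C\<^sup>2 * norm (w - w')"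
proof -
  have C: "0 \<le> C"
    using assms(3) norm_ge_zero order_trans by blast
  have yw: "\<bar>y \<bullet> w\<bar> \<le> C * 2" "\<bar>y \<bullet> w'\<bar> \<le> C * 2"
    by (rule order_trans[OF Cauchy_Schwarz_ineq2 mult_mono]; use assms C in auto)+
  have yd: "\<bar>y \<bullet> (w - w')\<bar> \<le> C * norm (w - w')"
    by (rule order_trans[OF Cauchy_Schwarz_ineq2 mult_mono]) (use assms C in auto)
  have sum: "\<bar>y \<bullet> (w + w')\<bar> \<le> 4 * C"
    using yw by (auto simp: inner_simps)
  have eq: "oja w y - oja w' y = (y \<bullet> (w - w')) *\<^sub>R y - (y \<bullet> w)\<^sup>2 *\<^sub>R (w - w')
      - ((y \<bullet> (w - w')) * (y \<bullet> (w + w'))) *\<^sub>R w'"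
    by (simp add: oja_def inner_simps algebra_simps power2_eq_square)
  have "norm (oja w y - oja w' y) \<le> \<bar>y \<bullet> (w - w')\<bar> * norm y + (y \<bullet> w)\<^sup>2 * norm (w - w')
      + (\<bar>y \<bullet> (w - w')\<bar> * \<bar>y \<bullet> (w + w')\<bar>) * norm w'"
    unfolding eq
    by (rule order_trans[OF norm_triangle_ineq4] add_mono order_refl)+ (simp_all add: abs_mult)
  also have "\<dots> \<le> (C * norm (w - w')) * C + (C * 2)\<^sup>2 * norm (w - w')
      + ((C * norm (w - w')) * (4 * C)) * 2"
    using assms C yw yd sum power2_le_iff_abs_le[of "C * 2" "y \<bullet> w"] by (intro add_mono mult_mono) auto
  also have "\<dots> = 13 * C\<^sup>2 * norm (w - w')"
    by (simp add: power2_eq_square algebra_simps)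
  also have "\<dots> \<le> 20 * C\<^sup>2 * norm (w - w')"
    by (intro mult_right_mono) auto
  finally show ?thesis .
qed

text \<open>The bound on the samples holds on every path rather than almost surely, so the estimates
  of this locale hold for each \<open>\<omega>\<close>. The main theorem provides it by
  truncation.\<close>

locale msgd_paths =
  fixes X :: "nat \<Rightarrow> 'a \<Rightarrow> real^'n" and C eta mu :: real and tau :: "nat \<Rightarrow> nat"
    and m :: nat and v0 :: "real^'n"
  assumes X_bound: "norm (X k \<omega>) \<le> C"
    and C: "1 \<le> C"
    and eta: "0 < eta"
    and mu: "0 \<le> mu" "mu < 1"
    and tau: "1 \<le> k \<Longrightarrow> tau k \<le> m"
    and v0: "norm v0 = 1"
begin

definition "kap = 1 / (1 - mu)"
definition "G = 10 * C\<^sup>2"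
text \<open>The time spanned by the largest delay. The extra step gives
  \<open>eta \<le> rho\<close>, which lets step-size errors be absorbed into delay errors.\<close>

definition "rho = eta * (real m + 1)"
definition "V k \<omega> = async_msgd eta mu tau (\<lambda>k. X k \<omega>) v0 k"
definition "W k \<omega> = V (k - tau k) \<omega>"
text \<open>The heavy-ball average turns the momentum recursion into one without momentum and with
  step size \<open>kap * eta\<close>.  For \<open>k = 0\<close> the truncated \<open>k - 1\<close> is again \<open>0\<close>, so \<open>Z 0 = v0\<close>.\<close>
definition "Z k \<omega> = V k \<omega> + (mu * kap) *\<^sub>R (V k \<omega> - V (k - 1) \<omega>)"
definition "g k \<omega> = oja (W k \<omega>) (X k \<omega>)"
definition "e k \<omega> = (norm (Z k \<omega>))\<^sup>2 - 1"

lemma kap: "1 \<le> kap" "mu * kap = kap - 1"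
  using mu by (auto simp: kap_def field_simps)

lemma G: "10 \<le> G" "C\<^sup>2 = G / 10"
  using C one_le_power[of C 2] by (auto simp: G_def)

lemma eta_rho: "eta \<le> rho" "0 < rho"
  using eta by (auto simp: rho_def)

lemma V_init [simp]: "V 0 \<omega> = v0" "V (Suc 0) \<omega> = v0"
  by (simp_all add: V_def)

lemma V_Suc: "1 \<le> k \<Longrightarrow> V (Suc k) \<omega> = V k \<omega> + mu *\<^sub>R (V k \<omega> - V (k - 1) \<omega>) + eta *\<^sub>R g k \<omega>"
  by (simp add: V_def W_def g_def async_msgd_Suc)

lemma Z_init [simp]: "Z 0 \<omega> = v0" "Z (Suc 0) \<omega> = v0"
  by (simp_all add: Z_def)

text \<open>The momentum terms collapse because \<open>1 + mu * kap = kap\<close>: the old increment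
  receives the weight \<open>mu * (1 + mu * kap) = mu * kap\<close>, which is its weight in
  \<open>Z k\<close>.\<close>

lemma Z_Suc:
  assumes "1 \<le> k"
  shows "Z (Suc k) \<omega> = Z k \<omega> + (kap * eta) *\<^sub>R g k \<omega>"
proof -
  define d where "d = V k \<omega> - V (k - 1) \<omega>"
  have "Z (Suc k) \<omega> = V k \<omega> + (mu *\<^sub>R d + eta *\<^sub>R g k \<omega>)
      + (mu * kap) *\<^sub>R (mu *\<^sub>R d + eta *\<^sub>R g k \<omega>)"
    using assms by (simp add: Z_def V_Suc d_def)
  also have "\<dots> = V k \<omega> + (mu * (1 + mu * kap)) *\<^sub>R d + ((1 + mu * kap) * eta) *\<^sub>R g k \<omega>"
    by (simp add: algebra_simps)
  also have "\<dots> = Z k \<omega> + (kap * eta) *\<^sub>R g k \<omega>"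
    using kap by (simp add: Z_def d_def)
  finally show ?thesis .
qed

lemma e_init [simp]: "e 0 \<omega> = 0" "e (Suc 0) \<omega> = 0"
  by (simp_all add: e_def v0)

lemma norm_g_le:
  assumes "norm (W k \<omega>) \<le> 2"
  shows "norm (g k \<omega>) \<le> G"
  using norm_oja_le[OF assms X_bound] by (simp add: g_def G_def)

text \<open>The excess \<open>e\<close> of the squared norm is damped by the random factor \<open>1 - a k \<in> [0, 1]\<close>. Only this sign
  keeps its bound linear in the time horizon; a Gronwall estimate would let it grow like a power of \<open>delta\<^sup>2 / eta\<close>.\<close>
definition "c k \<omega> = (norm (Z k \<omega>))\<^sup>2 - (norm (W k \<omega>))\<^sup>2"
definition "a k \<omega> = 2 * (kap * eta) * (X k \<omega> \<bullet> W k \<omega>)\<^sup>2"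

text \<open>To first order the squared norm changes through \<open>W \<bullet> g = (X \<bullet>
  W)\<^sup>2 * (1 - (norm W)\<^sup>2)\<close>, and \<open>1 - (norm W)\<^sup>2 = c - e\<close>.
  Hence the damping of \<open>e\<close>; staleness sits in \<open>c\<close> and in the term with
  \<open>Z - W\<close>.\<close>

lemma e_Suc:
  assumes "1 \<le> k"
  shows "e (Suc k) \<omega> = (1 - a k \<omega>) * e k \<omega> + a k \<omega> * c k \<omega>
    + 2 * (kap * eta) * ((Z k \<omega> - W k \<omega>) \<bullet> g k \<omega>) + (kap * eta)\<^sup>2 * (norm (g k \<omega>))\<^sup>2"
proof -
  have "W k \<omega> \<bullet> g k \<omega> = (X k \<omega> \<bullet> W k \<omega>)\<^sup>2 * (1 - (norm (W k \<omega>))\<^sup>2)"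
    unfolding power2_norm_eq_inner
    by (simp add: g_def inner_oja inner_simps power2_eq_square algebra_simps)
  moreover have "e (Suc k) \<omega> = e k \<omega> + 2 * (kap * eta) * (Z k \<omega> \<bullet> g k \<omega>)
      + (kap * eta)\<^sup>2 * (norm (g k \<omega>))\<^sup>2"
    unfolding e_def Z_Suc[OF assms] power2_norm_eq_inner
    by (simp add: inner_simps power2_eq_square inner_commute)
  ultimately have "e (Suc k) \<omega> = e k \<omega> + 2 * (kap * eta) * ((X k \<omega> \<bullet> W k \<omega>)\<^sup>2 * (1 - (norm (W k \<omega>))\<^sup>2)
      + (Z k \<omega> - W k \<omega>) \<bullet> g k \<omega>) + (kap * eta)\<^sup>2 * (norm (g k \<omega>))\<^sup>2"
    by (simp add: inner_diff_left)
  then show ?thesis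
    by (simp add: a_def c_def e_def algebra_simps)
qed

end

section \<open>Uniform bounds on all paths up to a time horizon\<close>

locale msgd_paths_small = msgd_paths +
  fixes T :: real
  assumes T: "1 \<le> T"
    and small: "8 * kap ^ 3 * G\<^sup>2 * T * rho \<le> 1"
begin

text \<open>\<open>kap * eta * G\<close> is the fixed point of \<open>x = mu * x + eta * G\<close>.
  The ball of radius 2 is assumed up to index \<open>k\<close> and the conclusion reaches
  \<open>Suc k\<close>, so that this and the next lemmas can serve inside the induction that
  establishes the ball.\<close>

lemma V_step_le:
  assumes "\<And>j. j \<le> k \<Longrightarrow> norm (V j \<omega>) \<le> 2" "j \<le> k"
  shows "norm (V (Suc j) \<omega> - V j \<omega>) \<le> kap * eta * G"
  using assms(2)
proof (induction j)
  case 0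
  show ?case using kap eta G by simp
next
  case (Suc j)
  have "norm (V (Suc (Suc j)) \<omega> - V (Suc j) \<omega>) \<le> mu * norm (V (Suc j) \<omega> - V j \<omega>) + eta * norm (g (Suc j) \<omega>)"
    using mu eta V_Suc[of "Suc j" \<omega>] norm_triangle_ineq[of "mu *\<^sub>R (V (Suc j) \<omega> - V j \<omega>)" "eta *\<^sub>R g (Suc j) \<omega>"]
    by simp
  also have "\<dots> \<le> mu * (kap * eta * G) + eta * G"
    using mu eta Suc assms(1) by (intro add_mono mult_left_mono norm_g_le) (auto simp: W_def)
  also have "\<dots> = (mu * kap + 1) * eta * G"
    by (simp add: algebra_simps)
  finally show ?case
    using kap by simp
qed

lemma V_diff_le:
  assumes "\<And>j. j \<le> k \<Longrightarrow> norm (V j \<omega>) \<le> 2" "i \<le> j" "j \<le> Suc k"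
  shows "norm (V j \<omega> - V i \<omega>) \<le> real (j - i) * (kap * eta * G)"
  using assms(2,3)
proof (induction j rule: dec_induct)
  case base
  show ?case by simp
next
  case (step j)
  have "norm (V (Suc j) \<omega> - V i \<omega>) \<le> norm (V (Suc j) \<omega> - V j \<omega>) + norm (V j \<omega> - V i \<omega>)"
    using norm_triangle_ineq[of "V (Suc j) \<omega> - V j \<omega>" "V j \<omega> - V i \<omega>"] by simp
  also have "\<dots> \<le> kap * eta * G + real (j - i) * (kap * eta * G)"
    using step assms(1) by (intro add_mono V_step_le) auto
  also have "\<dots> = real (Suc j - i) * (kap * eta * G)"
    using step by (simp add: Suc_diff_le algebra_simps)
  finally show ?case .
qed

lemma Z_V_diff_le:
  assumes "\<And>j. j \<le> k \<Longrightarrow> norm (V j \<omega>) \<le> 2" "j \<le> Suc k"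
  shows "norm (Z j \<omega> - V j \<omega>) \<le> (kap - 1) * (kap * eta * G)"
proof -
  have "norm (Z j \<omega> - V j \<omega>) = (kap - 1) * norm (V j \<omega> - V (j - 1) \<omega>)"
    using kap mu by (simp add: Z_def abs_mult)
  also have "\<dots> \<le> (kap - 1) * (real (j - (j - 1)) * (kap * eta * G))"
    using kap assms by (intro mult_left_mono V_diff_le) auto
  also have "\<dots> \<le> (kap - 1) * (1 * (kap * eta * G))"
    using kap eta G by (intro mult_left_mono mult_right_mono) auto
  finally show ?thesis by simp
qed

lemma Z_W_diff_le:
  assumes "\<And>j. j \<le> k \<Longrightarrow> norm (V j \<omega>) \<le> 2" "1 \<le> j" "j \<le> Suc k"
  shows "norm (Z j \<omega> - W j \<omega>) \<le> kap\<^sup>2 * G * rho"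
proof -
  have "norm (Z j \<omega> - W j \<omega>) \<le> norm (Z j \<omega> - V j \<omega>) + norm (V j \<omega> - V (j - tau j) \<omega>)"
    using norm_triangle_ineq[of "Z j \<omega> - V j \<omega>" "V j \<omega> - V (j - tau j) \<omega>"] by (simp add: W_def)
  also have "\<dots> \<le> (kap - 1) * (kap * eta * G) + real (j - (j - tau j)) * (kap * eta * G)"
    using assms by (intro add_mono Z_V_diff_le V_diff_le) auto
  also have "\<dots> \<le> (kap - 1) * (kap * eta * G) + real m * (kap * eta * G)"
    using assms tau[of j] kap eta G by (intro add_mono mult_right_mono) auto
  also have "\<dots> \<le> kap\<^sup>2 * G * rho"
  proof -
    have "kap - 1 + real m \<le> kap * (real m + 1)"
      using kap mult_right_mono[of 1 kap "real m"] by (simp add: algebra_simps)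
    from mult_right_mono[OF this, of "kap * eta * G"] show ?thesis
      using kap eta G by (simp add: rho_def power2_eq_square algebra_simps)
  qed
  finally show ?thesis .
qed

lemma small_consequences:
  "kap\<^sup>2 * G * rho \<le> 1 / 4" "kap\<^sup>2 * G * eta \<le> 1 / 4" "kap * G * eta \<le> 1"
proof -
  have "1 * 1 \<le> kap * T"
    using kap T by (intro mult_mono) auto
  then have "10 * 1 \<le> G * (kap * T)"
    using G by (intro mult_mono) auto
  then have "(kap\<^sup>2 * G * rho) * 80 \<le> (kap\<^sup>2 * G * rho) * (8 * (G * (kap * T)))"
    using kap G(1) eta_rho by (intro mult_left_mono) (linarith, simp)
  also have "\<dots> = 8 * kap ^ 3 * G\<^sup>2 * T * rho"
    by (simp add: power3_eq_cube power2_eq_square)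
  finally show r: "kap\<^sup>2 * G * rho \<le> 1 / 4"
    using small by (simp add: mult_ac)
  have "kap\<^sup>2 * G * eta \<le> kap\<^sup>2 * G * rho"
    using kap G eta_rho by (intro mult_left_mono) auto
  with r show e: "kap\<^sup>2 * G * eta \<le> 1 / 4" by simp
  have "kap * G * eta \<le> (kap * G * eta) * kap"
    using mult_left_mono[of 1 kap "kap * G * eta"] kap G eta by simp
  with e show "kap * G * eta \<le> 1"
    by (simp add: power2_eq_square mult_ac)
qed

text \<open>The error constant of one step of \<open>e\<close>, with \<open>8 = 5 + 2 + 1\<close>: 5
  from the norm mismatch \<open>c\<close>, 2 from the inner product with \<open>Z - W\<close>, 1
  from the squared step.\<close>

definition "E1 = 8 * kap ^ 3 * G\<^sup>2"

lemma a_bounds: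
  assumes "norm (W k \<omega>) \<le> 2"
  shows "0 \<le> a k \<omega>" "a k \<omega> \<le> kap * G * eta" "a k \<omega> \<le> 1"
proof -
  show "0 \<le> a k \<omega>"
    using kap eta by (simp add: a_def)
  have "\<bar>X k \<omega> \<bullet> W k \<omega>\<bar> \<le> C * 2"
    by (rule order_trans[OF Cauchy_Schwarz_ineq2 mult_mono]) (use assms X_bound C in auto)
  then have "(X k \<omega> \<bullet> W k \<omega>)\<^sup>2 \<le> (C * 2)\<^sup>2"
    using abs_le_square_iff[of "X k \<omega> \<bullet> W k \<omega>" "C * 2"] C by simp
  also have "\<dots> \<le> G / 2"
    by (simp add: G_def power_mult_distrib)
  finally have "a k \<omega> \<le> 2 * (kap * eta) * (G / 2)"
    unfolding a_def using kap eta by (intro mult_left_mono) auto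
  then show "a k \<omega> \<le> kap * G * eta" by (simp add: mult_ac)
  then show "a k \<omega> \<le> 1" using small_consequences by simp
qed

lemma norm_sq_diff_le:
  fixes z w :: "real^'n"
  assumes "norm (z - w) \<le> b" "norm w \<le> 2" "b \<le> 1"
  shows "\<bar>(norm z)\<^sup>2 - (norm w)\<^sup>2\<bar> \<le> 5 * b"
proof -
  have "norm z \<le> norm w + b" "norm w \<le> norm z + b"
    using assms(1) norm_triangle_ineq2[of z w] norm_triangle_ineq2[of w z]
    by (simp_all add: norm_minus_commute)
  then have d: "\<bar>norm z - norm w\<bar> \<le> b" by simp
  have s: "norm z + norm w \<le> 5"
    using \<open>norm z \<le> norm w + b\<close> assms by simp
  have "\<bar>(norm z)\<^sup>2 - (norm w)\<^sup>2\<bar> = \<bar>norm z - norm w\<bar> * (norm z + norm w)"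
    by (simp add: power2_eq_square square_diff_square_factored abs_mult)
  also have "\<dots> \<le> b * 5"
    using d s by (intro mult_mono) auto
  finally show ?thesis by simp
qed

lemma e_step:
  assumes "\<And>j. j \<le> k \<Longrightarrow> norm (V j \<omega>) \<le> 2" "1 \<le> j" "j \<le> k"
  shows "\<bar>e (Suc j) \<omega> - (1 - a j \<omega>) * e j \<omega>\<bar> \<le> E1 * eta * rho"
proof -
  have W: "norm (W j \<omega>) \<le> 2"
    using assms by (auto simp: W_def)
  have ZW: "norm (Z j \<omega> - W j \<omega>) \<le> kap\<^sup>2 * G * rho"
    using assms by (intro Z_W_diff_le[of k]) auto
  have c: "\<bar>c j \<omega>\<bar> \<le> 5 * (kap\<^sup>2 * G * rho)"
    unfolding c_def using ZW W small_consequences by (intro norm_sq_diff_le) auto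
  have g: "norm (g j \<omega>) \<le> G"
    by (rule norm_g_le[OF W])
  have "\<bar>e (Suc j) \<omega> - (1 - a j \<omega>) * e j \<omega>\<bar> \<le> \<bar>a j \<omega> * c j \<omega>\<bar>
      + \<bar>2 * (kap * eta) * ((Z j \<omega> - W j \<omega>) \<bullet> g j \<omega>)\<bar> + (kap * eta)\<^sup>2 * (norm (g j \<omega>))\<^sup>2"
  proof -
    have "e (Suc j) \<omega> - (1 - a j \<omega>) * e j \<omega> = a j \<omega> * c j \<omega>
      + 2 * (kap * eta) * ((Z j \<omega> - W j \<omega>) \<bullet> g j \<omega>) + (kap * eta)\<^sup>2 * (norm (g j \<omega>))\<^sup>2"
      unfolding e_Suc[OF assms(2)] by simp
    moreover have "0 \<le> (kap * eta)\<^sup>2 * (norm (g j \<omega>))\<^sup>2" by simp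
    ultimately show ?thesis by linarith
  qed
  also have "\<dots> \<le> (kap * G * eta) * (5 * (kap\<^sup>2 * G * rho))
      + 2 * (kap * eta) * ((kap\<^sup>2 * G * rho) * G) + (kap * eta)\<^sup>2 * G\<^sup>2"
  proof (intro add_mono)
    show "\<bar>a j \<omega> * c j \<omega>\<bar> \<le> (kap * G * eta) * (5 * (kap\<^sup>2 * G * rho))"
      using a_bounds[OF W] c unfolding abs_mult by (intro mult_mono) auto
    have "\<bar>(Z j \<omega> - W j \<omega>) \<bullet> g j \<omega>\<bar> \<le> (kap\<^sup>2 * G * rho) * G"
      by (rule order_trans[OF Cauchy_Schwarz_ineq2 mult_mono]) (use ZW g kap G eta_rho in auto)
    then show "\<bar>2 * (kap * eta) * ((Z j \<omega> - W j \<omega>) \<bullet> g j \<omega>)\<bar> \<le> 2 * (kap * eta) * ((kap\<^sup>2 * G * rho) * G)"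
      using kap eta by (simp add: abs_mult)
    show "(kap * eta)\<^sup>2 * (norm (g j \<omega>))\<^sup>2 \<le> (kap * eta)\<^sup>2 * G\<^sup>2"
      using g by (intro mult_left_mono power_mono) auto
  qed
  also have "\<dots> \<le> (kap * G * eta) * (5 * (kap\<^sup>2 * G * rho))
      + 2 * (kap * eta) * ((kap\<^sup>2 * G * rho) * G) + (kap * kap * eta) * (kap * rho) * G\<^sup>2"
  proof -
    \<comment> \<open>The squared step is of order \<open>eta\<^sup>2\<close>; one factor is traded
      for \<open>kap * rho\<close> so that it joins the other two terms.\<close>
    have "eta \<le> kap * rho"
      using kap eta_rho mult_mono[of 1 kap eta rho] eta by simp
    then have "(kap * eta)\<^sup>2 \<le> (kap * kap * eta) * (kap * rho)"
      using mult_left_mono[of eta "kap * rho" "kap * kap * eta"] kap eta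
      by (simp add: power2_eq_square mult_ac)
    from mult_right_mono[OF this, of "G\<^sup>2"] show ?thesis by simp
  qed
  also have "\<dots> \<le> E1 * eta * rho"
    using kap eta eta_rho G by (simp add: E1_def power2_eq_square power3_eq_cube algebra_simps)
  finally show ?thesis .
qed

text \<open>A bootstrap: the excess at \<open>Suc j\<close> needs the ball up to \<open>j\<close>,
  and the ball at \<open>Suc j\<close> follows from the excess. As the damping factor lies in
  \<open>[0, 1]\<close>, errors merely add up, to at most \<open>E1 * rho * T\<close>, which the
  assumption \<open>small\<close> caps at 1. Then \<open>norm Z \<le> 3/2\<close>, and the distance
  of at most \<open>1/4\<close> between \<open>Z\<close> and \<open>V\<close> leaves
  \<open>norm V \<le> 2\<close>.\<close>

lemma V_e_bound:
  assumes "real k * eta \<le> T"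
  shows "norm (V k \<omega>) \<le> 2 \<and> \<bar>e k \<omega>\<bar> \<le> E1 * rho * (real k * eta)"
  using assms
proof (induction k rule: less_induct)
  case (less k)
  show ?case
  proof (cases "k \<le> 1")
    case True
    then have "k = 0 \<or> k = Suc 0" by auto
    then show ?thesis
      using v0 kap eta G eta_rho by (auto simp: E1_def)
  next
    case False
    then obtain j where j: "k = Suc j" "1 \<le> j" by (cases k) auto
    have mono: "real i * eta \<le> T" if "i \<le> j" for i
      using less.prems that j eta by (intro order_trans[OF mult_right_mono[of "real i" "real k" eta]]) auto
    have V: "norm (V i \<omega>) \<le> 2" if "i \<le> j" for i
      using less.IH[of i] mono[of i] that j by auto
    then have W: "norm (W j \<omega>) \<le> 2" by (auto simp: W_def)
    have "\<bar>e k \<omega>\<bar> \<le> \<bar>e (Suc j) \<omega> - (1 - a j \<omega>) * e j \<omega>\<bar> + \<bar>(1 - a j \<omega>) * e j \<omega>\<bar>"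
      using j by simp
    also have "\<dots> \<le> E1 * eta * rho + \<bar>e j \<omega>\<bar>"
      using a_bounds[OF W] V j by (intro add_mono e_step[of j]) (auto simp: abs_mult intro: mult_left_le_one_le)
    also have "\<dots> \<le> E1 * eta * rho + E1 * rho * (real j * eta)"
      using less.IH[of j] mono[of j] j by auto
    also have "\<dots> = E1 * rho * (real k * eta)"
      using j by (simp add: algebra_simps)
    finally have e: "\<bar>e k \<omega>\<bar> \<le> E1 * rho * (real k * eta)" .
    have "E1 * rho * (real k * eta) \<le> E1 * rho * T"
      using less.prems kap eta_rho by (intro mult_left_mono) (auto simp: E1_def)
    also have "\<dots> \<le> 1"
      using small by (simp add: E1_def mult_ac)
    finally have "(norm (Z k \<omega>))\<^sup>2 \<le> (3/2)\<^sup>2"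
      using e by (auto simp: e_def power2_eq_square)
    then have Z: "norm (Z k \<omega>) \<le> 3/2"
      by (rule power2_le_imp_le) simp
    have "norm (Z k \<omega> - V k \<omega>) \<le> (kap - 1) * (kap * eta * G)"
      using V j by (intro Z_V_diff_le[of j]) auto
    also have "\<dots> \<le> kap\<^sup>2 * G * eta"
      using kap eta G by (simp add: power2_eq_square algebra_simps)
    also have "\<dots> \<le> 1/4"
      by (rule small_consequences)
    finally have "norm (V k \<omega>) \<le> 2"
      using Z norm_triangle_ineq2[of "V k \<omega>" "Z k \<omega>"] by (simp add: norm_minus_commute)
    with e show ?thesis by simp
  qed
qed

context
  fixes k :: nat
  assumes k: "real k * eta \<le> T"
begin

lemma time_le: "j \<le> k \<Longrightarrow> real j * eta \<le> T"
  using k eta by (intro order_trans[OF mult_right_mono[of "real j" "real k" eta]]) auto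

lemma V_le: "norm (V k \<omega>) \<le> 2"
  using V_e_bound[OF k] by simp

lemma V_le': "j \<le> k \<Longrightarrow> norm (V j \<omega>) \<le> 2"
  using V_e_bound time_le by blast

lemma W_le: "norm (W k \<omega>) \<le> 2"
  by (simp add: W_def V_le')

lemma g_le: "norm (g k \<omega>) \<le> G"
  by (rule norm_g_le[OF W_le])

lemma Z_V_le: "norm (Z k \<omega> - V k \<omega>) \<le> kap\<^sup>2 * G * eta"
proof -
  have "norm (Z k \<omega> - V k \<omega>) \<le> (kap - 1) * (kap * eta * G)"
    using V_le' by (intro Z_V_diff_le[of k]) auto
  also have "\<dots> \<le> kap * (kap * eta * G)"
    using kap eta G by (intro mult_right_mono) auto
  finally show ?thesis
    by (simp add: power2_eq_square mult_ac)
qed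

lemma Z_W_le: "1 \<le> k \<Longrightarrow> norm (Z k \<omega> - W k \<omega>) \<le> kap\<^sup>2 * G * rho"
  using V_le' by (intro Z_W_diff_le[of k]) auto

lemma Z_V_sq_le: "\<bar>(norm (Z k \<omega>))\<^sup>2 - (norm (V k \<omega>))\<^sup>2\<bar> \<le> 5 * (kap\<^sup>2 * G * eta)"
  using small_consequences by (intro norm_sq_diff_le Z_V_le V_le) auto

lemma e_le: "\<bar>e k \<omega>\<bar> \<le> E1 * rho * T"
proof -
  have "E1 * rho * (real k * eta) \<le> E1 * rho * T"
    using k kap eta_rho by (intro mult_left_mono) (auto simp: E1_def)
  then show ?thesis
    using V_e_bound[OF k, of \<omega>] by simp
qed

end

text \<open>\<open>Z\<close> moves by order \<open>eta\<close> in a step, its squared norm only by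
  order \<open>rho * eta\<close>: up to staleness the radial part of the update is proportional to
  the excess, which is itself of order \<open>rho\<close>.\<close>

lemma e_increment_le:
  assumes "1 \<le> j" "real j * eta \<le> T"
  shows "\<bar>e (Suc j) \<omega> - e j \<omega>\<bar> \<le> 2 * kap * G * E1 * T * rho * eta"
proof -
  have "\<bar>e (Suc j) \<omega> - e j \<omega>\<bar> \<le> \<bar>e (Suc j) \<omega> - (1 - a j \<omega>) * e j \<omega>\<bar> + a j \<omega> * \<bar>e j \<omega>\<bar>"
  proof -
    have "e (Suc j) \<omega> - e j \<omega> = (e (Suc j) \<omega> - (1 - a j \<omega>) * e j \<omega>) - a j \<omega> * e j \<omega>"
      by (simp add: algebra_simps)
    then show ?thesis
      using a_bounds[OF W_le[OF assms(2)]] abs_triangle_ineq4[of "e (Suc j) \<omega> - (1 - a j \<omega>) * e j \<omega>" "a j \<omega> * e j \<omega>"]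
      by (simp add: abs_mult)
  qed
  also have "\<dots> \<le> E1 * eta * rho + (kap * G * eta) * (E1 * rho * T)"
    using assms a_bounds[OF W_le[OF assms(2)]] e_le V_le'
    using kap G eta by (intro add_mono mult_mono e_step[of j]) auto
  also have "\<dots> \<le> kap * G * T * (E1 * eta * rho) + (kap * G * eta) * (E1 * rho * T)"
  proof -
    have "1 \<le> kap * G" using mult_mono[of 1 kap 1 G] kap G by simp
    then have "1 \<le> kap * G * T" using mult_mono[of 1 "kap * G" 1 T] T by simp
    from mult_right_mono[OF this, of "E1 * eta * rho"] show ?thesis
      using kap eta eta_rho by (simp add: E1_def mult_ac)
  qed
  finally show ?thesis by (simp add: algebra_simps)
qed

lemma e_diff_le:
  assumes "i \<le> j" "real j * eta \<le> T"
  shows "\<bar>e j \<omega> - e i \<omega>\<bar> \<le> real (j - i) * (2 * kap * G * E1 * T * rho * eta)" (is "_ \<le> _ * ?r")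
  using assms
proof (induction j rule: dec_induct)
  case base
  show ?case by simp
next
  case (step j)
  have nn: "0 \<le> ?r"
    using kap G T eta eta_rho by (simp add: E1_def)
  have j: "real j * eta \<le> T"
    using time_le[OF step.prems, of j] by simp
  have "\<bar>e (Suc j) \<omega> - e j \<omega>\<bar> \<le> ?r"
    using nn e_increment_le[OF _ j] by (cases "j = 0") auto
  then have "\<bar>e (Suc j) \<omega> - e i \<omega>\<bar> \<le> ?r
      + real (j - i) * ?r"
    using step.IH[OF j] by linarith
  also have "\<dots> = real (Suc j - i) * ?r"
    using step by (simp add: Suc_diff_le algebra_simps)
  finally show ?case .
qed

text \<open>Comparing norms through the distance of \<open>Z\<close> and \<open>W\<close> would give
  order \<open>rho\<close>. Going back to the index \<open>k - tau k\<close> and using that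
  \<open>e\<close> varies slowly gives \<open>rho\<^sup>2\<close>; the remaining \<open>eta\<close>
  is the distance between \<open>Z\<close> and \<open>V\<close> at that index.\<close>

lemma c_le:
  assumes "1 \<le> k" "real k * eta \<le> T"
  shows "\<bar>c k \<omega>\<bar> \<le> 2 * kap * G * E1 * T * rho\<^sup>2 + 5 * (kap\<^sup>2 * G * eta)"
proof -
  define j where "j = k - tau k"
  have j: "j \<le> k" "real j * eta \<le> T"
    using time_le[OF assms(2), of j] by (auto simp: j_def)
  have nn: "0 \<le> 2 * kap * G * E1 * T * rho"
    using kap G T eta_rho by (simp add: E1_def)
  have "c k \<omega> = (e k \<omega> - e j \<omega>) + ((norm (Z j \<omega>))\<^sup>2 - (norm (V j \<omega>))\<^sup>2)"
    by (simp add: c_def e_def W_def j_def)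
  then have "\<bar>c k \<omega>\<bar> \<le> real (k - j) * (2 * kap * G * E1 * T * rho * eta) + 5 * (kap\<^sup>2 * G * eta)"
    using e_diff_le[OF j(1) assms(2), of \<omega>] Z_V_sq_le[OF j(2), of \<omega>] by linarith
  also have "real (k - j) * (2 * kap * G * E1 * T * rho * eta) = 2 * kap * G * E1 * T * rho * (real (k - j) * eta)"
    by simp
  also have "\<dots> \<le> 2 * kap * G * E1 * T * rho * rho"
    using nn tau[OF assms(1)] eta by (intro mult_left_mono) (auto simp: rho_def j_def mult.commute)
  finally show ?thesis
    by (simp add: power2_eq_square)
qed

end

section \<open>Histories\<close>

context prob_space
begin

text \<open>The sigma-algebra generated by the samples with index below \<open>k\<close>. As a
  pullback along the tuple of these samples it is directly accessible to the independence of
  disjoint blocks of samples.\<close>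

definition hist :: "(nat \<Rightarrow> 'a \<Rightarrow> 'b::topological_space) \<Rightarrow> nat \<Rightarrow> 'a measure" where
  "hist X k = vimage_algebra (space M) (\<lambda>\<omega>. \<lambda>j\<in>{..<k}. X j \<omega>) (PiM {..<k} (\<lambda>_. borel))"

lemma space_hist [simp]: "space (hist X k) = space M"
  by (simp add: hist_def)

lemma sets_hist:
  "sets (hist X k) = {(\<lambda>\<omega>. \<lambda>j\<in>{..<k}. X j \<omega>) -` A \<inter> space M |A. A \<in> sets (PiM {..<k} (\<lambda>_. borel))}"
  unfolding hist_def by (rule sets_vimage_algebra2) (auto simp: space_PiM)

lemma measurable_hist: "j < k \<Longrightarrow> X j \<in> measurable (hist X k) borel"
proof -
  assume j: "j < k"
  have "(\<lambda>\<omega>. (\<lambda>j\<in>{..<k}. X j \<omega>) j) \<in> measurable (hist X k) borel"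
    unfolding hist_def
  proof (rule measurable_compose[OF measurable_vimage_algebra1 measurable_component_singleton])
    show "(\<lambda>\<omega>. \<lambda>j\<in>{..<k}. X j \<omega>) \<in> space M \<rightarrow> space (PiM {..<k} (\<lambda>_. borel))"
      by (auto simp: space_PiM)
  qed (use j in simp)
  then show ?thesis using j by simp
qed

lemma sets_hist_subset:
  assumes "space N = space M" "\<And>j. j < k \<Longrightarrow> X j \<in> measurable N borel"
  shows "sets (hist X k) \<subseteq> sets N"
proof -
  have "(\<lambda>\<omega>. \<lambda>j\<in>{..<k}. X j \<omega>) \<in> measurable N (PiM {..<k} (\<lambda>_. borel))"
    using assms(2) by (intro measurable_restrict) auto
  from measurable_sets[OF this] show ?thesis
    unfolding sets_hist assms(1) by blast
qed

lemma measurable_hist_mono: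
  assumes "A \<in> measurable (hist X k) N" "k \<le> l"
  shows "A \<in> measurable (hist X l) N"
proof -
  have "sets (hist X k) \<subseteq> sets (hist X l)"
    using assms(2) by (intro sets_hist_subset measurable_hist) auto
  then show ?thesis
    using assms(1) by (auto simp: measurable_def)
qed

lemma measurable_hist_M:
  assumes "A \<in> measurable (hist X k) N" "\<And>j. X j \<in> measurable M borel"
  shows "A \<in> measurable M N"
proof -
  have "sets (hist X k) \<subseteq> sets M"
    using assms(2) by (intro sets_hist_subset) auto
  then show ?thesis
    using assms(1) by (auto simp: measurable_def)
qed

lemma integrable_bounded:
  fixes f :: "'a \<Rightarrow> 'c::{banach, second_countable_topology}"
  assumes "f \<in> borel_measurable M" "\<And>\<omega>. norm (f \<omega>) \<le> B"
  shows "integrable M f"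
  using assms by (intro integrable_const_bound[of _ B]) auto

lemma integrable_bounded_square:
  fixes f :: "'a \<Rightarrow> real"
  assumes "f \<in> borel_measurable M" "\<And>\<omega>. \<bar>f \<omega>\<bar> \<le> B"
  shows "integrable M (\<lambda>\<omega>. (f \<omega>)\<^sup>2)"
  using assms power_mono[OF assms(2) abs_ge_zero, where n = 2] by (intro integrable_bounded[of _ "B\<^sup>2"]) auto

lemma expectation_le:
  fixes f :: "'a \<Rightarrow> real"
  assumes "integrable M f" "\<And>\<omega>. f \<omega> \<le> B"
  shows "expectation f \<le> B"
proof -
  have "expectation f \<le> expectation (\<lambda>_. B)"
    using assms by (intro integral_mono) auto
  then show ?thesis by (simp add: prob_space)
qed

text \<open>This product rule does the work of conditional expectation given the past. The blocks
  \<open>{..<k}\<close> and \<open>{k}\<close> are independent, and the sigma-algebras of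
  \<open>A\<close> and of \<open>\<phi> (X k)\<close> are contained in those of the two
  blocks.\<close>

lemma expectation_hist_indep:
  fixes A :: "'a \<Rightarrow> real" and \<phi> :: "'b::{topological_space,second_countable_topology} \<Rightarrow> real"
  assumes indep: "indep_vars (\<lambda>_. borel) X UNIV"
    and A: "A \<in> borel_measurable (hist X k)" "\<And>\<omega>. \<bar>A \<omega>\<bar> \<le> B"
    and \<phi>: "\<phi> \<in> borel_measurable borel" "\<And>\<omega>. \<bar>\<phi> (X k \<omega>)\<bar> \<le> B'"
  shows "expectation (\<lambda>\<omega>. A \<omega> * \<phi> (X k \<omega>)) = expectation A * expectation (\<lambda>\<omega>. \<phi> (X k \<omega>))"
proof -
  have X [measurable]: "X j \<in> borel_measurable M" for j
    using indep by (auto simp: indep_vars_def)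
  have A' [measurable]: "A \<in> borel_measurable M"
    by (rule measurable_hist_M[OF A(1) X])
  have \<phi>' [measurable]: "(\<lambda>\<omega>. \<phi> (X k \<omega>)) \<in> borel_measurable M"
    by (rule measurable_compose[OF X \<phi>(1)])
  let ?P = "\<lambda>K \<omega>. restrict (\<lambda>i. X i \<omega>) K"
  let ?A = "\<lambda>K. {?P K -` A \<inter> space M |A. A \<in> sets (PiM K (\<lambda>_. borel))}"
  let ?B = "\<lambda>f :: 'a \<Rightarrow> real. {f -` A \<inter> space M |A. A \<in> sets borel}"
  have ind: "indep_var (PiM {..<k} (\<lambda>_. borel)) (?P {..<k}) (PiM {k} (\<lambda>_. borel)) (?P {k})"
    by (rule indep_var_restrict[OF indep]) auto
  have "indep_var borel A borel (\<lambda>\<omega>. \<phi> (X k \<omega>))"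
    unfolding indep_var_eq
  proof (intro conjI A' \<phi>')
    have slope: "indep_set (sigma_sets (space M) (?A {..<k})) (sigma_sets (space M) (?A {k}))"
      using ind unfolding indep_var_eq by simp
    have AB: "sigma_sets (space M) (?B A) \<subseteq> sigma_sets (space M) (?A {..<k})"
      using measurable_sets[OF A(1)] unfolding sets_hist space_hist
      by (intro sigma_sets_subseteq) blast
    have "?B (\<lambda>\<omega>. \<phi> (X k \<omega>)) \<subseteq> ?A {k}"
    proof safe
      fix E :: "real set" assume "E \<in> sets borel"
      then have "(\<lambda>x. \<phi> (x k)) -` E \<inter> space (PiM {k} (\<lambda>_. borel)) \<in> sets (PiM {k} (\<lambda>_. borel))"
        by (intro measurable_sets[OF measurable_compose[OF _ \<phi>(1)]] measurable_component_singleton) auto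
      moreover have "(\<lambda>\<omega>. \<phi> (X k \<omega>)) -` E \<inter> space M
          = ?P {k} -` ((\<lambda>x. \<phi> (x k)) -` E \<inter> space (PiM {k} (\<lambda>_. borel))) \<inter> space M"
        by (auto simp: space_PiM)
      ultimately show "\<exists>A. (\<lambda>\<omega>. \<phi> (X k \<omega>)) -` E \<inter> space M = ?P {k} -` A \<inter> space M
          \<and> A \<in> sets (PiM {k} (\<lambda>_. borel))"
        by blast
    qed
    then have AC: "sigma_sets (space M) (?B (\<lambda>\<omega>. \<phi> (X k \<omega>))) \<subseteq> sigma_sets (space M) (?A {k})"
      by (rule sigma_sets_subseteq)
    show "indep_set (sigma_sets (space M) (?B A)) (sigma_sets (space M) (?B (\<lambda>\<omega>. \<phi> (X k \<omega>))))"
      using slope unfolding indep_set_def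
    proof (rule indep_sets_mono_sets)
      fix i :: bool
      show "(case i of True \<Rightarrow> sigma_sets (space M) (?B A) | False \<Rightarrow> sigma_sets (space M) (?B (\<lambda>\<omega>. \<phi> (X k \<omega>))))
        \<subseteq> (case i of True \<Rightarrow> sigma_sets (space M) (?A {..<k}) | False \<Rightarrow> sigma_sets (space M) (?A {k}))"
        using AB AC by (cases i) simp_all
    qed
  qed
  then show ?thesis
    using A(2) \<phi>(2) by (intro indep_var_lebesgue_integral integrable_bounded) auto
qed

end

section \<open>Moments of a single update given its past\<close>

locale msgd_process = prob_space M + msgd_paths_small X C eta mu tau m v0 T
  for M :: "'a measure" and X :: "nat \<Rightarrow> 'a \<Rightarrow> real^'n" and C eta mu tau m v0 T +
  fixes S :: "real^'n \<Rightarrow> real^'n"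
  assumes indep: "indep_vars (\<lambda>_. borel) X UNIV"
    and lin: "linear S"
    and cov: "expectation (\<lambda>\<omega>. (X k \<omega> \<bullet> u) * (X k \<omega> \<bullet> w)) = u \<bullet> S w"
begin

lemma X_meas [measurable]: "X k \<in> borel_measurable M"
  using indep by (auto simp: indep_vars_def)

definition "F k = hist X k"

lemma space_F [simp]: "space (F k) = space M"
  by (simp add: F_def)

lemma F_mono: "A \<in> measurable (F k) N \<Longrightarrow> k \<le> l \<Longrightarrow> A \<in> measurable (F l) N"
  unfolding F_def by (rule measurable_hist_mono)

lemma F_M: "A \<in> measurable (F k) N \<Longrightarrow> A \<in> measurable M N"
  unfolding F_def by (rule measurable_hist_M) auto

lemma X_F: "j < k \<Longrightarrow> X j \<in> borel_measurable (F k)"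
  unfolding F_def by (rule measurable_hist)

lemma V_F: "j \<le> k \<Longrightarrow> V j \<in> borel_measurable (F k)"
  unfolding V_def[abs_def] by (intro borel_measurable_async_msgd X_F) auto

lemma Z_F [measurable]: "Z k \<in> borel_measurable (F k)"
proof -
  have [measurable]: "V k \<in> borel_measurable (F k)" "V (k - 1) \<in> borel_measurable (F k)"
    by (auto intro: V_F)
  show ?thesis
    unfolding Z_def by measurable
qed

lemma W_F [measurable]: "W k \<in> borel_measurable (F k)"
  using V_F[of "k - tau k" k] by (simp add: W_def[abs_def])

lemma measurable_M [measurable]: "V k \<in> borel_measurable M" "Z k \<in> borel_measurable M" "W k \<in> borel_measurable M"
  "e k \<in> borel_measurable M" "g k \<in> borel_measurable M"
proof -
  show [measurable]: "V k \<in> borel_measurable M" "Z k \<in> borel_measurable M" "W k \<in> borel_measurable M"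
    using F_M[OF V_F[OF order_refl]] F_M[OF Z_F] F_M[OF W_F] by auto
  show "e k \<in> borel_measurable M" "g k \<in> borel_measurable M"
    unfolding e_def g_def oja_def by measurable
qed

lemma S_sym: "u \<bullet> S w = w \<bullet> S u"
  using cov[of 0 u w] cov[of 0 w u] by (simp add: mult.commute)

lemma S_meas [measurable]: "S \<in> borel_measurable borel"
  using lin by (intro borel_measurable_continuous_onI linear_continuous_on linear_conv_bounded_linear[THEN iffD1])

text \<open>The covariance form is tested with \<open>S u\<close> itself, and one factor
  \<open>norm (S u)\<close> cancels.\<close>

lemma norm_S_le: "norm (S u) \<le> C\<^sup>2 * norm u"
proof -
  have "(norm (S u))\<^sup>2 = expectation (\<lambda>\<omega>. (X 0 \<omega> \<bullet> S u) * (X 0 \<omega> \<bullet> u))"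
    by (simp add: cov power2_norm_eq_inner)
  also have "\<dots> \<le> (C * norm (S u)) * (C * norm u)"
  proof (rule expectation_le)
    have ab: "\<bar>X 0 \<omega> \<bullet> u\<bar> \<le> C * norm u" for u \<omega>
      by (rule order_trans[OF Cauchy_Schwarz_ineq2 mult_right_mono]) (use X_bound in auto)
    have b: "\<bar>(X 0 \<omega> \<bullet> S u) * (X 0 \<omega> \<bullet> u)\<bar> \<le> (C * norm (S u)) * (C * norm u)" for \<omega>
      unfolding abs_mult using C by (intro mult_mono ab) auto
    then show "integrable M (\<lambda>\<omega>. (X 0 \<omega> \<bullet> S u) * (X 0 \<omega> \<bullet> u))"
      by (intro integrable_bounded) auto
    show "(X 0 \<omega> \<bullet> S u) * (X 0 \<omega> \<bullet> u) \<le> (C * norm (S u)) * (C * norm u)" for \<omega>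
      using b[of \<omega>] by simp
  qed
  finally have "norm (S u) * norm (S u) \<le> norm (S u) * (C\<^sup>2 * norm u)"
    by (simp add: power2_eq_square mult_ac)
  then show ?thesis
    using C by (cases "norm (S u) = 0") (auto simp: mult_le_cancel_left)
qed

text \<open>The mean of \<open>oja w X\<close>, that is, the drift of the averaged dynamics. Among
  unit vectors its zeros are exactly the eigenvectors of \<open>S\<close>.\<close>

definition "f w = S w - (w \<bullet> S w) *\<^sub>R w"

lemma f_meas [measurable]: "f \<in> borel_measurable borel"
  unfolding f_def by measurable

text \<open>\<open>A\<close> and \<open>B\<close> are random but known before \<open>X k\<close> is
  drawn. Expansion in the standard basis leaves finitely many products of a history-measurable
  scalar and a function of \<open>X k\<close>, to which the product rule applies.\<close>

lemma expectation_bilinear: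
  assumes A: "A \<in> borel_measurable (F k)" "\<And>\<omega>. norm (A \<omega>) \<le> BA"
    and B: "B \<in> borel_measurable (F k)" "\<And>\<omega>. norm (B \<omega>) \<le> BB"
  shows "expectation (\<lambda>\<omega>. (X k \<omega> \<bullet> A \<omega>) * (X k \<omega> \<bullet> B \<omega>)) = expectation (\<lambda>\<omega>. A \<omega> \<bullet> S (B \<omega>))"
proof -
  note [measurable] = A(1) B(1) F_M[OF A(1)] F_M[OF B(1)]
  have nn: "0 \<le> BA" "0 \<le> BB"
    using A(2) B(2) norm_ge_zero order_trans by blast+
  have b: "\<bar>(A \<omega> \<bullet> i) * (B \<omega> \<bullet> j)\<bar> \<le> BA * BB" if "i \<in> Basis" "j \<in> Basis" for i j \<omega>
    unfolding abs_mult using nn that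
    by (intro mult_mono) (auto intro!: order_trans[OF Basis_le_norm] A B)
  have bX: "\<bar>(X k \<omega> \<bullet> i) * (X k \<omega> \<bullet> j)\<bar> \<le> C * C" if "i \<in> Basis" "j \<in> Basis" for i j \<omega>
    unfolding abs_mult using C that
    by (intro mult_mono) (auto intro!: order_trans[OF Basis_le_norm] X_bound)
  let ?ab = "\<lambda>i j \<omega>. (A \<omega> \<bullet> i) * (B \<omega> \<bullet> j)" and ?xx = "\<lambda>i j \<omega>. (X k \<omega> \<bullet> i) * (X k \<omega> \<bullet> j)"
  have exp: "(X k \<omega> \<bullet> A \<omega>) * (X k \<omega> \<bullet> B \<omega>)
      = (\<Sum>i\<in>Basis. \<Sum>j\<in>Basis. ?ab i j \<omega> * ?xx i j \<omega>)" for \<omega>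
    unfolding euclidean_inner[of "X k \<omega>" "A \<omega>"] euclidean_inner[of "X k \<omega>" "B \<omega>"] sum_product
    by (simp add: mult_ac)
  have expS: "A \<omega> \<bullet> S (B \<omega>) = (\<Sum>i\<in>Basis. \<Sum>j\<in>Basis. ?ab i j \<omega> * (i \<bullet> S j))" for \<omega>
  proof -
    have "S (B \<omega>) = (\<Sum>j\<in>Basis. (B \<omega> \<bullet> j) *\<^sub>R S j)"
      using lin by (subst euclidean_representation[of "B \<omega>", symmetric])
        (simp add: linear_sum linear_cmul)
    then have S: "S (B \<omega>) \<bullet> i = (\<Sum>j\<in>Basis. (B \<omega> \<bullet> j) * (i \<bullet> S j))" for i
      by (simp add: inner_sum_left inner_commute[of i])
    show ?thesis
      unfolding euclidean_inner[of "A \<omega>" "S (B \<omega>)"] S by (simp add: sum_distrib_left mult_ac)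
  qed
  have int: "integrable M (\<lambda>\<omega>. ?ab i j \<omega> * ?xx i j \<omega>)"
    if "i \<in> Basis" "j \<in> Basis" for i j
  proof (rule integrable_bounded)
    show "norm (?ab i j \<omega> * ?xx i j \<omega>) \<le> (BA * BB) * (C * C)" for \<omega>
      unfolding real_norm_def
      by (subst abs_mult, intro mult_mono b[OF that] bX[OF that]) (use nn in auto)
  qed measurable
  have int': "integrable M (\<lambda>\<omega>. ?ab i j \<omega> * (i \<bullet> S j))"
    if "i \<in> Basis" "j \<in> Basis" for i j
  proof (rule integrable_mult_left[OF integrable_bounded])
    show "norm (?ab i j \<omega>) \<le> BA * BB" for \<omega>
      using b[OF that] by simp
  qed measurable
  have eq: "expectation (\<lambda>\<omega>. ?ab i j \<omega> * ?xx i j \<omega>)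
      = expectation (\<lambda>\<omega>. ?ab i j \<omega> * (i \<bullet> S j))"
    if "i \<in> Basis" "j \<in> Basis" for i j
  proof -
    have mAB: "(\<lambda>\<omega>. (A \<omega> \<bullet> i) * (B \<omega> \<bullet> j)) \<in> borel_measurable (F k)"
      by measurable
    have "(\<lambda>x::real^'n. (x \<bullet> i) * (x \<bullet> j)) \<in> borel_measurable borel"
      by measurable
    from expectation_hist_indep[OF indep mAB[unfolded F_def] b[OF that] this bX[OF that]]
    show ?thesis by (simp only: cov integral_mult_left_zero)
  qed
  have "expectation (\<lambda>\<omega>. (X k \<omega> \<bullet> A \<omega>) * (X k \<omega> \<bullet> B \<omega>)) = (\<Sum>i\<in>Basis. \<Sum>j\<in>Basis.
      expectation (\<lambda>\<omega>. ?ab i j \<omega> * ?xx i j \<omega>))"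
    unfolding exp
    by (subst Bochner_Integration.integral_sum, intro Bochner_Integration.integrable_sum int, assumption+,
        intro sum.cong refl Bochner_Integration.integral_sum int)
  also have "\<dots> = (\<Sum>i\<in>Basis. \<Sum>j\<in>Basis. expectation (\<lambda>\<omega>. ?ab i j \<omega> * (i \<bullet> S j)))"
    by (intro sum.cong refl eq)
  also have "\<dots> = expectation (\<lambda>\<omega>. A \<omega> \<bullet> S (B \<omega>))"
    unfolding expS
    by (subst Bochner_Integration.integral_sum, intro Bochner_Integration.integrable_sum int', assumption+,
        intro sum.cong refl Bochner_Integration.integral_sum[symmetric] int')
  finally show ?thesis .
qed

lemma expectation_g:
  assumes A: "A \<in> borel_measurable (F k)" "\<And>\<omega>. norm (A \<omega>) \<le> BA" and k: "real k * eta \<le> T"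
  shows "expectation (\<lambda>\<omega>. A \<omega> \<bullet> g k \<omega>) = expectation (\<lambda>\<omega>. A \<omega> \<bullet> f (W k \<omega>))"
proof -
  note [measurable] = A(1)
  let ?B = "\<lambda>\<omega>. A \<omega> - (W k \<omega> \<bullet> A \<omega>) *\<^sub>R W k \<omega>"
  have "?B \<in> borel_measurable (F k)"
    by measurable
  moreover have "norm (?B \<omega>) \<le> 5 * BA" for \<omega>
  proof -
    have "\<bar>W k \<omega> \<bullet> A \<omega>\<bar> \<le> 2 * BA"
      using W_le[OF k] A(2) by (intro order_trans[OF Cauchy_Schwarz_ineq2] mult_mono) auto
    then have "\<bar>W k \<omega> \<bullet> A \<omega>\<bar> * norm (W k \<omega>) \<le> (2 * BA) * 2"
      using W_le[OF k] order_trans[OF norm_ge_zero A(2)] by (intro mult_mono) auto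
    then show ?thesis
      using A(2)[of \<omega>] norm_triangle_ineq4[of "A \<omega>" "(W k \<omega> \<bullet> A \<omega>) *\<^sub>R W k \<omega>"] by simp
  qed
  ultimately have "expectation (\<lambda>\<omega>. (X k \<omega> \<bullet> ?B \<omega>) * (X k \<omega> \<bullet> W k \<omega>)) = expectation (\<lambda>\<omega>. ?B \<omega> \<bullet> S (W k \<omega>))"
    by (rule expectation_bilinear[OF _ _ W_F W_le[OF k]])
  moreover have "A \<omega> \<bullet> g k \<omega> = (X k \<omega> \<bullet> ?B \<omega>) * (X k \<omega> \<bullet> W k \<omega>)" for \<omega>
    by (simp add: g_def inner_oja mult.commute)
  moreover have "A \<omega> \<bullet> f (W k \<omega>) = ?B \<omega> \<bullet> S (W k \<omega>)" for \<omega>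
    by (simp add: f_def inner_simps inner_commute)
  ultimately show ?thesis by simp
qed

lemma expectation_oja:
  shows "expectation (\<lambda>\<omega>. u \<bullet> oja w (X k \<omega>)) = u \<bullet> f w"
proof -
  have "u \<bullet> oja w (X k \<omega>) = (X k \<omega> \<bullet> (u - (w \<bullet> u) *\<^sub>R w)) * (X k \<omega> \<bullet> w)" for \<omega>
    by (simp add: inner_oja mult.commute)
  then show ?thesis
    by (simp add: cov) (simp add: f_def inner_simps inner_commute)
qed

text \<open>The Lipschitz bound of the update holds for every sample and passes to the mean: the
  difference of the drifts is tested against itself, and one factor of its norm cancels.\<close>

lemma f_diff_le:
  assumes "norm w \<le> 2" "norm w' \<le> 2"
  shows "norm (f w - f w') \<le> 2 * G * norm (w - w')"
proof -
  let ?d = "f w - f w'"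
  have meas: "(\<lambda>\<omega>. oja u (X 0 \<omega>)) \<in> borel_measurable M" for u
    unfolding oja_def by measurable
  have int: "integrable M (\<lambda>\<omega>. u \<bullet> oja w'' (X 0 \<omega>))" if "norm w'' \<le> 2" for u w''
    using meas norm_oja_le[OF that X_bound]
    by (intro integrable_inner_right integrable_bounded) auto
  have "(norm ?d)\<^sup>2 = ?d \<bullet> f w - ?d \<bullet> f w'"
    by (simp add: power2_norm_eq_inner inner_simps)
  also have "\<dots> = expectation (\<lambda>\<omega>. ?d \<bullet> oja w (X 0 \<omega>)) - expectation (\<lambda>\<omega>. ?d \<bullet> oja w' (X 0 \<omega>))"
    by (simp only: expectation_oja)
  also have "\<dots> = expectation (\<lambda>\<omega>. ?d \<bullet> oja w (X 0 \<omega>) - ?d \<bullet> oja w' (X 0 \<omega>))"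
    using int assms by simp
  also have "\<dots> \<le> norm ?d * (2 * G * norm (w - w'))"
  proof (rule expectation_le)
    show "?d \<bullet> oja w (X 0 \<omega>) - ?d \<bullet> oja w' (X 0 \<omega>) \<le> norm ?d * (2 * G * norm (w - w'))" for \<omega>
      unfolding inner_diff_right[symmetric]
      using norm_oja_diff_le[OF assms X_bound]
      by (intro order_trans[OF norm_cauchy_schwarz] mult_left_mono) (auto simp: G_def)
  qed (use int assms in auto)
  finally have "norm ?d * norm ?d \<le> norm ?d * (2 * G * norm (w - w'))"
    by (simp add: power2_eq_square)
  then show ?thesis
    using G by (cases "norm ?d = 0") (auto simp: mult_le_cancel_left)
qed

lemma f_le:
  assumes "norm w \<le> 2"
  shows "norm (f w) \<le> G"
proof -
  have meas: "(\<lambda>\<omega>. oja u (X 0 \<omega>)) \<in> borel_measurable M" for u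
    unfolding oja_def by measurable
  have "(norm (f w))\<^sup>2 = expectation (\<lambda>\<omega>. f w \<bullet> oja w (X 0 \<omega>))"
    by (simp add: power2_norm_eq_inner expectation_oja)
  also have "\<dots> \<le> norm (f w) * G"
  proof (rule expectation_le)
    show "integrable M (\<lambda>\<omega>. f w \<bullet> oja w (X 0 \<omega>))"
      using meas norm_oja_le[OF assms X_bound]
      by (intro integrable_inner_right integrable_bounded) auto
    show "f w \<bullet> oja w (X 0 \<omega>) \<le> norm (f w) * G" for \<omega>
      using norm_oja_le[OF assms X_bound]
      by (intro order_trans[OF norm_cauchy_schwarz] mult_left_mono) (auto simp: G_def)
  qed
  finally have "norm (f w) * norm (f w) \<le> norm (f w) * G"
    by (simp add: power2_eq_square)
  then show ?thesis
    using G by (cases "norm (f w) = 0") (auto simp: mult_le_cancel_left)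
qed

end

section \<open>Second moments near the saddle\<close>

text \<open>The count starts at 1 because \<open>Z\<close> rests at \<open>v0\<close> for the
  indices 0 and 1. With \<open>\<alpha> = 0\<close> this is plain summation, the form used for the
  excess of the squared norm.\<close>

lemma discrete_gronwall:
  fixes x :: "nat \<Rightarrow> real"
  assumes step: "\<And>j. 1 \<le> j \<Longrightarrow> j < k \<Longrightarrow> x (Suc j) \<le> (1 + \<alpha>) * x j + \<beta>"
    and nn: "0 \<le> \<alpha>" "0 \<le> \<beta>" "0 \<le> x 1" and k: "1 \<le> k"
  shows "x k \<le> exp (\<alpha> * real k) * (x 1 + real k * \<beta>)"
  using k step
proof (induction k rule: dec_induct)
  case base
  have "x 1 * 1 \<le> (x 1 + \<beta>) * exp \<alpha>"
    using nn by (intro mult_mono) auto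
  then show ?case by (simp add: mult.commute)
next
  case (step k)
  have e: "1 + \<alpha> \<le> exp \<alpha>" "1 \<le> exp \<alpha>" "1 \<le> exp (\<alpha> * real (Suc k))"
    using nn by (auto simp: exp_ge_add_one_self)
  have "x (Suc k) \<le> (1 + \<alpha>) * x k + \<beta>"
    using step by auto
  also have "\<dots> \<le> (1 + \<alpha>) * (exp (\<alpha> * real k) * (x 1 + real k * \<beta>)) + \<beta>"
    using step nn by (intro add_right_mono mult_left_mono) auto
  also have "\<dots> \<le> exp \<alpha> * (exp (\<alpha> * real k) * (x 1 + real k * \<beta>)) + exp (\<alpha> * real (Suc k)) * \<beta>"
    using e nn by (intro add_mono mult_right_mono mult_left_mono[of 1 _ \<beta>, simplified]
        mult_right_mono[of 1 _ \<beta>, simplified]) auto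
  also have "\<dots> = exp (\<alpha> * real (Suc k)) * (x 1 + real (Suc k) * \<beta>)"
    by (simp add: exp_add algebra_simps)
  finally show ?case .
qed

text \<open>Discrete variation of constants: the solution of
  \<open>z (Suc k) = a * z k + x k\<close> with \<open>z 1 = 0\<close>.\<close>

definition disc :: "real \<Rightarrow> (nat \<Rightarrow> real) \<Rightarrow> nat \<Rightarrow> real" where
  "disc a x k = (\<Sum>j\<in>{1..<k}. a ^ (k - 1 - j) * x j)"

lemma disc_1 [simp]: "disc a x (Suc 0) = 0"
  by (simp add: disc_def)

lemma disc_Suc: "1 \<le> k \<Longrightarrow> disc a x (Suc k) = a * disc a x k + x k"
proof -
  assume k: "1 \<le> k"
  have "disc a x (Suc k) = (\<Sum>j\<in>{1..<k}. a ^ (k - j) * x j) + x k"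
    using k by (simp add: disc_def)
  also have "(\<Sum>j\<in>{1..<k}. a ^ (k - j) * x j) = a * disc a x k"
    unfolding disc_def sum_distrib_left
  proof (rule sum.cong)
    fix j assume "j \<in> {1..<k}"
    then have "k - j = Suc (k - 1 - j)" by auto
    then show "a ^ (k - j) * x j = a * (a ^ (k - 1 - j) * x j)" by simp
  qed simp
  finally show ?thesis .
qed

lemma disc_add: "disc a (\<lambda>j. x j + y j) k = disc a x k + disc a y k"
  by (simp add: disc_def algebra_simps sum.distrib)

lemma disc_solves:
  assumes "1 \<le> k" "\<And>j. 1 \<le> j \<Longrightarrow> j < k \<Longrightarrow> z (Suc j) = a * z j + x j"
  shows "z k = a ^ (k - 1) * z 1 + disc a x k"
  using assms
proof (induction k rule: dec_induct)
  case base
  show ?case by simp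
next
  case (step k)
  then have "z (Suc k) = a * (a ^ (k - 1) * z 1 + disc a x k) + x k"
    by simp
  also have "\<dots> = a ^ (Suc k - 1) * z 1 + disc a x (Suc k)"
    using step.hyps by (cases k) (simp_all add: disc_Suc algebra_simps)
  finally show ?case .
qed

context prob_space
begin

lemma expectation_abs_le_sqrt:
  fixes f :: "'a \<Rightarrow> real"
  assumes "integrable M f" "integrable M (\<lambda>\<omega>. (f \<omega>)\<^sup>2)"
  shows "expectation (\<lambda>\<omega>. \<bar>f \<omega>\<bar>) \<le> sqrt (expectation (\<lambda>\<omega>. (f \<omega>)\<^sup>2))"
proof -
  have "0 \<le> variance (\<lambda>\<omega>. \<bar>f \<omega>\<bar>)" by simp
  also have "\<dots> = expectation (\<lambda>\<omega>. (f \<omega>)\<^sup>2) - (expectation (\<lambda>\<omega>. \<bar>f \<omega>\<bar>))\<^sup>2"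
    using assms by (subst variance_eq) auto
  finally show ?thesis
    by (intro real_le_rsqrt) simp
qed

text \<open>A discrete Ito isometry: orthogonality of \<open>n j\<close> to every bounded function
  of its past removes the cross term. Measurability and boundedness of the partial sums are carried
  through the induction because \<open>orth\<close> demands them.\<close>

lemma expectation_disc_sq_le:
  fixes n :: "nat \<Rightarrow> 'a \<Rightarrow> real" and F :: "nat \<Rightarrow> 'a measure"
  assumes mono: "\<And>(A :: 'a \<Rightarrow> real) j. A \<in> borel_measurable (F j) \<Longrightarrow> A \<in> borel_measurable (F (Suc j))"
    and FM: "\<And>(A :: 'a \<Rightarrow> real) j. A \<in> borel_measurable (F j) \<Longrightarrow> A \<in> borel_measurable M"
    and n: "\<And>j. 1 \<le> j \<Longrightarrow> j < K \<Longrightarrow> n j \<in> borel_measurable (F (Suc j))"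
    and n_bd: "\<And>j \<omega>. 1 \<le> j \<Longrightarrow> j < K \<Longrightarrow> \<bar>n j \<omega>\<bar> \<le> b"
    and orth: "\<And>A B j. 1 \<le> j \<Longrightarrow> j < K \<Longrightarrow> A \<in> borel_measurable (F j) \<Longrightarrow> (\<And>\<omega>. \<bar>A \<omega>\<bar> \<le> B) \<Longrightarrow>
        expectation (\<lambda>\<omega>. A \<omega> * n j \<omega>) = 0"
    and n2: "\<And>j. 1 \<le> j \<Longrightarrow> j < K \<Longrightarrow> expectation (\<lambda>\<omega>. (n j \<omega>)\<^sup>2) \<le> \<beta>"
    and a: "1 \<le> a" and \<beta>: "0 \<le> \<beta>" and k: "1 \<le> k" "k \<le> K"
  shows "(\<lambda>\<omega>. disc a (\<lambda>j. n j \<omega>) k) \<in> borel_measurable (F k)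
    \<and> (\<exists>B. \<forall>\<omega>. \<bar>disc a (\<lambda>j. n j \<omega>) k\<bar> \<le> B)
    \<and> expectation (\<lambda>\<omega>. (disc a (\<lambda>j. n j \<omega>) k)\<^sup>2) \<le> (a\<^sup>2) ^ k * real k * \<beta>"
  using k
proof (induction k rule: dec_induct)
  case base
  show ?case using a \<beta> by auto
next
  case (step k)
  let ?d = "\<lambda>k \<omega>. disc a (\<lambda>j. n j \<omega>) k"
  obtain B where B: "\<And>\<omega>. \<bar>?d k \<omega>\<bar> \<le> B" and dF: "?d k \<in> borel_measurable (F k)"
    and IH: "expectation (\<lambda>\<omega>. (?d k \<omega>)\<^sup>2) \<le> (a\<^sup>2) ^ k * real k * \<beta>"
    using step by auto
  note [measurable] = mono[OF dF] FM[OF dF] n[of k] FM[OF n[of k]]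
  have k: "1 \<le> k" "k < K" using step by auto
  have Suc: "?d (Suc k) \<omega> = a * ?d k \<omega> + n k \<omega>" for \<omega>
    by (rule disc_Suc[OF k(1)])
  have "?d (Suc k) \<in> borel_measurable (F (Suc k))"
    unfolding Suc using k by measurable
  moreover have "\<bar>?d (Suc k) \<omega>\<bar> \<le> a * B + b" for \<omega>
    unfolding Suc
  proof (rule order_trans[OF abs_triangle_ineq], rule add_mono)
    show "\<bar>a * ?d k \<omega>\<bar> \<le> a * B"
      unfolding abs_mult using a B[of \<omega>] by (intro mult_mono) auto
  qed (rule n_bd[OF k])
  moreover have "expectation (\<lambda>\<omega>. (?d (Suc k) \<omega>)\<^sup>2) \<le> (a\<^sup>2) ^ Suc k * real (Suc k) * \<beta>"
  proof -
    have [simp]: "integrable M (\<lambda>\<omega>. (?d k \<omega>)\<^sup>2)"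
      using B k by (intro integrable_bounded_square) auto
    have [simp]: "integrable M (\<lambda>\<omega>. (n k \<omega>)\<^sup>2)"
      using n_bd[OF k] k by (intro integrable_bounded_square) auto
    have [simp]: "integrable M (\<lambda>\<omega>. ?d k \<omega> * n k \<omega>)"
      using n_bd[OF k] B k order_trans[OF abs_ge_zero B]
      by (intro integrable_bounded[of _ "B * b"]) (auto simp: abs_mult intro!: mult_mono)
    have "(?d (Suc k) \<omega>)\<^sup>2 = a\<^sup>2 * (?d k \<omega>)\<^sup>2 + (2 * a) * (?d k \<omega> * n k \<omega>) + (n k \<omega>)\<^sup>2" for \<omega>
      unfolding Suc by (simp add: power2_eq_square algebra_simps)
    then have "expectation (\<lambda>\<omega>. (?d (Suc k) \<omega>)\<^sup>2) = a\<^sup>2 * expectation (\<lambda>\<omega>. (?d k \<omega>)\<^sup>2)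
        + (2 * a) * expectation (\<lambda>\<omega>. ?d k \<omega> * n k \<omega>) + expectation (\<lambda>\<omega>. (n k \<omega>)\<^sup>2)"
      by simp
    also have "\<dots> \<le> a\<^sup>2 * ((a\<^sup>2) ^ k * real k * \<beta>) + 0 + \<beta>"
      using IH n2[OF k] orth[OF k dF B] by (intro add_mono mult_left_mono) auto
    also have "\<dots> \<le> a\<^sup>2 * ((a\<^sup>2) ^ k * real k * \<beta>) + 0 + (a\<^sup>2) ^ Suc k * \<beta>"
      using a \<beta> one_le_power[of "a\<^sup>2" "Suc k"] one_le_power[of a 2] mult_right_mono[of 1 "(a\<^sup>2) ^ Suc k" \<beta>]
      by simp
    finally show ?thesis by (simp add: algebra_simps)
  qed
  ultimately show ?case by blast
qed

end

locale msgd_saddle = msgd_process M X C eta mu tau m v0 T S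
  for M :: "'a measure" and X :: "nat \<Rightarrow> 'a \<Rightarrow> real^'n" and C eta mu tau m v0 T S +
  fixes q1 q2 :: "real^'n" and lam1 lam2 s :: real
  assumes q: "norm q1 = 1" "norm q2 = 1" "q1 \<bullet> q2 = 0"
    and eig: "S q1 = lam1 *\<^sub>R q1" "S q2 = lam2 *\<^sub>R q2"
    and lam: "0 < lam2" "lam2 < lam1"
    and s: "s = 1 \<or> s = -1"
begin

text \<open>The condition on the start determines \<open>q2 \<bullet> v0\<close> only up to sign;
  \<open>u\<close> is one of the two antipodal saddles, and \<open>s\<close> will be chosen to
  select the near one.\<close>

definition "u = s *\<^sub>R q2"
definition "D k \<omega> = Z k \<omega> - u"
definition "d0 = norm (v0 - u)"
definition "st = kap * eta"
definition "b = kap\<^sup>2 * G * rho"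
text \<open>The Gronwall bound over the horizon. Its three sources are the start, the staleness
  (through \<open>b\<^sup>2\<close>) and the noise.\<close>

definition "DB = exp (6 * G * kap * T) * (d0\<^sup>2 + kap * T * (2 * G * b\<^sup>2 + G\<^sup>2 * kap * eta))"
definition "WB = 2 * DB + 2 * b\<^sup>2"

lemma norm_u [simp]: "norm u = 1"
  using q s by (auto simp: u_def)

lemma S_u: "S u = lam2 *\<^sub>R u"
  using lin eig by (simp add: u_def linear_cmul)

lemma f_u [simp]: "f u = 0"
  by (simp add: f_def S_u power2_norm_eq_inner[symmetric])

lemma q1_u [simp]: "q1 \<bullet> u = 0"
  using q by (simp add: u_def)

lemma nonneg: "0 \<le> b" "0 \<le> DB" "0 \<le> WB" "0 < st"
  using kap G T eta eta_rho by (auto simp: b_def DB_def WB_def st_def)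

lemma D_F [measurable]: "D k \<in> borel_measurable (F k)"
  unfolding D_def by measurable

lemma measurable_M' [measurable]: "D k \<in> borel_measurable M"
  unfolding D_def by measurable

lemma Z_le:
  assumes "real k * eta \<le> T"
  shows "norm (Z k \<omega>) \<le> 3"
  using V_le[OF assms, of \<omega>] Z_V_le[OF assms, of \<omega>] small_consequences
    norm_triangle_ineq2[of "Z k \<omega>" "V k \<omega>"] by simp

lemma D_le:
  assumes "real k * eta \<le> T"
  shows "norm (D k \<omega>) \<le> 4"
  using Z_le[OF assms, of \<omega>] norm_triangle_ineq4[of "Z k \<omega>" u] by (simp add: D_def)

lemma integrable_D_sq: "real k * eta \<le> T \<Longrightarrow> integrable M (\<lambda>\<omega>. (norm (D k \<omega>))\<^sup>2)"
  using power_mono[OF D_le norm_ge_zero, where n = 2] by (intro integrable_bounded[of _ "4\<^sup>2"]) auto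

lemma norm_W_u_le: "real k * eta \<le> T \<Longrightarrow> norm (W k \<omega> - u) \<le> 3"
  using W_le[of k \<omega>] norm_triangle_ineq4[of "W k \<omega>" u] by simp

lemma integrable_W_sq: "real k * eta \<le> T \<Longrightarrow> integrable M (\<lambda>\<omega>. (norm (W k \<omega> - u))\<^sup>2)"
  using power_mono[OF norm_W_u_le norm_ge_zero, where n = 2] by (intro integrable_bounded[of _ "3\<^sup>2"]) auto

lemma W_u_le:
  assumes "1 \<le> k" "real k * eta \<le> T"
  shows "norm (W k \<omega> - u) \<le> norm (D k \<omega>) + b"
  using Z_W_le[OF assms(2,1), of \<omega>] norm_triangle_ineq[of "Z k \<omega> - u" "W k \<omega> - Z k \<omega>"]
  by (simp add: D_def b_def norm_minus_commute)

text \<open>The noise is orthogonal to \<open>D k\<close> and the drift vanishes at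
  \<open>u\<close>, so staleness enters only through the drift and, after
  \<open>2 * norm D * b \<le> (norm D)\<^sup>2 + b\<^sup>2\<close>, only squared. It therefore costs
  no more than the noise does, namely order \<open>eta\<close> once
  \<open>rho\<^sup>2 \<le> eta\<close>. The saddle is unstable, so the factor exceeds 1 and the
  bound serves bounded horizons.\<close>

lemma D_sq_step:
  assumes "1 \<le> k" "real k * eta \<le> T"
  shows "expectation (\<lambda>\<omega>. (norm (D (Suc k) \<omega>))\<^sup>2)
    \<le> (1 + 6 * G * st) * expectation (\<lambda>\<omega>. (norm (D k \<omega>))\<^sup>2) + st * (2 * G * b\<^sup>2 + G\<^sup>2 * kap * eta)"
proof -
  let ?d = "\<lambda>\<omega>. (norm (D k \<omega>))\<^sup>2"
  have int: "integrable M ?d"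
    by (rule integrable_D_sq[OF assms(2)])
  have intg: "integrable M (\<lambda>\<omega>. D k \<omega> \<bullet> g k \<omega>)"
    using D_le[OF assms(2)] g_le[OF assms(2)]
    by (intro integrable_bounded[of _ "4 * G"]) (auto intro!: order_trans[OF Cauchy_Schwarz_ineq2] mult_mono)
  have intg2: "integrable M (\<lambda>\<omega>. (norm (g k \<omega>))\<^sup>2)"
    using g_le[OF assms(2)] by (intro integrable_bounded[of _ "G\<^sup>2"]) (auto intro: power_mono)
  have Df: "D k \<omega> \<bullet> f (W k \<omega>) \<le> 3 * G * ?d \<omega> + G * b\<^sup>2" for \<omega>
  proof -
    have "norm (f (W k \<omega>)) \<le> 2 * G * (norm (D k \<omega>) + b)"
      using f_diff_le[OF W_le[OF assms(2)], of u \<omega>] W_u_le[OF assms, of \<omega>] G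
      by (simp add: order_trans[OF _ mult_left_mono])
    then have "D k \<omega> \<bullet> f (W k \<omega>) \<le> norm (D k \<omega>) * (2 * G * (norm (D k \<omega>) + b))"
      by (intro order_trans[OF norm_cauchy_schwarz] mult_left_mono) auto
    also have "\<dots> = G * (2 * ?d \<omega> + 2 * norm (D k \<omega>) * b)"
      by (simp add: power2_eq_square algebra_simps)
    also have "\<dots> \<le> G * (2 * ?d \<omega> + (?d \<omega> + b\<^sup>2))"
      using G sum_squares_bound[of "norm (D k \<omega>)" b] by (intro mult_left_mono add_left_mono) auto
    finally show ?thesis by (simp add: algebra_simps)
  qed
  have "(norm (D (Suc k) \<omega>))\<^sup>2 = ?d \<omega> + 2 * st * (D k \<omega> \<bullet> g k \<omega>) + st\<^sup>2 * (norm (g k \<omega>))\<^sup>2" for \<omega>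
    unfolding D_def Z_Suc[OF assms(1)] power2_norm_eq_inner st_def
    by (simp add: inner_simps power2_eq_square inner_commute algebra_simps)
  then have "expectation (\<lambda>\<omega>. (norm (D (Suc k) \<omega>))\<^sup>2)
      = expectation ?d + 2 * st * expectation (\<lambda>\<omega>. D k \<omega> \<bullet> g k \<omega>) + st\<^sup>2 * expectation (\<lambda>\<omega>. (norm (g k \<omega>))\<^sup>2)"
    using int intg intg2 by simp
  also have "\<dots> \<le> expectation ?d + 2 * st * (3 * G * expectation ?d + G * b\<^sup>2) + st\<^sup>2 * G\<^sup>2"
  proof (intro add_mono mult_left_mono order_refl)
    have "expectation (\<lambda>\<omega>. D k \<omega> \<bullet> g k \<omega>) = expectation (\<lambda>\<omega>. D k \<omega> \<bullet> f (W k \<omega>))"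
      by (rule expectation_g[OF D_F D_le[OF assms(2)] assms(2)])
    also have "\<dots> \<le> expectation (\<lambda>\<omega>. 3 * G * ?d \<omega> + G * b\<^sup>2)"
    proof (rule integral_mono)
      show "integrable M (\<lambda>\<omega>. D k \<omega> \<bullet> f (W k \<omega>))"
        using D_le[OF assms(2)] f_le[OF W_le[OF assms(2)]]
        by (intro integrable_bounded[of _ "4 * G"]) (auto intro!: order_trans[OF Cauchy_Schwarz_ineq2] mult_mono)
    qed (use int Df in auto)
    also have "\<dots> = 3 * G * expectation ?d + G * b\<^sup>2"
      using int by (simp add: prob_space)
    finally show "expectation (\<lambda>\<omega>. D k \<omega> \<bullet> g k \<omega>) \<le> 3 * G * expectation ?d + G * b\<^sup>2" .
    show "expectation (\<lambda>\<omega>. (norm (g k \<omega>))\<^sup>2) \<le> G\<^sup>2"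
      using g_le[OF assms(2)] by (intro expectation_le intg2 power_mono) auto
  qed (use nonneg in auto)
  finally show ?thesis
    by (simp add: st_def power2_eq_square algebra_simps)
qed

lemma D_sq_le:
  assumes "1 \<le> k" "real k * eta \<le> T"
  shows "expectation (\<lambda>\<omega>. (norm (D k \<omega>))\<^sup>2) \<le> DB"
proof -
  let ?x = "\<lambda>k. expectation (\<lambda>\<omega>. (norm (D k \<omega>))\<^sup>2)" and ?h = "2 * G * b\<^sup>2 + G\<^sup>2 * kap * eta"
  have h: "0 \<le> ?h" using kap G eta by auto
  have x1: "?x 1 = d0\<^sup>2"
    by (simp add: D_def d0_def prob_space)
  have "?x k \<le> exp (6 * G * st * real k) * (?x 1 + real k * (st * ?h))"
    using nonneg G h assms time_le[OF assms(2)]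
    by (intro discrete_gronwall D_sq_step) auto
  also have "\<dots> \<le> exp (6 * G * kap * T) * (d0\<^sup>2 + kap * T * ?h)"
  proof (intro mult_mono)
    show "exp (6 * G * st * real k) \<le> exp (6 * G * kap * T)"
      using assms(2) kap G by (simp add: st_def mult_ac mult_left_mono)
    have "real k * (st * ?h) = kap * (real k * eta) * ?h"
      by (simp add: st_def)
    also have "\<dots> \<le> kap * T * ?h"
      using assms(2) kap h by (intro mult_right_mono mult_left_mono) auto
    finally show "?x 1 + real k * (st * ?h) \<le> d0\<^sup>2 + kap * T * ?h"
      using x1 by simp
    show "0 \<le> ?x 1 + real k * (st * ?h)"
      using x1 nonneg h by simp
  qed simp
  finally show ?thesis by (simp add: DB_def)
qed

lemma W_sq_le:
  assumes "1 \<le> k" "real k * eta \<le> T"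
  shows "expectation (\<lambda>\<omega>. (norm (W k \<omega> - u))\<^sup>2) \<le> WB"
proof -
  have "(norm (W k \<omega> - u))\<^sup>2 \<le> 2 * (norm (D k \<omega>))\<^sup>2 + 2 * b\<^sup>2" for \<omega>
  proof -
    have "(norm (W k \<omega> - u))\<^sup>2 \<le> (norm (D k \<omega>) + b)\<^sup>2"
      by (intro power_mono W_u_le assms) auto
    then show ?thesis
      using sum_squares_bound[of "norm (D k \<omega>)" b] by (simp add: power2_sum)
  qed
  then have "expectation (\<lambda>\<omega>. (norm (W k \<omega> - u))\<^sup>2) \<le> expectation (\<lambda>\<omega>. 2 * (norm (D k \<omega>))\<^sup>2 + 2 * b\<^sup>2)"
    using integrable_D_sq[OF assms(2)] by (intro integral_mono integrable_W_sq assms(2)) auto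
  also have "\<dots> = 2 * expectation (\<lambda>\<omega>. (norm (D k \<omega>))\<^sup>2) + 2 * b\<^sup>2"
    using integrable_D_sq[OF assms(2)] by (simp add: prob_space)
  also have "\<dots> \<le> WB"
    using D_sq_le[OF assms] by (simp add: WB_def)
  finally show ?thesis .
qed

end

context msgd_saddle
begin

definition "noise k \<omega> = g k \<omega> - f (W k \<omega>)"

lemma F_Suc: "A \<in> measurable (F k) N \<Longrightarrow> A \<in> measurable (F (Suc k)) N"
  by (rule F_mono) auto

lemma noise_meas: "noise k \<in> borel_measurable (F (Suc k))"
proof -
  have [measurable]: "W k \<in> borel_measurable (F (Suc k))" "X k \<in> borel_measurable (F (Suc k))"
    using F_mono[OF W_F] X_F[of k "Suc k"] by auto
  show ?thesis
    unfolding noise_def g_def oja_def by measurable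
qed

lemma noise_le: "real k * eta \<le> T \<Longrightarrow> norm (noise k \<omega>) \<le> 2 * G"
  using g_le[of k \<omega>] f_le[OF W_le, of k \<omega>] norm_triangle_ineq4[of "g k \<omega>" "f (W k \<omega>)"]
  by (simp add: noise_def)

lemma expectation_noise:
  assumes A: "A \<in> borel_measurable (F k)" "\<And>\<omega>. norm (A \<omega>) \<le> BA" and k: "real k * eta \<le> T"
  shows "expectation (\<lambda>\<omega>. A \<omega> \<bullet> noise k \<omega>) = 0"
proof -
  note [measurable] = F_M[OF A(1)]
  have nn: "0 \<le> BA" using A(2) norm_ge_zero order_trans by blast
  have "integrable M (\<lambda>\<omega>. A \<omega> \<bullet> g k \<omega>)"
    using A(2) g_le[OF k] nn
    by (intro integrable_bounded[of _ "BA * G"]) (auto intro!: order_trans[OF Cauchy_Schwarz_ineq2] mult_mono)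
  moreover have "integrable M (\<lambda>\<omega>. A \<omega> \<bullet> f (W k \<omega>))"
    using A(2) f_le[OF W_le[OF k]] nn
    by (intro integrable_bounded[of _ "BA * G"]) (auto intro!: order_trans[OF Cauchy_Schwarz_ineq2] mult_mono)
  ultimately show ?thesis
    using expectation_g[OF A k] by (simp add: noise_def inner_diff_right)
qed

subsection \<open>The squared norm\<close>

text \<open>The martingale part of the staleness term in \<open>e_Suc\<close>. One step has size
  \<open>rho * eta\<close>; over \<open>T / eta\<close> steps absolute values would add up to order
  \<open>rho\<close>, while orthogonality reduces this to \<open>rho * sqrt eta\<close>.\<close>

definition "en k \<omega> = 2 * st * ((Z k \<omega> - W k \<omega>) \<bullet> noise k \<omega>)"
definition "eq k \<omega> = disc 1 (\<lambda>j. en j \<omega>) k"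

lemma en_meas: "en k \<in> borel_measurable (F (Suc k))"
proof -
  have [measurable]: "W k \<in> borel_measurable (F (Suc k))" "Z k \<in> borel_measurable (F (Suc k))"
    "noise k \<in> borel_measurable (F (Suc k))"
    using F_mono[OF W_F] F_mono[OF Z_F] noise_meas by auto
  show ?thesis unfolding en_def by measurable
qed

lemma en_le:
  assumes "1 \<le> k" "real k * eta \<le> T"
  shows "\<bar>en k \<omega>\<bar> \<le> 4 * st * b * G"
proof -
  have "\<bar>(Z k \<omega> - W k \<omega>) \<bullet> noise k \<omega>\<bar> \<le> b * (2 * G)"
    using Z_W_le[OF assms(2,1)] noise_le[OF assms(2)] nonneg
    by (intro order_trans[OF Cauchy_Schwarz_ineq2] mult_mono) (auto simp: b_def)
  from mult_left_mono[OF this, of "2 * st"] show ?thesis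
    using nonneg by (simp add: en_def abs_mult)
qed

lemma eq_facts:
  assumes "1 \<le> k" "real k * eta \<le> T"
  shows "eq k \<in> borel_measurable M" "integrable M (eq k)"
    "expectation (\<lambda>\<omega>. \<bar>eq k \<omega>\<bar>) \<le> 4 * kap * b * G * sqrt (T * eta)"
proof -
  have *: "(\<lambda>\<omega>. disc 1 (\<lambda>j. en j \<omega>) k) \<in> borel_measurable (F k)
    \<and> (\<exists>B. \<forall>\<omega>. \<bar>disc 1 (\<lambda>j. en j \<omega>) k\<bar> \<le> B)
    \<and> expectation (\<lambda>\<omega>. (disc 1 (\<lambda>j. en j \<omega>) k)\<^sup>2) \<le> (1\<^sup>2) ^ k * real k * (4 * st * b * G)\<^sup>2"
  proof (rule expectation_disc_sq_le[where K = k and b = "4 * st * b * G"])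
    fix j assume j: "1 \<le> j" "j < k"
    have t: "real j * eta \<le> T"
      using time_le[OF assms(2), of j] j by simp
    show "\<bar>en j \<omega>\<bar> \<le> 4 * st * b * G" for \<omega>
      by (rule en_le[OF j(1) t])
    then show "expectation (\<lambda>\<omega>. (en j \<omega>)\<^sup>2) \<le> (4 * st * b * G)\<^sup>2"
      using F_M[OF en_meas[of j]]
      by (intro expectation_le integrable_bounded[of _ "(4 * st * b * G)\<^sup>2"])
        (auto simp: abs_le_square_iff[symmetric] intro: order_trans[OF _ abs_ge_self])
    fix A :: "'a \<Rightarrow> real" and B :: real assume A: "A \<in> borel_measurable (F j)" "\<And>\<omega>. \<bar>A \<omega>\<bar> \<le> B"
    note [measurable] = A(1)
    let ?A = "\<lambda>\<omega>. (2 * st * A \<omega>) *\<^sub>R (Z j \<omega> - W j \<omega>)"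
    have "norm (?A \<omega>) \<le> (2 * st * B) * b" for \<omega>
      using A(2)[of \<omega>] Z_W_le[OF t j(1), of \<omega>] nonneg
      by (auto simp: abs_mult b_def intro!: mult_mono)
    then have "expectation (\<lambda>\<omega>. ?A \<omega> \<bullet> noise j \<omega>) = 0"
      by (intro expectation_noise t) measurable
    then show "expectation (\<lambda>\<omega>. A \<omega> * en j \<omega>) = 0"
      by (simp add: en_def mult_ac)
  qed (use assms F_M F_Suc en_meas in auto)
  then obtain B where B: "\<And>\<omega>. \<bar>eq k \<omega>\<bar> \<le> B"
    and sq: "expectation (\<lambda>\<omega>. (eq k \<omega>)\<^sup>2) \<le> real k * (4 * st * b * G)\<^sup>2"
    by (auto simp: eq_def)
  show meas [measurable]: "eq k \<in> borel_measurable M"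
    unfolding eq_def[abs_def] using * by (intro F_M) auto
  show int: "integrable M (eq k)"
    using B by (intro integrable_bounded) auto
  have "expectation (\<lambda>\<omega>. \<bar>eq k \<omega>\<bar>) \<le> sqrt (expectation (\<lambda>\<omega>. (eq k \<omega>)\<^sup>2))"
    by (intro expectation_abs_le_sqrt int integrable_bounded_square[OF meas B])
  also have "\<dots> \<le> sqrt ((real k * eta) * eta * (4 * kap * b * G)\<^sup>2)"
    using sq by (simp add: st_def power_mult_distrib power2_eq_square mult_ac)
  also have "\<dots> \<le> sqrt (T * eta * (4 * kap * b * G)\<^sup>2)"
    using assms eta by (intro real_sqrt_le_mono mult_right_mono) auto
  also have "\<dots> = 4 * kap * b * G * sqrt (T * eta)"
    using nonneg kap G by (simp add: real_sqrt_mult)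
  finally show "expectation (\<lambda>\<omega>. \<bar>eq k \<omega>\<bar>) \<le> 4 * kap * b * G * sqrt (T * eta)" .
qed

text \<open>As \<open>f u = 0\<close>, the drift near the saddle has the order of the distance to
  it, \<open>sqrt eta\<close> in mean. The drift part of the staleness term is thus small without
  any cancellation.\<close>

lemma expectation_f_le:
  assumes "1 \<le> k" "real k * eta \<le> T"
  shows "expectation (\<lambda>\<omega>. norm (f (W k \<omega>))) \<le> 2 * G * sqrt WB"
proof -
  have int: "integrable M (\<lambda>\<omega>. norm (W k \<omega> - u))"
    using norm_W_u_le[OF assms(2)] by (intro integrable_bounded[of _ 3]) auto
  have "expectation (\<lambda>\<omega>. norm (f (W k \<omega>))) \<le> expectation (\<lambda>\<omega>. 2 * G * norm (W k \<omega> - u))"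
  proof (intro integral_mono)
    show "integrable M (\<lambda>\<omega>. norm (f (W k \<omega>)))"
      using f_le[OF W_le[OF assms(2)]] by (intro integrable_bounded[of _ G]) auto
    show "norm (f (W k \<omega>)) \<le> 2 * G * norm (W k \<omega> - u)" for \<omega>
      using f_diff_le[OF W_le[OF assms(2)], of u \<omega>] by simp
  qed (use int in auto)
  also have "\<dots> = 2 * G * expectation (\<lambda>\<omega>. \<bar>norm (W k \<omega> - u)\<bar>)"
    by simp
  also have "\<dots> \<le> 2 * G * sqrt (expectation (\<lambda>\<omega>. (norm (W k \<omega> - u))\<^sup>2))"
    using G by (intro mult_left_mono expectation_abs_le_sqrt int integrable_W_sq assms) auto
  also have "\<dots> \<le> 2 * G * sqrt WB"
    using G W_sq_le[OF assms] by (intro mult_left_mono) auto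
  finally show ?thesis .
qed

text \<open>Each of the four terms is of order \<open>rho * sqrt eta\<close>, hence
  \<open>o(eta)\<close>. They are kept apart from the leading term because \<open>WB\<close> depends
  on the distance of the start from the saddle.\<close>

definition "e_rest = 4 * kap\<^sup>2 * G\<^sup>2 * T * b * sqrt (T * eta) + 2 * kap\<^sup>2 * G\<^sup>2 * E1 * T\<^sup>2 * rho\<^sup>2
  + 4 * kap * T * b * G * sqrt WB + 4 * kap * b * G * sqrt (T * eta)"

text \<open>The martingale is subtracted before absolute values are taken. Damping acts on
  \<open>e\<close> but not on the plain sum \<open>eq\<close>, which leaves the term with
  \<open>\<bar>eq k \<omega>\<bar>\<close>.\<close>

lemma e_eq_step:
  assumes "1 \<le> k" "real k * eta \<le> T"
  shows "\<bar>e (Suc k) \<omega> - eq (Suc k) \<omega>\<bar> \<le> \<bar>e k \<omega> - eq k \<omega>\<bar>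
    + kap * G * eta * (\<bar>eq k \<omega>\<bar> + (2 * kap * G * E1 * T * rho\<^sup>2 + 5 * (kap\<^sup>2 * G * eta)))
    + 2 * st * b * norm (f (W k \<omega>)) + st\<^sup>2 * G\<^sup>2"
proof -
  let ?c = "2 * kap * G * E1 * T * rho\<^sup>2 + 5 * (kap\<^sup>2 * G * eta)"
  note W = W_le[OF assms(2), of \<omega>]
  note a = a_bounds[OF W]
  have "e (Suc k) \<omega> - eq (Suc k) \<omega> = (1 - a k \<omega>) * (e k \<omega> - eq k \<omega>) + a k \<omega> * (c k \<omega> - eq k \<omega>)
      + 2 * st * ((Z k \<omega> - W k \<omega>) \<bullet> f (W k \<omega>)) + st\<^sup>2 * (norm (g k \<omega>))\<^sup>2"
    unfolding e_Suc[OF assms(1)] eq_def disc_Suc[OF assms(1)]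
    by (simp add: en_def noise_def st_def inner_diff_right algebra_simps)
  then have "\<bar>e (Suc k) \<omega> - eq (Suc k) \<omega>\<bar> \<le> \<bar>(1 - a k \<omega>) * (e k \<omega> - eq k \<omega>)\<bar>
      + \<bar>a k \<omega> * (c k \<omega> - eq k \<omega>)\<bar> + \<bar>2 * st * ((Z k \<omega> - W k \<omega>) \<bullet> f (W k \<omega>))\<bar> + \<bar>st\<^sup>2 * (norm (g k \<omega>))\<^sup>2\<bar>"
    by linarith
  also have "\<dots> \<le> \<bar>e k \<omega> - eq k \<omega>\<bar>
    + kap * G * eta * (\<bar>eq k \<omega>\<bar> + ?c)
    + 2 * st * (b * norm (f (W k \<omega>))) + st\<^sup>2 * G\<^sup>2"
  proof (intro add_mono)
    show "\<bar>(1 - a k \<omega>) * (e k \<omega> - eq k \<omega>)\<bar> \<le> \<bar>e k \<omega> - eq k \<omega>\<bar>"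
      using a by (simp add: abs_mult mult_left_le_one_le)
    show "\<bar>a k \<omega> * (c k \<omega> - eq k \<omega>)\<bar> \<le> kap * G * eta * (\<bar>eq k \<omega>\<bar> + ?c)"
      unfolding abs_mult using a c_le[OF assms, of \<omega>] by (intro mult_mono) auto
    have "\<bar>(Z k \<omega> - W k \<omega>) \<bullet> f (W k \<omega>)\<bar> \<le> b * norm (f (W k \<omega>))"
      using Z_W_le[OF assms(2,1), of \<omega>] unfolding b_def[symmetric]
      by (intro order_trans[OF Cauchy_Schwarz_ineq2] mult_right_mono) auto
    then show "\<bar>2 * st * ((Z k \<omega> - W k \<omega>) \<bullet> f (W k \<omega>))\<bar> \<le> 2 * st * (b * norm (f (W k \<omega>)))"
      using nonneg by (simp add: abs_mult)
    show "\<bar>st\<^sup>2 * (norm (g k \<omega>))\<^sup>2\<bar> \<le> st\<^sup>2 * G\<^sup>2"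
      using g_le[OF assms(2), of \<omega>] by (simp add: mult_left_mono power_mono)
  qed
  finally show ?thesis by simp
qed

lemma expectation_e_le:
  assumes "1 \<le> k" "real k * eta \<le> T"
  shows "expectation (\<lambda>\<omega>. \<bar>e k \<omega>\<bar>) \<le> 6 * kap ^ 3 * G\<^sup>2 * T * eta + e_rest"
proof -
  let ?x = "\<lambda>k. expectation (\<lambda>\<omega>. \<bar>e k \<omega> - eq k \<omega>\<bar>)"
  let ?c = "2 * kap * G * E1 * T * rho\<^sup>2 + 5 * (kap\<^sup>2 * G * eta)"
  define \<beta> where "\<beta> = kap * G * eta * (4 * kap * b * G * sqrt (T * eta) + ?c)
    + 2 * st * b * (2 * G * sqrt WB) + st\<^sup>2 * G\<^sup>2"
  have \<beta>: "0 \<le> \<beta>"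
    using kap G T eta nonneg by (simp add: \<beta>_def E1_def)
  have ei: "integrable M (e j)" if "real j * eta \<le> T" for j
    using e_le[OF that] by (intro integrable_bounded) auto
  have "?x k \<le> exp (0 * real k) * (?x 1 + real k * \<beta>)"
  proof (rule discrete_gronwall)
    fix j assume j: "1 \<le> j" "j < k"
    have t: "real j * eta \<le> T" "real (Suc j) * eta \<le> T"
      using time_le[OF assms(2), of j] time_le[OF assms(2), of "Suc j"] j by auto
    note int [simp] = ei[OF t(1)] ei[OF t(2)] eq_facts(2)[OF j(1) t(1)] eq_facts(2)[OF _ t(2)]
    have intf [simp]: "integrable M (\<lambda>\<omega>. norm (f (W j \<omega>)))"
      using f_le[OF W_le[OF t(1)]] by (intro integrable_bounded[of _ G]) auto
    have "?x (Suc j) \<le> expectation (\<lambda>\<omega>. \<bar>e j \<omega> - eq j \<omega>\<bar> + kap * G * eta * (\<bar>eq j \<omega>\<bar> + ?c)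
        + 2 * st * b * norm (f (W j \<omega>)) + st\<^sup>2 * G\<^sup>2)"
      using e_eq_step[OF j(1) t(1)] by (intro integral_mono) auto
    also have "\<dots> = ?x j + kap * G * eta * (expectation (\<lambda>\<omega>. \<bar>eq j \<omega>\<bar>) + ?c)
        + 2 * st * b * expectation (\<lambda>\<omega>. norm (f (W j \<omega>))) + st\<^sup>2 * G\<^sup>2"
      by (simp add: prob_space)
    also have "\<dots> \<le> ?x j + \<beta>"
      unfolding \<beta>_def add.assoc[symmetric]
      using eq_facts(3)[OF j(1) t(1)] expectation_f_le[OF j(1) t(1)] kap G eta nonneg
      by (intro add_mono mult_left_mono order_refl) auto
    finally show "?x (Suc j) \<le> (1 + 0) * ?x j + \<beta>" by simp
  qed (use \<beta> assms in auto)
  then have x: "?x k \<le> real k * \<beta>"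
    by (simp add: eq_def)
  have "expectation (\<lambda>\<omega>. \<bar>e k \<omega>\<bar>) \<le> expectation (\<lambda>\<omega>. \<bar>e k \<omega> - eq k \<omega>\<bar> + \<bar>eq k \<omega>\<bar>)"
    using ei[OF assms(2)] eq_facts(2)[OF assms] by (intro integral_mono) auto
  also have "\<dots> = ?x k + expectation (\<lambda>\<omega>. \<bar>eq k \<omega>\<bar>)"
    using ei[OF assms(2)] eq_facts(2)[OF assms] by simp
  also have "\<dots> \<le> real k * \<beta> + 4 * kap * b * G * sqrt (T * eta)"
    using x eq_facts(3)[OF assms] by simp
  also have "real k * \<beta> = (real k * eta) * (\<beta> / eta)"
    using eta by simp
  also have "\<dots> \<le> T * (\<beta> / eta)"
    using assms(2) \<beta> eta by (intro mult_right_mono) auto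
  also have "\<beta> / eta = kap * G * (4 * kap * b * G * sqrt (T * eta) + ?c)
      + 2 * kap * b * (2 * G * sqrt WB) + kap\<^sup>2 * eta * G\<^sup>2"
    using eta by (simp add: \<beta>_def st_def field_simps power2_eq_square)
  \<comment> \<open>The leading constant is \<open>6 = 5 + 1\<close>: 5 from the distance between
    \<open>Z\<close> and \<open>V\<close> inside \<open>c\<close>, 1 from the squared step.\<close>
  also have "T * \<dots> + 4 * kap * b * G * sqrt (T * eta)
      = e_rest + (5 * kap ^ 3 * G\<^sup>2 * T * eta + kap\<^sup>2 * G\<^sup>2 * T * eta)"
    by (simp add: e_rest_def power2_eq_square power3_eq_cube algebra_simps)
  also have "kap\<^sup>2 * G\<^sup>2 * T * eta \<le> kap ^ 3 * G\<^sup>2 * T * eta"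
    using kap G T eta by (intro mult_right_mono power_increasing) auto
  finally show ?thesis by (simp add: mult_ac)
qed

subsection \<open>The unstable coordinate\<close>

definition "Delta = lam1 - lam2"
definition "gr = 1 + st * Delta"
text \<open>The noise with the iterate frozen at \<open>u\<close>. It depends on \<open>X k\<close>
  alone, so these variables are independent.\<close>

definition "xi k \<omega> = s * ((X k \<omega> \<bullet> q1) * (X k \<omega> \<bullet> q2))"
text \<open>\<open>zr\<close> is the error of linearising the drift, \<open>zn\<close> that of
  freezing the noise. Apart from staleness the first is quadratic in the distance to
  \<open>u\<close>, so its absolute values can be summed. The second is only linear in the distance
  and is handled as a martingale, in mean square.\<close>

definition "zr k \<omega> = q1 \<bullet> f (W k \<omega>) - Delta * (q1 \<bullet> Z k \<omega>)"
definition "zn k \<omega> = q1 \<bullet> noise k \<omega> - xi k \<omega>"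
definition "zp k \<omega> = disc gr (\<lambda>j. st * zr j \<omega>) k"
definition "zq k \<omega> = disc gr (\<lambda>j. st * zn j \<omega>) k"

lemma Delta: "0 < Delta" "Delta \<le> G"
proof -
  have "lam1 = norm (S q1)"
    using q eig lam by simp
  also have "\<dots> \<le> G"
    using norm_S_le[of q1] q G by simp
  finally show "0 < Delta" "Delta \<le> G"
    using lam by (auto simp: Delta_def)
qed

lemma gr: "1 \<le> gr" "real k * eta \<le> T \<Longrightarrow> gr ^ k \<le> exp (kap * Delta * T)"
proof -
  show "1 \<le> gr" using Delta nonneg by (simp add: gr_def)
  assume k: "real k * eta \<le> T"
  have "gr ^ k \<le> exp (st * Delta) ^ k"
    using exp_ge_add_one_self[of "st * Delta"] \<open>1 \<le> gr\<close> by (intro power_mono) (auto simp: gr_def)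
  also have "\<dots> = exp (kap * Delta * (real k * eta))"
    by (simp add: exp_of_nat_mult[symmetric] st_def mult_ac)
  also have "\<dots> \<le> exp (kap * Delta * T)"
    using k kap Delta by (simp add: mult_left_mono)
  finally show "gr ^ k \<le> exp (kap * Delta * T)" .
qed

lemma q1_Z_eq:
  assumes "1 \<le> k"
  shows "q1 \<bullet> Z k \<omega> = gr ^ (k - 1) * (q1 \<bullet> v0) + disc gr (\<lambda>j. st * xi j \<omega>) k + zp k \<omega> + zq k \<omega>"
proof -
  have "q1 \<bullet> Z (Suc j) \<omega> = gr * (q1 \<bullet> Z j \<omega>) + (st * xi j \<omega> + st * zr j \<omega> + st * zn j \<omega>)" if "1 \<le> j" for j
    unfolding Z_Suc[OF that]
    by (simp add: inner_add_right inner_diff_right gr_def zr_def zn_def noise_def st_def algebra_simps)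
  from disc_solves[of k "\<lambda>j. q1 \<bullet> Z j \<omega>" gr "\<lambda>j. st * xi j \<omega> + st * zr j \<omega> + st * zn j \<omega>", OF assms this]
  show ?thesis
    by (simp add: disc_add zp_def zq_def)
qed

lemma xi_eq: "xi k \<omega> = q1 \<bullet> oja u (X k \<omega>)"
  using s by (auto simp: xi_def inner_oja inner_simps u_def q inner_commute)

text \<open>As \<open>q1\<close> is an eigenvector, \<open>q1 \<bullet> f w - Delta * (q1 \<bullet>
  w) = (q1 \<bullet> w) * (lam2 - w \<bullet> S w)\<close>, and both factors vanish at
  \<open>w = u\<close>. Passing from \<open>W\<close> to \<open>Z\<close> in the linear term costs
  \<open>Delta * b\<close>.\<close>

lemma zr_le:
  assumes "1 \<le> k" "real k * eta \<le> T"
  shows "\<bar>zr k \<omega>\<bar> \<le> G * (norm (W k \<omega> - u))\<^sup>2 + G * b"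
proof -
  let ?w = "W k \<omega>"
  have w: "norm ?w \<le> 2" by (rule W_le[OF assms(2)])
  have "q1 \<bullet> S ?w = lam1 * (q1 \<bullet> ?w)"
    unfolding S_sym[of q1 ?w] eig by (simp add: inner_commute)
  then have "zr k \<omega> = (q1 \<bullet> ?w) * (lam2 - ?w \<bullet> S ?w) + Delta * (q1 \<bullet> ?w - q1 \<bullet> Z k \<omega>)"
    by (simp add: zr_def f_def Delta_def inner_diff_right algebra_simps)
  also have "lam2 - ?w \<bullet> S ?w = (u - ?w) \<bullet> S u + ?w \<bullet> S (u - ?w)"
  proof -
    have "u \<bullet> S u = lam2"
      by (simp add: S_u power2_norm_eq_inner[symmetric])
    then show ?thesis
      by (simp add: linear_diff[OF lin] inner_diff_left inner_diff_right)
  qed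
  finally have "zr k \<omega> = (q1 \<bullet> (?w - u)) * ((u - ?w) \<bullet> S u + ?w \<bullet> S (u - ?w)) + Delta * (q1 \<bullet> (?w - Z k \<omega>))"
    by (simp add: inner_diff_right)
  then have "\<bar>zr k \<omega>\<bar> \<le> \<bar>(q1 \<bullet> (?w - u)) * ((u - ?w) \<bullet> S u + ?w \<bullet> S (u - ?w))\<bar> + \<bar>Delta * (q1 \<bullet> (?w - Z k \<omega>))\<bar>"
    by (simp only: abs_triangle_ineq)
  also have "\<dots> \<le> \<bar>q1 \<bullet> (?w - u)\<bar> * (\<bar>(u - ?w) \<bullet> S u\<bar> + \<bar>?w \<bullet> S (u - ?w)\<bar>) + Delta * \<bar>q1 \<bullet> (?w - Z k \<omega>)\<bar>"
    unfolding abs_mult using Delta by (intro add_mono mult_left_mono abs_triangle_ineq) auto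
  also have "\<dots> \<le> norm (?w - u) * (norm (?w - u) * (C\<^sup>2 * 1) + 2 * (C\<^sup>2 * norm (?w - u))) + G * b"
  proof (intro add_mono mult_mono)
    show "\<bar>q1 \<bullet> (?w - u)\<bar> \<le> norm (?w - u)"
      using Cauchy_Schwarz_ineq2[of q1 "?w - u"] q by simp
    show "\<bar>(u - ?w) \<bullet> S u\<bar> \<le> norm (?w - u) * (C\<^sup>2 * 1)"
      using norm_S_le[of u] by (intro order_trans[OF Cauchy_Schwarz_ineq2] mult_mono) (auto simp: norm_minus_commute)
    show "\<bar>?w \<bullet> S (u - ?w)\<bar> \<le> 2 * (C\<^sup>2 * norm (?w - u))"
      using norm_S_le[of "u - ?w"] w by (intro order_trans[OF Cauchy_Schwarz_ineq2] mult_mono) (auto simp: norm_minus_commute)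
    show "\<bar>q1 \<bullet> (?w - Z k \<omega>)\<bar> \<le> b"
      using Cauchy_Schwarz_ineq2[of q1 "?w - Z k \<omega>"] q Z_W_le[OF assms(2,1), of \<omega>] by (simp add: b_def norm_minus_commute)
  qed (use Delta G nonneg in auto)
  also have "\<dots> = (3 * C\<^sup>2) * (norm (?w - u))\<^sup>2 + G * b"
    by (simp add: power2_eq_square algebra_simps)
  also have "\<dots> \<le> G * (norm (?w - u))\<^sup>2 + G * b"
    using G nonneg by (intro add_mono mult_right_mono) auto
  finally show ?thesis .
qed

lemma zr_meas [measurable]: "zr k \<in> borel_measurable M"
  unfolding zr_def by measurable

lemma zp_facts:
  assumes "1 \<le> k" "real k * eta \<le> T"
  shows "zp k \<in> borel_measurable M" "integrable M (zp k)"
    "expectation (\<lambda>\<omega>. \<bar>zp k \<omega>\<bar>) \<le> exp (kap * Delta * T) * kap * T * (G * WB + G * b)"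
proof -
  let ?B = "exp (kap * Delta * T)"
  have t: "real j * eta \<le> T" if "j < k" for j
    using time_le[OF assms(2), of j] that by simp
  have W2: "integrable M (\<lambda>\<omega>. (norm (W j \<omega> - u))\<^sup>2)" if "j \<in> {1..<k}" for j
    using t that by (intro integrable_W_sq) auto
  have int: "integrable M (zr j)" if "j \<in> {1..<k}" for j
  proof (rule Bochner_Integration.integrable_bound)
    show "integrable M (\<lambda>\<omega>. G * (norm (W j \<omega> - u))\<^sup>2 + G * b)"
      using W2[OF that] by auto
    show "AE \<omega> in M. norm (zr j \<omega>) \<le> norm (G * (norm (W j \<omega> - u))\<^sup>2 + G * b)"
      using that t[of j] zr_le[of j] by (auto intro!: AE_I2 intro: order_trans[OF _ abs_ge_self])
  qed measurable
  have Er: "expectation (\<lambda>\<omega>. \<bar>zr j \<omega>\<bar>) \<le> G * WB + G * b" if "j \<in> {1..<k}" for j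
  proof -
    have "expectation (\<lambda>\<omega>. \<bar>zr j \<omega>\<bar>) \<le> expectation (\<lambda>\<omega>. G * (norm (W j \<omega> - u))\<^sup>2 + G * b)"
      using that t[of j] zr_le[of j] W2[OF that] int[OF that] by (intro integral_mono) auto
    also have "\<dots> = G * expectation (\<lambda>\<omega>. (norm (W j \<omega> - u))\<^sup>2) + G * b"
      using W2[OF that] by (simp add: prob_space)
    also have "\<dots> \<le> G * WB + G * b"
      using that t[of j] W_sq_le[of j] G by auto
    finally show ?thesis .
  qed
  show "zp k \<in> borel_measurable M"
    unfolding zp_def disc_def by measurable
  show intp: "integrable M (zp k)"
    unfolding zp_def disc_def using int by auto
  have "expectation (\<lambda>\<omega>. \<bar>zp k \<omega>\<bar>) \<le> expectation (\<lambda>\<omega>. \<Sum>j\<in>{1..<k}. ?B * st * \<bar>zr j \<omega>\<bar>)"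
  proof (rule integral_mono)
    show "integrable M (\<lambda>\<omega>. \<Sum>j\<in>{1..<k}. ?B * st * \<bar>zr j \<omega>\<bar>)"
      using int by (intro Bochner_Integration.integrable_sum integrable_mult_right) auto
    show "\<bar>zp k \<omega>\<bar> \<le> (\<Sum>j\<in>{1..<k}. ?B * st * \<bar>zr j \<omega>\<bar>)" for \<omega>
      unfolding zp_def disc_def
    proof (rule order_trans[OF sum_abs sum_mono])
      fix j assume j: "j \<in> {1..<k}"
      have "gr ^ (k - 1 - j) \<le> ?B"
        using time_le[OF assms(2), of "k - 1 - j"] by (intro gr) simp
      then show "\<bar>gr ^ (k - 1 - j) * (st * zr j \<omega>)\<bar> \<le> ?B * st * \<bar>zr j \<omega>\<bar>"
        using gr(1) nonneg by (simp add: abs_mult mult_right_mono)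
    qed
  qed (use intp in auto)
  also have "\<dots> = (\<Sum>j\<in>{1..<k}. ?B * st * expectation (\<lambda>\<omega>. \<bar>zr j \<omega>\<bar>))"
    using int by (subst Bochner_Integration.integral_sum) auto
  also have "\<dots> \<le> (\<Sum>j\<in>{1..<k}. ?B * st * (G * WB + G * b))"
    using nonneg by (intro sum_mono mult_left_mono Er) auto
  also have "\<dots> \<le> real k * (?B * st * (G * WB + G * b))"
    using nonneg G by (simp add: mult_right_mono)
  also have "\<dots> = ?B * kap * (real k * eta) * (G * WB + G * b)"
    by (simp add: st_def)
  also have "\<dots> \<le> ?B * kap * T * (G * WB + G * b)"
    using assms(2) nonneg G kap by (intro mult_right_mono mult_left_mono) auto
  finally show "expectation (\<lambda>\<omega>. \<bar>zp k \<omega>\<bar>) \<le> ?B * kap * T * (G * WB + G * b)" .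
qed

lemma zn_eq: "zn k \<omega> = q1 \<bullet> (oja (W k \<omega>) (X k \<omega>) - oja u (X k \<omega>)) - q1 \<bullet> (f (W k \<omega>) - f u)"
  by (simp add: zn_def noise_def g_def xi_eq inner_simps)

lemma zn_meas: "zn k \<in> borel_measurable (F (Suc k))"
proof -
  have [measurable]: "noise k \<in> borel_measurable (F (Suc k))" "X k \<in> borel_measurable (F (Suc k))"
    using noise_meas X_F[of k "Suc k"] by auto
  show ?thesis
    unfolding zn_def xi_def by measurable
qed

lemma zn_le:
  assumes "real k * eta \<le> T"
  shows "\<bar>zn k \<omega>\<bar> \<le> 4 * G * norm (W k \<omega> - u)"
proof -
  have "\<bar>q1 \<bullet> (oja (W k \<omega>) (X k \<omega>) - oja u (X k \<omega>))\<bar> \<le> 2 * G * norm (W k \<omega> - u)"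
    using Cauchy_Schwarz_ineq2[of q1 "oja (W k \<omega>) (X k \<omega>) - oja u (X k \<omega>)"] q
      norm_oja_diff_le[OF W_le[OF assms], of u "X k \<omega>" C \<omega>] X_bound[of k \<omega>] by (simp add: G_def)
  moreover have "\<bar>q1 \<bullet> (f (W k \<omega>) - f u)\<bar> \<le> 2 * G * norm (W k \<omega> - u)"
    using Cauchy_Schwarz_ineq2[of q1 "f (W k \<omega>) - f u"] q
      f_diff_le[OF W_le[OF assms], of u \<omega>] by simp
  ultimately show ?thesis
    unfolding zn_eq by linarith
qed

lemma zn_abs_le:
  assumes "real k * eta \<le> T"
  shows "\<bar>zn k \<omega>\<bar> \<le> 12 * G"
proof -
  have "4 * G * norm (W k \<omega> - u) \<le> 4 * G * 3"
    using G by (intro mult_left_mono norm_W_u_le assms) auto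
  then show ?thesis
    using zn_le[OF assms, of \<omega>] by simp
qed

lemma zq_facts:
  assumes "1 \<le> k" "real k * eta \<le> T"
  shows "zq k \<in> borel_measurable M" "integrable M (\<lambda>\<omega>. (zq k \<omega>)\<^sup>2)"
    "expectation (\<lambda>\<omega>. (zq k \<omega>)\<^sup>2) \<le> (exp (kap * Delta * T))\<^sup>2 * T * kap\<^sup>2 * (16 * G\<^sup>2 * WB) * eta"
proof -
  have *: "(\<lambda>\<omega>. disc gr (\<lambda>j. st * zn j \<omega>) k) \<in> borel_measurable (F k)
    \<and> (\<exists>B. \<forall>\<omega>. \<bar>disc gr (\<lambda>j. st * zn j \<omega>) k\<bar> \<le> B)
    \<and> expectation (\<lambda>\<omega>. (disc gr (\<lambda>j. st * zn j \<omega>) k)\<^sup>2) \<le> (gr\<^sup>2) ^ k * real k * (st\<^sup>2 * (16 * G\<^sup>2 * WB))"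
  proof (rule expectation_disc_sq_le[where K = k and b = "st * (12 * G)"])
    fix j assume j: "1 \<le> j" "j < k"
    have t: "real j * eta \<le> T"
      using time_le[OF assms(2), of j] j by simp
    have [measurable]: "zn j \<in> borel_measurable M"
      by (rule F_M[OF zn_meas])
    show "(\<lambda>\<omega>. st * zn j \<omega>) \<in> borel_measurable (F (Suc j))"
      by (intro borel_measurable_times borel_measurable_const zn_meas)
    show bd: "\<bar>st * zn j \<omega>\<bar> \<le> st * (12 * G)" for \<omega>
      using zn_abs_le[OF t, of \<omega>] nonneg by (simp add: abs_mult)
    have "expectation (\<lambda>\<omega>. (st * zn j \<omega>)\<^sup>2) \<le> expectation (\<lambda>\<omega>. st\<^sup>2 * (16 * G\<^sup>2 * (norm (W j \<omega> - u))\<^sup>2))"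
    proof (rule integral_mono)
      show "integrable M (\<lambda>\<omega>. (st * zn j \<omega>)\<^sup>2)"
        by (intro integrable_bounded_square[OF _ bd]) measurable
      show "(st * zn j \<omega>)\<^sup>2 \<le> st\<^sup>2 * (16 * G\<^sup>2 * (norm (W j \<omega> - u))\<^sup>2)" for \<omega>
        using power_mono[OF zn_le[OF t, of \<omega>], of 2] by (simp add: power_mult_distrib mult_left_mono)
    qed (use integrable_W_sq[OF t] in auto)
    also have "\<dots> \<le> st\<^sup>2 * (16 * G\<^sup>2 * WB)"
      using W_sq_le[OF j(1) t] by (simp add: mult_left_mono)
    finally show "expectation (\<lambda>\<omega>. (st * zn j \<omega>)\<^sup>2) \<le> st\<^sup>2 * (16 * G\<^sup>2 * WB)" .
    fix A :: "'a \<Rightarrow> real" and B :: real assume A: "A \<in> borel_measurable (F j)" "\<And>\<omega>. \<bar>A \<omega>\<bar> \<le> B"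
    note [measurable] = A(1) F_M[OF A(1)]
    have nn: "0 \<le> B" by (rule order_trans[OF abs_ge_zero A(2)])
    let ?\<phi> = "\<lambda>x. q1 \<bullet> oja u x"
    have \<phi>: "\<bar>?\<phi> (X j \<omega>)\<bar> \<le> 1 * G" for \<omega>
      using norm_oja_le[OF _ X_bound, of u j \<omega>] q
      by (intro order_trans[OF Cauchy_Schwarz_ineq2] mult_mono) (auto simp: G_def)
    have m\<phi> [measurable]: "?\<phi> \<in> borel_measurable borel"
      unfolding oja_def by measurable
    have "expectation (\<lambda>\<omega>. A \<omega> * ?\<phi> (X j \<omega>)) = expectation A * expectation (\<lambda>\<omega>. ?\<phi> (X j \<omega>))"
      by (rule expectation_hist_indep[OF indep A(1)[unfolded F_def] A(2) m\<phi> \<phi>])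
    then have x0: "expectation (\<lambda>\<omega>. A \<omega> * xi j \<omega>) = 0"
      by (simp add: xi_eq expectation_oja)
    have "expectation (\<lambda>\<omega>. (A \<omega> *\<^sub>R q1) \<bullet> noise j \<omega>) = 0"
      using A(2) q by (intro expectation_noise[of _ _ B] t) auto
    moreover have "integrable M (\<lambda>\<omega>. A \<omega> * xi j \<omega>)"
      unfolding xi_eq
    proof (rule integrable_bounded)
      show "norm (A \<omega> * ?\<phi> (X j \<omega>)) \<le> B * (1 * G)" for \<omega>
        unfolding real_norm_def abs_mult by (intro mult_mono A(2) \<phi> nn abs_ge_zero)
    qed measurable
    moreover have "integrable M (\<lambda>\<omega>. (A \<omega> *\<^sub>R q1) \<bullet> noise j \<omega>)"
    proof (rule integrable_bounded)
      note [measurable] = F_M[OF noise_meas[of j]]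
      show "(\<lambda>\<omega>. (A \<omega> *\<^sub>R q1) \<bullet> noise j \<omega>) \<in> borel_measurable M"
        by measurable
      show "norm ((A \<omega> *\<^sub>R q1) \<bullet> noise j \<omega>) \<le> B * (2 * G)" for \<omega>
        unfolding real_norm_def using A(2)[of \<omega>] q noise_le[OF t, of \<omega>] nn
        by (intro order_trans[OF Cauchy_Schwarz_ineq2 mult_mono]) auto
    qed
    ultimately have "expectation (\<lambda>\<omega>. (A \<omega> *\<^sub>R q1) \<bullet> noise j \<omega> - A \<omega> * xi j \<omega>) = 0"
      using x0 by simp
    moreover have "A \<omega> * (st * zn j \<omega>) = st * ((A \<omega> *\<^sub>R q1) \<bullet> noise j \<omega> - A \<omega> * xi j \<omega>)" for \<omega>
      by (simp add: zn_def algebra_simps)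
    ultimately show "expectation (\<lambda>\<omega>. A \<omega> * (st * zn j \<omega>)) = 0"
      by (simp only: integral_mult_right_zero mult_zero_right)
  next
    show "0 \<le> st\<^sup>2 * (16 * G\<^sup>2 * WB)"
      using nonneg by simp
  qed (use assms F_M F_Suc gr(1) in auto)
  then obtain B where B: "\<And>\<omega>. \<bar>zq k \<omega>\<bar> \<le> B"
    and sq: "expectation (\<lambda>\<omega>. (zq k \<omega>)\<^sup>2) \<le> (gr\<^sup>2) ^ k * real k * (st\<^sup>2 * (16 * G\<^sup>2 * WB))"
    by (auto simp: zq_def)
  show meas [measurable]: "zq k \<in> borel_measurable M"
    unfolding zq_def[abs_def] using * by (intro F_M) auto
  show "integrable M (\<lambda>\<omega>. (zq k \<omega>)\<^sup>2)"
    by (rule integrable_bounded_square[OF meas B])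
  note sq
  also have "(gr\<^sup>2) ^ k * real k * (st\<^sup>2 * (16 * G\<^sup>2 * WB)) = (gr ^ k)\<^sup>2 * (real k * eta) * (kap\<^sup>2 * (16 * G\<^sup>2 * WB) * eta)"
    by (simp add: st_def power2_eq_square power_mult_distrib mult_ac)
  also have "\<dots> \<le> (exp (kap * Delta * T))\<^sup>2 * T * (kap\<^sup>2 * (16 * G\<^sup>2 * WB) * eta)"
    using assms(2) gr nonneg kap eta
    by (intro mult_right_mono mult_mono power_mono) auto
  finally show "expectation (\<lambda>\<omega>. (zq k \<omega>)\<^sup>2) \<le> (exp (kap * Delta * T))\<^sup>2 * T * kap\<^sup>2 * (16 * G\<^sup>2 * WB) * eta"
    by (simp add: mult_ac)
qed

end

section \<open>The normal distribution and a central limit theorem\<close>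

abbreviation "Phi \<equiv> cdf std_normal_distribution"

interpretation std_normal: real_distribution std_normal_distribution
  by (rule real_dist_normal_dist)

lemma std_normal_Icc_eq_integral:
  "measure std_normal_distribution {a..b} = integral {a..b} std_normal_density"
proof -
  have "measure std_normal_distribution {a..b} = (LINT x|std_normal_distribution. indicator {a..b} x)"
    by simp
  also have "\<dots> = (LINT x|lborel. std_normal_density x *\<^sub>R indicator {a..b} x)"
    by (rule integral_density) auto
  also have "\<dots> = (LINT x:{a..b}|lborel. std_normal_density x)"
    by (simp add: set_lebesgue_integral_def mult.commute)
  also have "\<dots> = integral {a..b} std_normal_density"
  proof (rule set_borel_integral_eq_integral(2))
    show "set_integrable lborel {a..b} std_normal_density"
      unfolding set_integrable_def by (intro integrable_mult_indicator) auto
  qed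
  finally show ?thesis .
qed

lemma Phi_diff_eq_Icc:
  assumes "a \<le> b"
  shows "Phi b - Phi a = measure std_normal_distribution {a..b}"
proof (cases "a = b")
  case True
  then show ?thesis using std_normal_Icc_eq_integral[of b b] by simp
next
  case False
  have "measure std_normal_distribution {a..b} = measure std_normal_distribution ({a} \<union> {a<..b})"
    using assms by (intro arg_cong[where f = "measure _"]) auto
  also have "\<dots> = measure std_normal_distribution {a..a} + measure std_normal_distribution {a<..b}"
    by (subst std_normal.finite_measure_Union) auto
  finally show ?thesis
    using False assms std_normal_Icc_eq_integral[of a a] by (simp add: std_normal.cdf_diff_eq)
qed

lemma Phi_DERIV: "(Phi has_real_derivative std_normal_density x) (at x)"
proof -
  have "((\<lambda>t. integral {x - 1..t} std_normal_density) has_real_derivative std_normal_density x)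
      (at x within {x - 1..x + 1})"
    by (rule integral_has_real_derivative) (auto simp: normal_density_def intro!: continuous_intros)
  then have "((\<lambda>t. Phi (x - 1) + integral {x - 1..t} std_normal_density) has_real_derivative std_normal_density x)
      (at x within {x - 1..x + 1})"
    by (auto intro!: derivative_eq_intros)
  then have "(Phi has_real_derivative std_normal_density x) (at x within {x - 1..x + 1})"
  proof (rule has_field_derivative_transform_within[of _ _ _ _ 1])
    show "Phi (x - 1) + integral {x - 1..t} std_normal_density = Phi t" if "t \<in> {x - 1..x + 1}" for t
      using that Phi_diff_eq_Icc[of "x - 1" t] by (simp add: std_normal_Icc_eq_integral)
  qed auto
  then show ?thesis
    using at_within_Icc_at[of "x - 1" x "x + 1"] by simp
qed

lemma Phi_isCont: "isCont Phi x"
  using Phi_DERIV by (rule DERIV_isCont)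

lemma Phi_strict_mono: "x < y \<Longrightarrow> Phi x < Phi y"
  by (rule DERIV_pos_imp_increasing) (blast intro: Phi_DERIV normal_density_pos zero_less_one)+

text \<open>The sum \<open>Phi x + Phi (- x)\<close> has derivative 0 because the density is even,
  and it tends to 1 as \<open>x\<close> grows.\<close>

lemma Phi_minus: "Phi (- x) = 1 - Phi x"
proof -
  let ?g = "\<lambda>x. Phi x + Phi (- x)"
  have "(?g has_real_derivative 0) (at y)" for y
  proof -
    have "(?g has_real_derivative (std_normal_density y + std_normal_density (- y) * (- 1))) (at y)"
      by (intro DERIV_add Phi_DERIV DERIV_chain2[OF Phi_DERIV]) (auto intro!: derivative_eq_intros)
    then show ?thesis
      by (simp add: normal_density_def)
  qed
  then have c: "?g y = ?g x" for y
    by (intro DERIV_isconst_all) auto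
  have "(?g \<longlongrightarrow> 1 + 0) at_top"
    by (intro tendsto_add std_normal.cdf_lim_at_top_prob
        filterlim_compose[OF std_normal.cdf_lim_at_bot filterlim_uminus_at_bot_at_top])
  moreover have "?g = (\<lambda>_. ?g x)"
    using c by (rule ext)
  ultimately have "((\<lambda>_ :: real. ?g x) \<longlongrightarrow> 1) at_top"
    by (simp only: add_0_right)
  then have "?g x = 1"
    by (simp only: tendsto_const_iff trivial_limit_at_top_linorder simp_thms)
  then show ?thesis by simp
qed

lemma Phi_quantile:
  assumes "0 < q" "q < 1"
  shows "Phi (std_normal_quantile q) = q"
proof -
  have "\<forall>\<^sub>F x in at_bot. Phi x < q" "\<forall>\<^sub>F x in at_top. q < Phi x"
    using std_normal.cdf_lim_at_bot std_normal.cdf_lim_at_top_prob assms by (auto intro: order_tendstoD)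
  then obtain a b where a: "Phi a < q" and b: "q < Phi b"
    using eventually_happens'[OF trivial_limit_at_bot_linorder] eventually_happens'[OF trivial_limit_at_top_linorder]
    by meson
  have "a \<le> b"
    using a b Phi_strict_mono[of b a] by linarith
  then obtain z where z: "Phi z = q"
    using IVT[of Phi a q b] a b Phi_isCont by auto
  have "z' = z" if "Phi z' = q" for z'
    using that z Phi_strict_mono[of z z'] Phi_strict_mono[of z' z] by linarith
  then have "std_normal_quantile q = z"
    unfolding std_normal_quantile_def by (rule the_equality[of "\<lambda>z. Phi z = q", OF z])
  with z show ?thesis
    by simp
qed

lemma quantile_pos:
  assumes "1 / 2 < q" "q < 1"
  shows "0 < std_normal_quantile q"
proof (rule ccontr)
  assume "\<not> ?thesis"
  then have "Phi (std_normal_quantile q) \<le> Phi 0"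
    using Phi_strict_mono[of "std_normal_quantile q" 0] by (cases "std_normal_quantile q = 0") (simp, linarith)
  then show False
    using assms Phi_quantile[of q] Phi_minus[of 0] by simp
qed

text \<open>For \<open>m \<ge> 0\<close> the derivative in \<open>m\<close> is the density at the
  far endpoint \<open>- b - m\<close> minus that at the near endpoint \<open>b - m\<close>, hence
  nonpositive. Negative shifts reduce to positive ones by symmetry.\<close>

lemma Phi_interval_le:
  assumes "0 \<le> b"
  shows "Phi (b - m) - Phi (- b - m) \<le> 2 * Phi b - 1"
proof -
  have *: "Phi (b - m) - Phi (- b - m) \<le> 2 * Phi b - 1" if m: "0 \<le> m" for m
  proof -
    let ?g = "\<lambda>m. Phi (b - m) - Phi (- b - m)"
    have "?g m \<le> ?g 0"
    proof (rule DERIV_nonpos_imp_nonincreasing[OF m])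
      fix x assume x: "0 \<le> x" "x \<le> m"
      have "(?g has_real_derivative (std_normal_density (b - x) * (- 1) - std_normal_density (- b - x) * (- 1))) (at x)"
        by (intro DERIV_diff DERIV_chain2[OF Phi_DERIV]) (auto intro!: derivative_eq_intros)
      moreover have "std_normal_density (- b - x) \<le> std_normal_density (b - x)"
      proof -
        have "\<bar>b - x\<bar> \<le> \<bar>- b - x\<bar>" using assms x by auto
        then have "(b - x)\<^sup>2 \<le> (- b - x)\<^sup>2" by (simp only: abs_le_square_iff)
        then show ?thesis
          by (simp add: normal_density_def divide_right_mono)
      qed
      ultimately show "\<exists>y. (?g has_real_derivative y) (at x) \<and> y \<le> 0"
        by (intro exI[of _ "std_normal_density (b - x) * (- 1) - std_normal_density (- b - x) * (- 1)"]) simp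
    qed
    then show ?thesis
      by (simp add: Phi_minus)
  qed
  show ?thesis
  proof (cases "0 \<le> m")
    case False
    have "Phi (b - m) - Phi (- b - m) = Phi (b - (- m)) - Phi (- b - (- m))"
      using Phi_minus[of "b - m"] Phi_minus[of "b + m"] by (simp add: algebra_simps)
    with *[of "- m"] False show ?thesis by simp
  qed (rule *)
qed

context prob_space
begin

text \<open>The noise is bounded, so a vanishing largest weight \<open>d n\<close> plays the part of
  the Lindeberg condition. Each characteristic function is compared with the Gaussian factor of the
  same variance, and a difference of products of numbers in the unit disc is at most the sum of the
  differences.\<close>

lemma weighted_clt:
  fixes \<xi> :: "nat \<Rightarrow> 'a \<Rightarrow> real" and c :: "nat \<Rightarrow> nat \<Rightarrow> real" and J :: "nat \<Rightarrow> nat set"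
  assumes indep: "indep_vars (\<lambda>_. borel) \<xi> UNIV"
    and bound: "\<And>k \<omega>. \<bar>\<xi> k \<omega>\<bar> \<le> B"
    and mean: "\<And>k. expectation (\<xi> k) = 0"
    and var: "\<And>k. expectation (\<lambda>\<omega>. (\<xi> k \<omega>)\<^sup>2) = v"
    and c: "\<And>n k. k \<in> J n \<Longrightarrow> \<bar>c n k\<bar> \<le> d n" "d \<longlonglongrightarrow> 0"
    and sum: "(\<lambda>n. v * (\<Sum>k\<in>J n. (c n k)\<^sup>2)) \<longlonglongrightarrow> 1"
  shows "weak_conv_m (\<lambda>n. distr M borel (\<lambda>\<omega>. \<Sum>k\<in>J n. c n k * \<xi> k \<omega>)) std_normal_distribution"
proof (rule levy_continuity)
  have [measurable]: "\<xi> k \<in> borel_measurable M" for k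
    using indep by (auto simp: indep_vars_def)
  show "real_distribution (distr M borel (\<lambda>\<omega>. \<Sum>k\<in>J n. c n k * \<xi> k \<omega>))" for n
    by (intro real_distribution_distr) auto
  show "real_distribution std_normal_distribution"
    by (rule real_dist_normal_dist)
  fix t :: real
  have B: "0 \<le> B" using bound[of undefined undefined] by linarith
  have v: "0 \<le> v" unfolding var[of 0, symmetric] by simp
  let ?\<phi> = "\<lambda>k. char (distr M borel (\<xi> k))"
  have \<phi>: "char (distr M borel (\<lambda>\<omega>. \<Sum>k\<in>J n. c n k * \<xi> k \<omega>)) t = (\<Prod>k\<in>J n. ?\<phi> k (t * c n k))" for n
  proof -
    have "indep_vars (\<lambda>_. borel) (\<lambda>k \<omega>. c n k * \<xi> k \<omega>) (J n)"
      by (rule indep_vars_compose2[OF indep_vars_subset[OF indep]]) auto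
    then have "char (distr M borel (\<lambda>\<omega>. \<Sum>k\<in>J n. c n k * \<xi> k \<omega>)) t
        = (\<Prod>k\<in>J n. char (distr M borel (\<lambda>\<omega>. c n k * \<xi> k \<omega>)) t)"
      by (rule char_distr_sum)
    also have "\<dots> = (\<Prod>k\<in>J n. ?\<phi> k (t * c n k))"
      by (simp add: char_def integral_distr mult_ac)
    finally show ?thesis .
  qed
  let ?q = "\<lambda>n. \<Sum>k\<in>J n. (c n k)\<^sup>2" and ?p = "\<lambda>n. \<Prod>k\<in>J n. ?\<phi> k (t * c n k)"
    and ?w = "\<lambda>n k. exp (- ((t * c n k)\<^sup>2 * v / 2)) :: real"
  \<comment> \<open>\<open>s\<^sup>2 * K s\<close> is the error of one factor: the first part of
    \<open>K\<close> is the third-moment Taylor remainder, the second the error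
    \<open>x\<^sup>2\<close> of \<open>1 - x\<close> against \<open>exp (- x)\<close> at
    \<open>x = s\<^sup>2 * v / 2\<close>.\<close>
  define K where "K s = \<bar>s\<bar> * B ^ 3 / 6 + s\<^sup>2 * v\<^sup>2 / 4" for s
  have one: "cmod (?\<phi> k s - exp (- (s\<^sup>2 * v / 2))) \<le> s\<^sup>2 * K s" for k s
  proof -
    have int: "integrable M (\<xi> k)"
      using bound[of k] by (intro integrable_bounded[of _ B]) auto
    have int2: "integrable M (\<lambda>\<omega>. (\<xi> k \<omega>)\<^sup>2)"
      by (rule integrable_bounded_square[OF _ bound]) measurable
    have "cmod (?\<phi> k s - (1 - s\<^sup>2 * v / 2)) \<le> (s\<^sup>2 / 6) * expectation (\<lambda>\<omega>. min (6 * (\<xi> k \<omega>)\<^sup>2) (\<bar>s\<bar> * \<bar>\<xi> k \<omega>\<bar> ^ 3))"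
      using int int2 mean[of k] var[of k] by (intro char_approx3'[of "\<xi> k"]) auto
    also have "\<dots> \<le> (s\<^sup>2 / 6) * (\<bar>s\<bar> * B ^ 3)"
    proof (intro mult_left_mono expectation_le)
      have le: "min (6 * (\<xi> k \<omega>)\<^sup>2) (\<bar>s\<bar> * \<bar>\<xi> k \<omega>\<bar> ^ 3) \<le> \<bar>s\<bar> * B ^ 3" for \<omega>
        by (rule min.coboundedI2) (intro mult_left_mono power_mono bound, auto)
      then show "min (6 * (\<xi> k \<omega>)\<^sup>2) (\<bar>s\<bar> * \<bar>\<xi> k \<omega>\<bar> ^ 3) \<le> \<bar>s\<bar> * B ^ 3" for \<omega> .
      show "integrable M (\<lambda>\<omega>. min (6 * (\<xi> k \<omega>)\<^sup>2) (\<bar>s\<bar> * \<bar>\<xi> k \<omega>\<bar> ^ 3))"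
        using le by (intro integrable_bounded[of _ "\<bar>s\<bar> * B ^ 3"]) auto
    qed auto
    finally have 1: "cmod (?\<phi> k s - (1 - s\<^sup>2 * v / 2)) \<le> s\<^sup>2 * (\<bar>s\<bar> * B ^ 3 / 6)"
      by simp
    let ?x = "s\<^sup>2 * v / 2"
    have x: "0 \<le> ?x" using v by simp
    have lo: "1 - ?x \<le> exp (- ?x)"
      using exp_ge_add_one_self[of "- ?x"] by simp
    have "exp (- ?x) \<le> 1 / (1 + ?x)"
      using exp_ge_add_one_self[of ?x] x by (simp add: exp_minus inverse_eq_divide frac_le)
    also have "\<dots> \<le> 1 - ?x + ?x\<^sup>2"
    proof -
      have "(1 - ?x + ?x\<^sup>2) * (1 + ?x) = 1 + ?x ^ 3"
        by (simp add: power2_eq_square power3_eq_cube algebra_simps)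
      then have "1 \<le> (1 - ?x + ?x\<^sup>2) * (1 + ?x)"
        using x by simp
      then show ?thesis
        using x by (subst pos_divide_le_eq) auto
    qed
    finally have "\<bar>(1 - ?x) - exp (- ?x)\<bar> \<le> ?x\<^sup>2"
      using lo by simp
    then have 2: "cmod (of_real (1 - ?x) - of_real (exp (- ?x))) \<le> ?x\<^sup>2"
      unfolding of_real_diff[symmetric] norm_of_real .
    have "cmod (?\<phi> k s - of_real (exp (- ?x))) \<le> cmod (?\<phi> k s - (1 - ?x)) + cmod (of_real (1 - ?x) - of_real (exp (- ?x)))"
      using norm_triangle_ineq[of "?\<phi> k s - (1 - ?x)" "of_real (1 - ?x) - of_real (exp (- ?x))"] by simp
    also have "\<dots> \<le> s\<^sup>2 * (\<bar>s\<bar> * B ^ 3 / 6) + ?x\<^sup>2"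
      by (intro add_mono 1 2)
    also have "\<dots> = s\<^sup>2 * K s"
      by (simp add: K_def power2_eq_square field_simps)
    finally show ?thesis by simp
  qed
  have diff: "cmod (?p n - exp (- (t\<^sup>2 / 2) * (v * ?q n)))
      \<le> t\<^sup>2 * K (t * d n) * ?q n" for n
  proof -
    have "real_distribution (distr M borel (\<xi> k))" for k
      by (intro real_distribution_distr) auto
    note le1 = real_distribution.cmod_char_le_1[OF this]
    have "exp (- (t\<^sup>2 / 2) * (v * ?q n)) = (\<Prod>k\<in>J n. ?w n k)"
    proof (cases "finite (J n)")
      case True
      then show ?thesis
        by (simp add: exp_sum[symmetric] sum_distrib_left power_mult_distrib sum_negf mult_ac)
    qed simp
    then have "cmod (?p n - exp (- (t\<^sup>2 / 2) * (v * ?q n)))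
        = cmod (?p n - (\<Prod>k\<in>J n. of_real (?w n k)))"
      by (simp only: of_real_prod)
    also have "\<dots> \<le> (\<Sum>k\<in>J n. cmod (?\<phi> k (t * c n k) - of_real (?w n k)))"
      using le1 v by (intro norm_prod_diff) (auto simp del: of_real_exp)
    also have "\<dots> \<le> (\<Sum>k\<in>J n. (t\<^sup>2 * K (t * d n)) * (c n k)\<^sup>2)"
    proof (rule sum_mono)
      fix k assume k: "k \<in> J n"
      have "cmod (?\<phi> k (t * c n k) - of_real (?w n k)) \<le> (t * c n k)\<^sup>2 * K (t * c n k)"
        by (rule one)
      also have "K (t * c n k) \<le> K (t * d n)"
      proof -
        have "\<bar>t * c n k\<bar> \<le> \<bar>t * d n\<bar>"
          using c(1)[OF k] unfolding abs_mult by (intro mult_left_mono) auto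
        moreover from this have "(t * c n k)\<^sup>2 \<le> (t * d n)\<^sup>2"
          by (simp only: abs_le_square_iff)
        ultimately show ?thesis
          unfolding K_def using B by (intro add_mono divide_right_mono mult_right_mono) auto
      qed
      then have "(t * c n k)\<^sup>2 * K (t * c n k) \<le> (t * c n k)\<^sup>2 * K (t * d n)"
        by (intro mult_left_mono) auto
      finally show "cmod (?\<phi> k (t * c n k) - of_real (?w n k)) \<le> (t\<^sup>2 * K (t * d n)) * (c n k)\<^sup>2"
        by (simp add: power_mult_distrib mult_ac)
    qed
    finally show ?thesis
      by (simp add: sum_distrib_left)
  qed
  have v0: "v \<noteq> 0"
    using sum LIMSEQ_unique[of "\<lambda>_. 0 :: real" 0 1] by (cases "v = 0") auto
  have s: "(\<lambda>n. ?q n) \<longlonglongrightarrow> 1 / v"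
    using tendsto_divide[OF sum tendsto_const[of v]] v0 by simp
  have "(\<lambda>n. t\<^sup>2 * K (t * d n) * ?q n) \<longlonglongrightarrow> t\<^sup>2 * (\<bar>t * 0\<bar> * B ^ 3 / 6 + (t * 0)\<^sup>2 * v\<^sup>2 / 4) * (1 / v)"
    unfolding K_def by (intro tendsto_intros c(2) s) auto
  then have lim0: "(\<lambda>n. t\<^sup>2 * K (t * d n) * ?q n) \<longlonglongrightarrow> 0"
    by simp
  have "(\<lambda>n. ?p n - of_real (exp (- (t\<^sup>2 / 2) * (v * ?q n)))) \<longlonglongrightarrow> 0"
    by (rule Lim_null_comparison[OF always_eventually lim0]) (use diff in blast)
  moreover have "(\<lambda>n. complex_of_real (exp (- (t\<^sup>2 / 2) * (v * ?q n)))) \<longlonglongrightarrow> of_real (exp (- (t\<^sup>2 / 2) * 1))"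
    by (intro tendsto_intros sum)
  ultimately have "(\<lambda>n. ?p n) \<longlonglongrightarrow> of_real (exp (- (t\<^sup>2 / 2) * 1))"
    by (rule Lim_transform[rotated])
  then show "(\<lambda>n. char (distr M borel (\<lambda>\<omega>. \<Sum>k\<in>J n. c n k * \<xi> k \<omega>)) t) \<longlonglongrightarrow> char std_normal_distribution t"
    unfolding \<phi> by (simp add: char_std_normal_distribution)
qed

text \<open>The shift will be the deterministic part of the first coordinate, which varies with
  \<open>n\<close> and need not converge. Uniformity in \<open>m\<close> comes from a finite grid of
  shifts with mesh \<open>h\<close> and an interval widened by \<open>h\<close>; weak convergence is
  applied at the grid points only.\<close>

lemma shifted_small_ball:
  fixes W :: "nat \<Rightarrow> 'a \<Rightarrow> real"
  assumes W [measurable]: "\<And>n. W n \<in> borel_measurable M"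
    and conv: "weak_conv_m (\<lambda>n. distr M borel (W n)) std_normal_distribution"
    and b: "0 \<le> b" and \<epsilon>: "0 < \<epsilon>"
  shows "\<forall>\<^sub>F n in sequentially. \<forall>m. \<bar>m\<bar> \<le> R \<longrightarrow> prob {\<omega> \<in> space M. \<bar>m + W n \<omega>\<bar> \<le> b} \<le> 2 * Phi b - 1 + \<epsilon>"
proof -
  have "\<forall>\<^sub>F h in at_right 0. Phi (b + h) < Phi b + \<epsilon> / 4"
  proof -
    have "((\<lambda>h. Phi (b + h)) \<longlongrightarrow> Phi (b + 0)) (at_right 0)"
      by (intro isCont_tendsto_compose[OF Phi_isCont] tendsto_intros)
    then show ?thesis
      using \<epsilon> by (intro order_tendstoD(2)) auto
  qed
  then have "\<forall>\<^sub>F h in at_right 0. Phi (b + h) < Phi b + \<epsilon> / 4 \<and> 0 < h"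
    by (intro eventually_conj eventually_at_right_less)
  then obtain h where h: "Phi (b + h) < Phi b + \<epsilon> / 4" "0 < h"
    using eventually_happens'[OF trivial_limit_at_right_real] by blast
  let ?m = "measure std_normal_distribution"
  have grid: "\<forall>\<^sub>F n in sequentially. prob {\<omega> \<in> space M. \<bar>x + W n \<omega>\<bar> \<le> b + h} \<le> 2 * Phi b - 1 + \<epsilon>" for x
  proof -
    let ?A = "{- (b + h) - x..b + h - x}"
    interpret Wn: real_distribution "distr M borel (W n)" for n
      by (intro real_distribution_distr) auto
    have "?m (frontier ?A) \<le> ?m ({- (b + h) - x..- (b + h) - x} \<union> {b + h - x..b + h - x})"
      using b h(2) by (intro std_normal.finite_measure_mono) (auto simp: frontier_def)
    also have "\<dots> \<le> ?m {- (b + h) - x..- (b + h) - x} + ?m {b + h - x..b + h - x}"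
      by (intro measure_Un_le) auto
    also have "\<dots> = 0"
      by (simp only: std_normal_Icc_eq_integral) simp
    finally have "?m (frontier ?A) = 0"
      by (simp add: measure_le_0_iff)
    then have "(\<lambda>n. measure (distr M borel (W n)) ?A) \<longlonglongrightarrow> ?m ?A"
      by (intro weak_conv_imp_continuity_set_conv[OF Wn.real_distribution_axioms std_normal.real_distribution_axioms conv])
        (simp_all add: std_normal.emeasure_eq_measure)
    moreover have "?m ?A < 2 * Phi b - 1 + \<epsilon>"
      using Phi_interval_le[of "b + h" x] b h \<epsilon> Phi_diff_eq_Icc[of "- (b + h) - x" "b + h - x"] by simp
    ultimately have "\<forall>\<^sub>F n in sequentially. measure (distr M borel (W n)) ?A < 2 * Phi b - 1 + \<epsilon>"
      by (rule order_tendstoD(2))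
    moreover have "measure (distr M borel (W n)) ?A = prob {\<omega> \<in> space M. \<bar>x + W n \<omega>\<bar> \<le> b + h}" for n
      by (subst measure_distr) (auto intro!: arg_cong[where f = prob])
    ultimately show ?thesis
      by (auto elim: eventually_mono)
  qed
  define K where "K = \<lceil>\<bar>R\<bar> / h\<rceil> + 1"
  have "\<forall>\<^sub>F n in sequentially. \<forall>i\<in>{- K..K}. prob {\<omega> \<in> space M. \<bar>of_int i * h + W n \<omega>\<bar> \<le> b + h} \<le> 2 * Phi b - 1 + \<epsilon>"
    using grid by (intro eventually_ball_finite) auto
  then show ?thesis
  proof eventually_elim
    case (elim n)
    show ?case
    proof (intro allI impI)
      fix m :: real assume m: "\<bar>m\<bar> \<le> R"
      define i where "i = \<lfloor>m / h\<rfloor>"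
      have i1: "of_int i \<le> m / h" "m / h < of_int i + 1"
        unfolding i_def by linarith+
      then have i2: "\<bar>m - of_int i * h\<bar> \<le> h"
        using h(2) by (simp add: field_simps abs_le_iff)
      have "\<bar>m / h\<bar> \<le> \<bar>R\<bar> / h"
        using m h(2) by (simp add: divide_right_mono)
      then have "m / h \<le> \<bar>R\<bar> / h" "- (\<bar>R\<bar> / h) \<le> m / h"
        by linarith+
      then have "of_int i \<le> (of_int K :: real)" "- of_int K \<le> (of_int i :: real)"
        using i1 le_of_int_ceiling[of "\<bar>R\<bar> / h"] unfolding K_def of_int_add of_int_1 by linarith+
      then have "i \<in> {- K..K}"
        by simp
      with elim have "prob {\<omega> \<in> space M. \<bar>of_int i * h + W n \<omega>\<bar> \<le> b + h} \<le> 2 * Phi b - 1 + \<epsilon>"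
        by blast
      moreover have "prob {\<omega> \<in> space M. \<bar>m + W n \<omega>\<bar> \<le> b} \<le> prob {\<omega> \<in> space M. \<bar>of_int i * h + W n \<omega>\<bar> \<le> b + h}"
        using i2 by (intro finite_measure_mono) auto
      ultimately show "prob {\<omega> \<in> space M. \<bar>m + W n \<omega>\<bar> \<le> b} \<le> 2 * Phi b - 1 + \<epsilon>"
        by simp
    qed
  qed
qed

end

section \<open>The exit probability\<close>

context msgd_paths
begin

text \<open>The earlier bounds with horizon, start and delay at their worst cases. They involve only
  \<open>C\<close>, \<open>mu\<close>, \<open>Tm\<close> and \<open>R\<close>, so they stay fixed
  while \<open>eta\<close> tends to 0.\<close>

definition "WB_fac Tm R = 2 * (exp (6 * G * kap * Tm) * (2 * R\<^sup>2 + kap * Tm * (2 * G * (kap\<^sup>2 * G)\<^sup>2 + G\<^sup>2 * kap)))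
  + 2 * (kap\<^sup>2 * G)\<^sup>2"
definition "e_fac Tm R = 4 * kap\<^sup>2 * G\<^sup>2 * Tm * (kap\<^sup>2 * G) * sqrt Tm + 2 * kap\<^sup>2 * G\<^sup>2 * (8 * kap ^ 3 * G\<^sup>2) * Tm\<^sup>2
  + 4 * kap * Tm * (kap\<^sup>2 * G) * G * sqrt (WB_fac Tm R) + 4 * kap * (kap\<^sup>2 * G) * G * sqrt Tm"
definition "zp_fac Tm R = exp (kap * G * Tm) * kap * Tm * (G * WB_fac Tm R + G * (kap\<^sup>2 * G))"
definition "zq_fac Tm R = (exp (kap * G * Tm))\<^sup>2 * Tm * kap\<^sup>2 * (16 * G\<^sup>2 * WB_fac Tm R)"

lemma WB_fac_nonneg: "0 \<le> Tm \<Longrightarrow> 0 \<le> WB_fac Tm R"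
  using kap G by (simp add: WB_fac_def)

end

context msgd_saddle
begin

context
  fixes Tm R :: real
  assumes Tm: "T \<le> Tm" and rho: "rho\<^sup>2 \<le> eta" and d0: "d0\<^sup>2 \<le> 2 * R\<^sup>2 * eta"
begin

lemma b_sq_le: "b\<^sup>2 \<le> (kap\<^sup>2 * G)\<^sup>2 * eta"
  using rho by (simp add: b_def power_mult_distrib mult_left_mono)

lemma WB_le: "WB \<le> WB_fac Tm R * eta"
proof -
  have "DB \<le> exp (6 * G * kap * Tm) * (2 * R\<^sup>2 * eta + kap * Tm * (2 * G * ((kap\<^sup>2 * G)\<^sup>2 * eta) + G\<^sup>2 * kap * eta))"
    unfolding DB_def using Tm T kap G eta b_sq_le d0 nonneg
    by (intro mult_mono add_mono exp_le_cancel_iff[THEN iffD2] order_refl add_nonneg_nonneg mult_nonneg_nonneg) auto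
  then show ?thesis
    using b_sq_le by (simp add: WB_def WB_fac_def algebra_simps)
qed

lemma sqrt_WB_le: "sqrt WB \<le> sqrt (WB_fac Tm R) * sqrt eta"
  using WB_le by (simp add: real_sqrt_mult[symmetric])

lemma rho_le_sqrt: "rho \<le> sqrt eta"
  using rho by (rule real_le_rsqrt)

lemma e_rest_le: "e_rest \<le> e_fac Tm R * (rho * sqrt eta)"
proof -
  have Tm0: "0 \<le> Tm" using T Tm by simp
  have sT: "sqrt (T * eta) \<le> sqrt Tm * sqrt eta"
    using Tm eta by (simp add: real_sqrt_mult)
  have r: "rho\<^sup>2 \<le> rho * sqrt eta"
    using rho_le_sqrt eta_rho by (simp add: power2_eq_square)
  have b: "b = (kap\<^sup>2 * G) * rho"
    by (simp add: b_def)
  note nn = kap(1) G(1) eta_rho eta Tm0 T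
  have "4 * kap\<^sup>2 * G\<^sup>2 * T * b * sqrt (T * eta) \<le> 4 * kap\<^sup>2 * G\<^sup>2 * Tm * b * (sqrt Tm * sqrt eta)"
    using sT nn Tm nonneg by (intro mult_mono) auto
  moreover have "2 * kap\<^sup>2 * G\<^sup>2 * E1 * T\<^sup>2 * rho\<^sup>2 \<le> 2 * kap\<^sup>2 * G\<^sup>2 * E1 * Tm\<^sup>2 * (rho * sqrt eta)"
    using r nn Tm by (intro mult_mono power_mono) (auto simp: E1_def)
  moreover have "4 * kap * T * b * G * sqrt WB \<le> 4 * kap * Tm * b * G * (sqrt (WB_fac Tm R) * sqrt eta)"
    using sqrt_WB_le nn Tm nonneg WB_fac_nonneg[OF Tm0] by (intro mult_mono) auto
  moreover have "4 * kap * b * G * sqrt (T * eta) \<le> 4 * kap * b * G * (sqrt Tm * sqrt eta)"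
    using sT nn nonneg by (intro mult_mono) auto
  ultimately have "e_rest \<le> 4 * kap\<^sup>2 * G\<^sup>2 * Tm * b * (sqrt Tm * sqrt eta)
      + 2 * kap\<^sup>2 * G\<^sup>2 * E1 * Tm\<^sup>2 * (rho * sqrt eta)
      + 4 * kap * Tm * b * G * (sqrt (WB_fac Tm R) * sqrt eta) + 4 * kap * b * G * (sqrt Tm * sqrt eta)"
    unfolding e_rest_def by linarith
  also have "\<dots> = e_fac Tm R * (rho * sqrt eta)"
    unfolding b e_fac_def E1_def by (simp add: algebra_simps)
  finally show ?thesis .
qed

lemma exp_le: "exp (kap * Delta * T) \<le> exp (kap * G * Tm)"
  using kap Delta T Tm G by (auto intro!: mult_mono)

lemma expectation_zp_le:
  assumes "1 \<le> N" "real N * eta \<le> T"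
  shows "expectation (\<lambda>\<omega>. \<bar>zp N \<omega>\<bar>) \<le> zp_fac Tm R * (eta + rho)"
proof -
  have Tm0: "0 \<le> Tm" using T Tm by simp
  note K = WB_fac_nonneg[OF Tm0, of R]
  note zp_facts(3)[OF assms]
  also have "exp (kap * Delta * T) * kap * T * (G * WB + G * b)
      \<le> exp (kap * G * Tm) * kap * Tm * (G * (WB_fac Tm R * eta) + G * b)"
    using exp_le WB_le kap(1) G(1) T Tm nonneg K eta
    by (intro mult_mono add_mono) (auto intro!: mult_nonneg_nonneg add_nonneg_nonneg)
  also have "\<dots> \<le> exp (kap * G * Tm) * kap * Tm * ((G * WB_fac Tm R + G * (kap\<^sup>2 * G)) * (eta + rho))"
  proof (intro mult_left_mono)
    have "0 \<le> (G * WB_fac Tm R) * rho" "0 \<le> (G * (kap\<^sup>2 * G)) * eta"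
      using K G(1) kap(1) eta_rho eta by auto
    then show "G * (WB_fac Tm R * eta) + G * b \<le> (G * WB_fac Tm R + G * (kap\<^sup>2 * G)) * (eta + rho)"
      by (simp add: b_def algebra_simps)
  qed (use kap(1) Tm0 in auto)
  finally show ?thesis
    by (simp add: zp_fac_def)
qed

lemma expectation_zq_le:
  assumes "1 \<le> N" "real N * eta \<le> T"
  shows "expectation (\<lambda>\<omega>. (zq N \<omega>)\<^sup>2) \<le> zq_fac Tm R * eta\<^sup>2"
proof -
  have Tm0: "0 \<le> Tm" using T Tm by simp
  note K = WB_fac_nonneg[OF Tm0, of R]
  note zq_facts(3)[OF assms]
  also have "(exp (kap * Delta * T))\<^sup>2 * T * kap\<^sup>2 * (16 * G\<^sup>2 * WB) * eta
      \<le> (exp (kap * G * Tm))\<^sup>2 * Tm * kap\<^sup>2 * (16 * G\<^sup>2 * (WB_fac Tm R * eta)) * eta"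
    using exp_le WB_le kap(1) G(1) T Tm nonneg K eta
    by (intro mult_mono power_mono) (auto intro!: mult_nonneg_nonneg)
  finally show ?thesis
    by (simp add: zq_fac_def power2_eq_square mult_ac)
qed

text \<open>With the excess below \<open>B * eta\<close>, a large second coordinate forces
  \<open>\<bar>q1 \<bullet> V N \<omega>\<bar> < y\<close>; with both remainders below
  \<open>sqrt eta\<close>, the linear part then lies in the stated interval. The three exceptional
  events are bounded by Markov's inequality. Passing between \<open>Z\<close> and \<open>V\<close>
  costs \<open>5 * (kap\<^sup>2 * G) * eta\<close> in the squared norm and
  \<open>kap\<^sup>2 * G * eta\<close> in the coordinate.\<close>

lemma saddle_exit_bound:
  assumes N: "1 \<le> N" "real N * eta \<le> T" and B: "0 < B" and y: "0 \<le> y" "\<delta>\<^sup>2 + (B + 5 * (kap\<^sup>2 * G)) * eta \<le> y\<^sup>2"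
  shows "prob {\<omega> \<in> space M. 1 - \<delta>\<^sup>2 < (q2 \<bullet> V N \<omega>)\<^sup>2}
    \<le> (6 * kap ^ 3 * G\<^sup>2 * T + e_fac Tm R * (rho / sqrt eta)) / B
      + zp_fac Tm R * (sqrt eta + rho / sqrt eta) + zq_fac Tm R * eta
      + prob {\<omega> \<in> space M. \<bar>gr ^ (N - 1) * (q1 \<bullet> v0) + disc gr (\<lambda>j. st * xi j \<omega>) N\<bar> \<le> y + 2 * sqrt eta + kap\<^sup>2 * G * eta}"
proof -
  let ?th = "sqrt eta"
  have th: "0 < ?th" "?th * ?th = eta" "(?th)\<^sup>2 = eta"
    using eta by auto
  let ?E = "{\<omega> \<in> space M. B * eta \<le> \<bar>e N \<omega>\<bar>}"
  let ?P = "{\<omega> \<in> space M. ?th \<le> \<bar>zp N \<omega>\<bar>}"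
  let ?Q = "{\<omega> \<in> space M. ?th\<^sup>2 \<le> (zq N \<omega>)\<^sup>2}"
  let ?Y = "{\<omega> \<in> space M. \<bar>gr ^ (N - 1) * (q1 \<bullet> v0) + disc gr (\<lambda>j. st * xi j \<omega>) N\<bar> \<le> y + 2 * ?th + kap\<^sup>2 * G * eta}"
  note [measurable] = zp_facts(1)[OF N] zq_facts(1)[OF N]
  have [measurable]: "(\<lambda>\<omega>. disc gr (\<lambda>j. st * xi j \<omega>) N) \<in> borel_measurable M"
    unfolding disc_def xi_def by measurable
  have inte: "integrable M (e N)"
    using e_le[OF N(2)] by (intro integrable_bounded) auto
  have sub: "{\<omega> \<in> space M. 1 - \<delta>\<^sup>2 < (q2 \<bullet> V N \<omega>)\<^sup>2} \<subseteq> ((?E \<union> ?P) \<union> ?Q) \<union> ?Y"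
  proof (rule subsetI, rule ccontr)
    fix \<omega> assume \<omega>: "\<omega> \<in> {\<omega> \<in> space M. 1 - \<delta>\<^sup>2 < (q2 \<bullet> V N \<omega>)\<^sup>2}" "\<omega> \<notin> ((?E \<union> ?P) \<union> ?Q) \<union> ?Y"
    then have lt: "1 - \<delta>\<^sup>2 < (q2 \<bullet> V N \<omega>)\<^sup>2" and e: "\<bar>e N \<omega>\<bar> < B * eta" and p: "\<bar>zp N \<omega>\<bar> < ?th"
      and qq: "(zq N \<omega>)\<^sup>2 < ?th\<^sup>2"
      and Y: "y + 2 * ?th + kap\<^sup>2 * G * eta < \<bar>gr ^ (N - 1) * (q1 \<bullet> v0) + disc gr (\<lambda>j. st * xi j \<omega>) N\<bar>"
      by (auto simp: not_le)
    have q': "\<bar>zq N \<omega>\<bar> < ?th"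
      using qq th(1) by (intro power2_less_imp_less[of "\<bar>zq N \<omega>\<bar>" ?th]) (simp_all only: power2_abs less_imp_le)
    have "(q1 \<bullet> V N \<omega>)\<^sup>2 + (q2 \<bullet> V N \<omega>)\<^sup>2 \<le> (norm (V N \<omega>))\<^sup>2"
      by (rule bessel_two[OF q])
    also have "\<dots> \<le> 1 + B * eta + 5 * (kap\<^sup>2 * G * eta)"
      using Z_V_sq_le[OF N(2), of \<omega>] e by (simp add: e_def)
    finally have "(q1 \<bullet> V N \<omega>)\<^sup>2 < y\<^sup>2"
      using lt y(2) by (simp add: algebra_simps)
    then have V: "\<bar>q1 \<bullet> V N \<omega>\<bar> < y"
      using y(1) by (intro power2_less_imp_less[of "\<bar>q1 \<bullet> V N \<omega>\<bar>" y]) (simp_all only: power2_abs)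
    have "\<bar>q1 \<bullet> (Z N \<omega> - V N \<omega>)\<bar> \<le> kap\<^sup>2 * G * eta"
      using Cauchy_Schwarz_ineq2[of q1 "Z N \<omega> - V N \<omega>"] Z_V_le[OF N(2), of \<omega>] q by simp
    then have "\<bar>q1 \<bullet> Z N \<omega>\<bar> \<le> y + kap\<^sup>2 * G * eta"
      using V by (simp add: inner_diff_right)
    then show False
      using q1_Z_eq[OF N(1), of \<omega>] p q' Y by linarith
  qed
  have "prob {\<omega> \<in> space M. 1 - \<delta>\<^sup>2 < (q2 \<bullet> V N \<omega>)\<^sup>2} \<le> prob (((?E \<union> ?P) \<union> ?Q) \<union> ?Y)"
    using sub by (intro finite_measure_mono) measurable
  also have "\<dots> \<le> prob ((?E \<union> ?P) \<union> ?Q) + prob ?Y"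
    by (intro measure_Un_le) measurable
  also have "prob ((?E \<union> ?P) \<union> ?Q) \<le> prob (?E \<union> ?P) + prob ?Q"
    by (intro measure_Un_le) measurable
  also have "prob (?E \<union> ?P) \<le> prob ?E + prob ?P"
    by (intro measure_Un_le) measurable
  also have "prob ?E \<le> (6 * kap ^ 3 * G\<^sup>2 * T + e_fac Tm R * (rho / sqrt eta)) / B"
  proof -
    have "prob ?E \<le> expectation (\<lambda>\<omega>. \<bar>e N \<omega>\<bar>) / (B * eta)"
      using inte B eta by (intro integral_Markov_inequality_measure[where A = "{}"]) auto
    also have "\<dots> \<le> (6 * kap ^ 3 * G\<^sup>2 * T * eta + e_fac Tm R * (rho * sqrt eta)) / (B * eta)"
      using expectation_e_le[OF N] e_rest_le B eta by (intro divide_right_mono) auto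
    also have "rho * sqrt eta = (rho / sqrt eta) * eta"
      using th by (simp add: field_simps)
    also have "6 * kap ^ 3 * G\<^sup>2 * T * eta + e_fac Tm R * (rho / sqrt eta * eta)
        = (6 * kap ^ 3 * G\<^sup>2 * T + e_fac Tm R * (rho / sqrt eta)) * eta"
      by (simp only: distrib_right mult.assoc)
    also have "\<dots> / (B * eta) = (6 * kap ^ 3 * G\<^sup>2 * T + e_fac Tm R * (rho / sqrt eta)) / B"
      using eta by (intro mult_divide_mult_cancel_right) simp
    finally show ?thesis .
  qed
  also have "prob ?P \<le> zp_fac Tm R * (sqrt eta + rho / sqrt eta)"
  proof -
    have "prob ?P \<le> expectation (\<lambda>\<omega>. \<bar>zp N \<omega>\<bar>) / ?th"
      using zp_facts(2)[OF N] th by (intro integral_Markov_inequality_measure[where A = "{}"]) auto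
    also have "\<dots> \<le> zp_fac Tm R * (eta + rho) / ?th"
      using expectation_zp_le[OF N] th by (intro divide_right_mono) auto
    also have "\<dots> = zp_fac Tm R * (eta / ?th + rho / ?th)"
      by (simp only: add_divide_distrib[symmetric] times_divide_eq_right)
    also have "eta / ?th = ?th"
      using eta by (simp add: real_div_sqrt)
    finally show ?thesis .
  qed
  also have "prob ?Q \<le> zq_fac Tm R * eta"
  proof -
    have "prob ?Q \<le> expectation (\<lambda>\<omega>. (zq N \<omega>)\<^sup>2) / ?th\<^sup>2"
      using zq_facts(2)[OF N] th by (intro integral_Markov_inequality_measure[where A = "{}"]) auto
    also have "\<dots> \<le> zq_fac Tm R * eta\<^sup>2 / eta"
      using expectation_zq_le[OF N] th eta by (simp add: divide_right_mono)
    finally show ?thesis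
      using eta by (simp add: power2_eq_square)
  qed
  finally show ?thesis
    by simp
qed

end

end

section \<open>Growth and variance at the exit time\<close>

lemma geometric_disc: "disc r (\<lambda>_. 1) N * (r - 1) = r ^ (N - 1) - 1"
proof (cases "1 \<le> N")
  case True
  then show ?thesis
  proof (induction N rule: dec_induct)
    case (step k)
    then have "disc r (\<lambda>_. 1) (Suc k) * (r - 1) = r * (r ^ (k - 1) - 1) + (r - 1)"
      by (simp add: disc_Suc distrib_right mult.assoc)
    also have "\<dots> = r ^ (Suc k - 1) - 1"
      using step.hyps by (cases k) (simp_all add: algebra_simps)
    finally show ?case .
  qed simp
qed (simp add: disc_def)

text \<open>The floor in \<open>N\<close> and the exponent \<open>N - 1\<close> lose one step each,
  hence \<open>2 * eta\<close>; replacing \<open>ln (1 + g)\<close> by \<open>g - g\<^sup>2\<close>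
  loses the rest. For a fixed ratio \<open>g / eta\<close> the correction exponent tends to 0 with
  \<open>g\<close>.\<close>

lemma growth_lower:
  fixes g eta T Tm :: real
  assumes g: "0 < g" "g \<le> 1" and eta: "0 < eta" and T: "0 \<le> T" "T \<le> Tm"
    and N: "N = nat \<lfloor>T / eta\<rfloor>" "1 \<le> N"
  shows "exp (2 * (g / eta) * T) * exp (- (2 * g * (2 + Tm * (g / eta)))) \<le> ((1 + g)\<^sup>2) ^ (N - 1)"
proof -
  define c where "c = g / eta"
  have gc: "g = c * eta" and c: "0 < c"
    using g eta by (simp_all add: c_def)
  have "T / eta - 1 < real N"
    using N T eta by (simp add: of_nat_nat)
  then have "T - 2 * eta \<le> (real N - 1) * eta"
    using eta by (simp add: field_simps)
  then have "(T - 2 * eta) * (c * (1 - g)) \<le> ((real N - 1) * eta) * (c * (1 - g))"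
    using g c by (intro mult_right_mono) auto
  also have "\<dots> = (real N - 1) * (g - g\<^sup>2)"
    by (simp add: gc power2_eq_square algebra_simps)
  also have "\<dots> \<le> (real N - 1) * ln (1 + g)"
    using g N by (intro mult_left_mono ln_one_plus_pos_lower_bound) auto
  finally have 1: "(T - 2 * eta) * (c * (1 - g)) \<le> (real N - 1) * ln (1 + g)" .
  have "T * (g * c) \<le> Tm * (g * c)"
    using T g c by (intro mult_right_mono) auto
  moreover have "(T - 2 * eta) * (c * (1 - g)) = c * T - T * (g * c) - 2 * g + 2 * (g * g)"
    by (simp add: gc algebra_simps)
  moreover have "g * (2 + Tm * c) = 2 * g + Tm * (g * c)"
    by (simp add: algebra_simps)
  ultimately have "c * T - g * (2 + Tm * c) \<le> (real N - 1) * ln (1 + g)"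
    using 1 mult_nonneg_nonneg[of g g] g by linarith
  then have "2 * c * T + - (2 * g * (2 + Tm * c)) \<le> 2 * (real N - 1) * ln (1 + g)"
    by (simp add: algebra_simps)
  then have "exp (2 * (g / eta) * T) * exp (- (2 * g * (2 + Tm * (g / eta)))) \<le> exp (2 * (real N - 1) * ln (1 + g))"
    by (simp only: c_def exp_add[symmetric] exp_le_cancel_iff)
  also have "2 * (real N - 1) * ln (1 + g) = real (2 * (N - 1)) * ln (1 + g)"
    using N by (simp add: of_nat_diff)
  also have "exp \<dots> = (1 + g) ^ (2 * (N - 1))"
    using g by (simp only: exp_of_nat_mult exp_ln)
  also have "\<dots> = ((1 + g)\<^sup>2) ^ (N - 1)"
    by (simp add: power_mult)
  finally show ?thesis .
qed

text \<open>A square-root bound on the logarithm is enough: it makes the exit time at most linear in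
  \<open>delta / sqrt eta\<close>, and a linear term can be absorbed by completing the square around
  \<open>delta\<close>.\<close>

lemma ln_one_plus_le_sqrt:
  assumes "0 \<le> x"
  shows "ln (1 + x) \<le> 2 * sqrt x"
proof -
  have "1 + x \<le> (1 + sqrt x)\<^sup>2"
    using assms by (simp add: power2_eq_square algebra_simps)
  then have "ln (1 + x) \<le> ln ((1 + sqrt x)\<^sup>2)"
    using assms by (intro ln_mono) auto
  also have "\<dots> = 2 * ln (1 + sqrt x)"
    using assms by (simp add: ln_realpow add_pos_nonneg)
  also have "\<dots> \<le> 2 * sqrt x"
    using assms ln_add_one_self_le_self[of "sqrt x"] by simp
  finally show ?thesis .
qed

text \<open>The data that do not vary with the step size, so that \<open>slope\<close> and
  \<open>excess\<close> may enter \<open>c0\<close>.\<close>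

locale oja_data = prob_space M
  for M :: "'a measure" +
  fixes X :: "nat \<Rightarrow> 'a \<Rightarrow> real^'n" and S :: "real^'n \<Rightarrow> real^'n" and C mu lam1 lam2 al nu :: real
    and q1 q2 :: "real^'n"
  assumes X_bound: "norm (X k \<omega>) \<le> C"
    and C: "1 \<le> C"
    and mu: "0 \<le> mu" "mu < 1"
    and indep: "indep_vars (\<lambda>_. borel) X UNIV"
    and lin: "linear S"
    and cov: "expectation (\<lambda>\<omega>. (X k \<omega> \<bullet> u) * (X k \<omega> \<bullet> w)) = u \<bullet> S w"
    and q: "norm q1 = 1" "norm q2 = 1" "q1 \<bullet> q2 = 0"
    and eig: "S q1 = lam1 *\<^sub>R q1" "S q2 = lam2 *\<^sub>R q2"
    and lam: "0 < lam2" "lam2 < lam1"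
    and fourth: "expectation (\<lambda>\<omega>. ((X k \<omega> \<bullet> q1) * (X k \<omega> \<bullet> q2))\<^sup>2) = al\<^sup>2" and al: "0 < al"
    and nu: "0 < nu" "nu < 1"
begin

definition "z = std_normal_quantile ((1 + nu / 2) / 2)"
definition "gap = lam1 - lam2"
definition "kp = 1 / (1 - mu)"
definition "GG = 10 * C\<^sup>2"
text \<open>Chosen so that \<open>exp (2 * (kp * gap) * T1) = 1 + growth * (delta / sqrt
  eta)\<^sup>2\<close>; the factors in it turn the resulting variance into
  \<open>(delta / z)\<^sup>2\<close>.\<close>

definition "growth = 2 * gap / (kp * z\<^sup>2 * al\<^sup>2)"
definition "T_exit eta delta = T1 mu nu lam1 lam2 al eta delta"
definition "slope = sqrt growth / (kp * gap)"
text \<open>\<open>8 / nu\<close> is Markov's inequality at level \<open>nu / 8\<close>. It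
  multiplies the leading term of the expected excess, with the time bounded through
  \<open>slope\<close>, and a 1 that caps \<open>e_rest\<close> in units of \<open>eta\<close>. The
  last summand pays for passing from \<open>Z\<close> to \<open>V\<close>.\<close>

definition "excess = (8 / nu) * (6 * kp ^ 3 * GG\<^sup>2 * (1 + slope) + 1) + 5 * (kp\<^sup>2 * GG)"

lemma z: "0 < z" "2 * Phi z - 1 = nu / 2"
  using nu quantile_pos[of "(1 + nu / 2) / 2"] Phi_quantile[of "(1 + nu / 2) / 2"]
  by (auto simp: z_def)

lemma data_pos: "0 < gap" "1 \<le> kp" "10 \<le> GG" "0 < growth" "0 < slope" "0 < excess"
proof -
  show D: "0 < gap" using lam by (simp add: gap_def)
  show k: "1 \<le> kp" using mu by (simp add: kp_def)
  show G: "10 \<le> GG" using C one_le_power[of C 2] by (simp add: GG_def)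
  show w: "0 < growth" using D k z al by (simp add: growth_def)
  then show A: "0 < slope" using D k by (simp add: slope_def)
  show "0 < excess" using A k G nu by (auto simp: excess_def intro!: add_pos_nonneg mult_pos_pos add_nonneg_pos)
qed

lemma T_exit_eq:
  assumes "0 < eta"
  shows "T_exit eta delta = ln (1 + growth * (delta / sqrt eta)\<^sup>2) / (2 * (kp * gap))"
proof -
  have "2 * (1 - mu) * inverse eta * delta\<^sup>2 * (lam1 - lam2) / (z\<^sup>2 * al\<^sup>2) = growth * (delta / sqrt eta)\<^sup>2"
    using assms mu by (simp add: growth_def gap_def kp_def field_simps)
  moreover have "(1 - mu) / (2 * (lam1 - lam2)) = 1 / (2 * (kp * gap))"
    using mu by (simp add: gap_def kp_def)
  ultimately show ?thesis
    by (simp add: T_exit_def T1_def z_def[symmetric] add.commute)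
qed

lemma exp_TT:
  assumes "0 < eta"
  shows "exp (2 * (kp * gap) * T_exit eta delta) = 1 + growth * (delta / sqrt eta)\<^sup>2"
proof -
  have "0 < 1 + growth * (delta / sqrt eta)\<^sup>2"
    using data_pos by (auto intro!: add_pos_nonneg)
  then show ?thesis
    using data_pos by (simp add: T_exit_eq[OF assms])
qed

lemma T_exit_bounds:
  assumes "0 < eta" "0 < delta"
  shows "0 \<le> T_exit eta delta" "T_exit eta delta \<le> slope * (delta / sqrt eta)"
proof -
  let ?k = "delta / sqrt eta"
  have k: "0 < ?k" using assms by simp
  show "0 \<le> T_exit eta delta"
    unfolding T_exit_eq[OF assms(1)] using data_pos by (intro divide_nonneg_pos ln_ge_zero) auto
  have "ln (1 + growth * ?k\<^sup>2) \<le> 2 * sqrt (growth * ?k\<^sup>2)"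
    using data_pos by (intro ln_one_plus_le_sqrt) auto
  also have "\<dots> = 2 * (sqrt growth * ?k)"
    using k by (simp only: real_sqrt_mult real_sqrt_abs abs_of_pos)
  finally have "T_exit eta delta \<le> 2 * (sqrt growth * ?k) / (2 * (kp * gap))"
    unfolding T_exit_eq[OF assms(1)] using data_pos by (intro divide_right_mono) auto
  then show "T_exit eta delta \<le> slope * ?k"
    by (simp add: slope_def mult_ac)
qed

text \<open>The variance, in units of \<open>eta\<close>, of the linearised first coordinate after \<open>N\<close> steps.\<close>
definition "noise_var eta N = (al * kp)\<^sup>2 * eta * disc ((1 + kp * eta * gap)\<^sup>2) (\<lambda>_. 1) N"

text \<open>With \<open>x = growth * (delta / sqrt eta)\<^sup>2\<close>, the geometric sum yields
  \<open>(1 + x) * exp (- r) - 1\<close> where \<open>x\<close> is wanted. The two are comparable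
  only for \<open>x\<close> bounded away from 0, here by \<open>x0\<close>, which is another use of
  the lower bound on \<open>delta\<close>. The factor \<open>L\<close>, later taken below 1, is what
  discretisation costs.\<close>

lemma noise_var_ge:
  assumes eta: "0 < eta" and delta: "0 < delta" and g: "kp * eta * gap \<le> 1"
    and T: "T_exit eta delta \<le> Tm" and N: "N = nat \<lfloor>T_exit eta delta / eta\<rfloor>" "1 \<le> N"
    and x0: "0 < x0" "x0 \<le> growth * (delta / sqrt eta)\<^sup>2"
    and r: "r = 2 * (kp * eta * gap) * (2 + Tm * (kp * gap))"
    and L: "0 \<le> L" "L * (2 + kp * eta * gap) \<le> 2 * (exp (- r) - (1 - exp (- r)) / x0)"
  shows "L * ((delta / sqrt eta) / z)\<^sup>2 \<le> noise_var eta N"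
proof -
  define g' where "g' = kp * eta * gap"
  have g': "0 < g'" "g' \<le> 1" using g eta data_pos by (auto simp: g'_def)
  have gd: "g' / eta = kp * gap" using eta by (simp add: g'_def)
  define x where "x = growth * (delta / sqrt eta)\<^sup>2"
  have x: "x0 \<le> x" "0 < x" using x0 by (auto simp: x_def)
  have Tm: "0 \<le> Tm" using T T_exit_bounds[OF eta delta] by simp
  have r0: "0 \<le> r" using g' Tm data_pos unfolding r g'_def[symmetric] by auto
  have "(1 + x) * exp (- r) \<le> ((1 + g')\<^sup>2) ^ (N - 1)"
    using growth_lower[OF g' eta T_exit_bounds(1)[OF eta delta] T N]
    unfolding gd exp_TT[OF eta, of delta] x_def[symmetric] r g'_def[symmetric] by simp
  moreover have "x * (exp (- r) - (1 - exp (- r)) / x0) \<le> (1 + x) * exp (- r) - 1"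
  proof -
    have "1 - exp (- r) \<le> x * ((1 - exp (- r)) / x0)"
      using x x0 r0 mult_right_mono[OF x(1), of "(1 - exp (- r)) / x0"] by (simp add: divide_nonneg_pos)
    then show ?thesis by (simp add: algebra_simps)
  qed
  ultimately have p: "x * (exp (- r) - (1 - exp (- r)) / x0) \<le> ((1 + g')\<^sup>2) ^ (N - 1) - 1"
    by simp
  have den: "(1 + g')\<^sup>2 - 1 = g' * (2 + g')"
    by (simp add: power2_eq_square algebra_simps)
  have "disc ((1 + g')\<^sup>2) (\<lambda>_. 1) N * (g' * (2 + g')) = ((1 + g')\<^sup>2) ^ (N - 1) - 1"
    using geometric_disc[of "(1 + g')\<^sup>2" N] unfolding den .
  then have d: "disc ((1 + g')\<^sup>2) (\<lambda>_. 1) N = (((1 + g')\<^sup>2) ^ (N - 1) - 1) / (g' * (2 + g'))"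
    using g' by (intro eq_divide_imp) auto
  have "x * (L * (2 + g')) \<le> x * (2 * (exp (- r) - (1 - exp (- r)) / x0))"
    using L x unfolding g'_def by (intro mult_left_mono) auto
  also have "\<dots> \<le> 2 * (((1 + g')\<^sup>2) ^ (N - 1) - 1)"
    by (subst mult.left_commute) (intro mult_left_mono p, simp)
  finally have le: "x * (L * (2 + g')) \<le> 2 * (((1 + g')\<^sup>2) ^ (N - 1) - 1)" .
  have "x * L / (2 * g') = x * (L * (2 + g')) / (2 * (g' * (2 + g')))"
    using g' by (simp only: mult.assoc[symmetric]) simp
  also have "\<dots> \<le> 2 * (((1 + g')\<^sup>2) ^ (N - 1) - 1) / (2 * (g' * (2 + g')))"
    using g' le by (intro divide_right_mono) auto
  also have "\<dots> = disc ((1 + g')\<^sup>2) (\<lambda>_. 1) N"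
    unfolding d by (rule mult_divide_mult_cancel_left) simp
  finally have "x * L / (2 * g') \<le> disc ((1 + g')\<^sup>2) (\<lambda>_. 1) N" .
  then have "(al * kp)\<^sup>2 * eta * (x * L / (2 * g')) \<le> noise_var eta N"
    unfolding noise_var_def g'_def using eta by (intro mult_left_mono) auto
  moreover have "(al * kp)\<^sup>2 * eta * (x * L / (2 * g')) = L * ((delta / sqrt eta) / z)\<^sup>2"
    using eta data_pos al z by (simp add: x_def growth_def g'_def power_mult_distrib power_divide power2_eq_square[of kp] mult_ac)
  ultimately show ?thesis by simp
qed

definition "msgd eta tau v0 N \<omega> = async_msgd eta mu tau (\<lambda>k. X k \<omega>) v0 N"
definition "e_fac0 Tm R = msgd_paths.e_fac C mu Tm R"
definition "zp_fac0 Tm R = msgd_paths.zp_fac C mu Tm R"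
definition "zq_fac0 Tm R = msgd_paths.zq_fac C mu Tm R"

text \<open>The bound before any limit: \<open>sm1\<close> to \<open>sm5\<close> are smallness
  conditions that will hold eventually. The linear part is divided by \<open>sqrt eta * sg\<close>,
  where \<open>sg\<close> is its standard deviation in units of \<open>sqrt eta\<close>, to prepare
  the normal approximation.\<close>

lemma exit_bound_pointwise:
  fixes eta delta R :: real and tau m v0
  defines "rho \<equiv> eta * (real m + 1)" and "Tn \<equiv> T_exit eta delta" and "k \<equiv> delta / sqrt eta"
  defines "s \<equiv> if 0 \<le> q2 \<bullet> v0 then 1 else -1 :: real"
  defines "N \<equiv> nat \<lfloor>Tn / eta\<rfloor>" and "gr \<equiv> 1 + kp * eta * gap" and "sg \<equiv> sqrt (noise_var eta (nat \<lfloor>T_exit eta delta / eta\<rfloor>))"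
  assumes eta: "0 < eta" and delta: "0 < delta" "delta \<le> R * sqrt eta"
    and tau: "\<And>k. 1 \<le> k \<Longrightarrow> tau k \<le> m" and v0: "norm v0 = 1" "1 - delta\<^sup>2 \<le> (q2 \<bullet> v0)\<^sup>2"
    and N: "1 \<le> N" and Tm: "1 + Tn \<le> Tm"
    and sm1: "8 * kp ^ 3 * GG\<^sup>2 * (1 + Tn) * rho \<le> 1" and sm2: "rho\<^sup>2 \<le> eta"
    and sm3: "e_fac0 Tm R * (rho / sqrt eta) \<le> 1"
    and sm4: "zp_fac0 Tm R * (sqrt eta + rho / sqrt eta) + zq_fac0 Tm R * eta \<le> nu / 8"
    and sm5: "kp\<^sup>2 * GG * sqrt eta \<le> 1"
    and h: "0 < h" "excess + 4 \<le> h * k" and sg: "k / (z * (1 + h)) \<le> sg"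
  shows "prob {\<omega> \<in> space M. 1 - delta\<^sup>2 < (q2 \<bullet> msgd eta tau v0 N \<omega>)\<^sup>2}
    \<le> nu / 4 + prob {\<omega> \<in> space M. \<bar>gr ^ (N - 1) * (q1 \<bullet> v0) / (sqrt eta * sg)
        + (\<Sum>j\<in>{1..<N}. (gr ^ (N - 1 - j) * (kp * sqrt eta) * s / sg) * ((X j \<omega> \<bullet> q1) * (X j \<omega> \<bullet> q2)))\<bar> \<le> z * (1 + h)\<^sup>2}"
    (is "_ \<le> _ + prob ?S")
proof -
  have k: "0 < k" using eta delta by (simp add: k_def)
  have sgp: "0 < sg"
    using sg k z h by (intro less_le_trans[OF _ sg]) (auto intro!: divide_pos_pos mult_pos_pos add_pos_pos)
  interpret pth: msgd_paths X C eta mu tau m v0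
    by unfold_locales (use X_bound C eta mu tau v0 in auto)
  have kap: "pth.kap = kp" and G: "pth.G = GG" and rho: "pth.rho = rho"
    by (simp_all add: pth.kap_def kp_def pth.G_def GG_def pth.rho_def rho_def)
  interpret ms: msgd_saddle M X C eta mu tau m v0 "1 + Tn" S q1 q2 lam1 lam2 s
  proof unfold_locales
    \<comment> \<open>The horizon is \<open>1 + Tn\<close> instead of \<open>Tn\<close> because the
      path bounds require a horizon of at least 1.\<close>
    show "1 \<le> 1 + Tn" using T_exit_bounds(1)[OF eta delta(1)] by (simp add: Tn_def)
    show "8 * pth.kap ^ 3 * pth.G\<^sup>2 * (1 + Tn) * pth.rho \<le> 1"
      using sm1 unfolding kap G rho .
    show "s = 1 \<or> s = -1" by (simp add: s_def)
  qed (use indep linear_add[OF lin] linear_scale[OF lin] cov q eig lam in auto)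
  have st: "ms.st = kp * eta" by (simp add: ms.st_def kap)
  have gr: "ms.gr = gr" by (simp add: ms.gr_def ms.Delta_def gr_def st gap_def)
  have V: "pth.V N \<omega> = msgd eta tau v0 N \<omega>" for \<omega>
    by (simp add: pth.V_def msgd_def)
  have d0: "ms.d0\<^sup>2 \<le> 2 * R\<^sup>2 * eta"
  proof -
    have le1: "\<bar>q2 \<bullet> v0\<bar> \<le> 1"
      using Cauchy_Schwarz_ineq2[of q2 v0] q v0 by simp
    have sq: "s * (q2 \<bullet> v0) = \<bar>q2 \<bullet> v0\<bar>" "s * s = 1"
      by (auto simp: s_def)
    have "(v0 - s *\<^sub>R q2) \<bullet> (v0 - s *\<^sub>R q2) = v0 \<bullet> v0 - 2 * (s * (q2 \<bullet> v0)) + (s * s) * (q2 \<bullet> q2)"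
      by (simp add: inner_diff_left inner_diff_right inner_commute[of v0 q2] algebra_simps)
    also have "\<dots> = 2 - 2 * \<bar>q2 \<bullet> v0\<bar>"
      using q v0 unfolding sq power2_norm_eq_inner[symmetric] by simp
    finally have "ms.d0\<^sup>2 = 2 - 2 * \<bar>q2 \<bullet> v0\<bar>"
      by (simp add: ms.d0_def ms.u_def power2_norm_eq_inner)
    \<comment> \<open>For \<open>t = \<bar>q2 \<bullet> v0\<bar> \<le> 1\<close> the squared
      distance to the near saddle is \<open>2 - 2 * t\<close>, and \<open>t\<^sup>2 \<le> t\<close>
      makes the start condition \<open>1 - delta\<^sup>2 \<le> t\<^sup>2\<close> applicable.\<close>
    also have "(q2 \<bullet> v0)\<^sup>2 \<le> \<bar>q2 \<bullet> v0\<bar>"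
      using le1 mult_left_mono[OF le1, of "\<bar>q2 \<bullet> v0\<bar>"] by (simp add: power2_eq_square)
    then have "2 - 2 * \<bar>q2 \<bullet> v0\<bar> \<le> 2 * delta\<^sup>2"
      using v0(2) by simp
    also have "\<dots> \<le> 2 * (R * sqrt eta)\<^sup>2"
      using delta by (intro mult_left_mono power_mono) auto
    also have "\<dots> = 2 * R\<^sup>2 * eta"
      using eta by (simp add: power_mult_distrib)
    finally show ?thesis .
  qed
  have Nt: "real N * eta \<le> 1 + Tn"
  proof -
    have "real N \<le> Tn / eta"
      using T_exit_bounds(1)[OF eta delta(1)] eta by (simp add: N_def Tn_def of_nat_nat)
    then have "real N * eta \<le> Tn" using eta by (simp add: field_simps)
    then show ?thesis by simp
  qed
  define B where "B = (8 / nu) * (6 * kp ^ 3 * GG\<^sup>2 * (1 + Tn) + 1)"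
  \<comment> \<open>In units of \<open>eta\<close>, \<open>y\<^sup>2\<close> exceeds
    \<open>delta\<^sup>2\<close> by \<open>2 * (excess + 1) * k + (excess + 1)\<^sup>2\<close>,
    which dominates the norm excess \<open>excess * (1 + k)\<close>.\<close>
  define y where "y = delta + (excess + 1) * sqrt eta"
  have Tn0: "0 \<le> Tn" using T_exit_bounds(1)[OF eta delta(1)] by (simp add: Tn_def)
  have B: "0 < B"
    unfolding B_def using nu data_pos Tn0 by (intro mult_pos_pos add_nonneg_pos) auto
  have B_le: "B + 5 * (kp\<^sup>2 * GG) \<le> excess * (1 + k)"
  proof -
    have "1 + Tn \<le> (1 + slope) * (1 + k)"
      using T_exit_bounds(2)[OF eta delta(1)] data_pos k unfolding Tn_def k_def by (simp add: algebra_simps)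
    then have "6 * kp ^ 3 * GG\<^sup>2 * (1 + Tn) + 1 \<le> 6 * kp ^ 3 * GG\<^sup>2 * ((1 + slope) * (1 + k)) + (1 + k)"
      using data_pos k by (intro add_mono mult_left_mono) auto
    then have "B \<le> (8 / nu) * (6 * kp ^ 3 * GG\<^sup>2 * ((1 + slope) * (1 + k)) + (1 + k))"
      unfolding B_def using nu by (intro mult_left_mono) auto
    moreover have "5 * (kp\<^sup>2 * GG) \<le> 5 * (kp\<^sup>2 * GG) * (1 + k)"
      using data_pos k by simp
    moreover have alg: "c * (P * ((1 + slope) * (1 + k)) + (1 + k)) = (c * (P * (1 + slope) + 1)) * (1 + k)" for c P
      by (simp add: algebra_simps)
    moreover have "excess * (1 + k) = (8 / nu) * (6 * kp ^ 3 * GG\<^sup>2 * (1 + slope) + 1) * (1 + k) + 5 * (kp\<^sup>2 * GG) * (1 + k)"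
      unfolding excess_def by (rule distrib_right)
    ultimately show ?thesis
      unfolding alg by linarith
  qed
  have ds: "delta * sqrt eta = k * eta"
    using eta by (simp add: k_def field_simps)
  have y2: "delta\<^sup>2 + (B + 5 * (pth.kap\<^sup>2 * pth.G)) * eta \<le> y\<^sup>2"
  proof -
    have "(B + 5 * (kp\<^sup>2 * GG)) * eta \<le> excess * (1 + k) * eta"
      using B_le eta by (intro mult_right_mono) auto
    also have "\<dots> \<le> (2 * (excess + 1) * k + (excess + 1)\<^sup>2) * eta"
    proof (rule mult_right_mono)
      have "excess * (1 + k) = excess * k + excess" by (simp add: algebra_simps)
      also have "\<dots> \<le> 2 * (excess + 1) * k + (excess + 1)\<^sup>2"
        using data_pos k by (intro add_mono mult_right_mono) (auto simp: power2_eq_square algebra_simps)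
      finally show "excess * (1 + k) \<le> 2 * (excess + 1) * k + (excess + 1)\<^sup>2" .
    qed (use eta in simp)
    also have "\<dots> = 2 * (excess + 1) * (k * eta) + (excess + 1)\<^sup>2 * eta"
      by (simp add: algebra_simps)
    also have "delta\<^sup>2 + \<dots> = y\<^sup>2"
      unfolding y_def ds[symmetric] using eta by (simp add: power2_sum power_mult_distrib)
    finally show ?thesis by (simp add: kap G)
  qed
  have y0: "0 \<le> y" using delta data_pos eta by (simp add: y_def)
  define main where "main \<omega> = gr ^ (N - 1) * (q1 \<bullet> v0) + disc gr (\<lambda>j. kp * eta * ms.xi j \<omega>) N" for \<omega>
  have "prob {\<omega> \<in> space M. 1 - delta\<^sup>2 < (q2 \<bullet> msgd eta tau v0 N \<omega>)\<^sup>2}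
    \<le> (6 * kp ^ 3 * GG\<^sup>2 * (1 + Tn) + e_fac0 Tm R * (rho / sqrt eta)) / B
      + zp_fac0 Tm R * (sqrt eta + rho / sqrt eta) + zq_fac0 Tm R * eta
      + prob {\<omega> \<in> space M. \<bar>main \<omega>\<bar> \<le> y + 2 * sqrt eta + kp\<^sup>2 * GG * eta}"
    using ms.saddle_exit_bound[OF Tm _ d0 N Nt B y0 y2] sm2
    unfolding V kap G rho gr st main_def e_fac0_def zp_fac0_def zq_fac0_def by simp
  also have "(6 * kp ^ 3 * GG\<^sup>2 * (1 + Tn) + e_fac0 Tm R * (rho / sqrt eta)) / B \<le> nu / 8"
  proof -
    have "(6 * kp ^ 3 * GG\<^sup>2 * (1 + Tn) + e_fac0 Tm R * (rho / sqrt eta)) / B \<le> (6 * kp ^ 3 * GG\<^sup>2 * (1 + Tn) + 1) / B"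
      using sm3 B by (intro divide_right_mono) auto
    also have "\<dots> = nu / 8"
    proof -
      have "0 < 6 * kp ^ 3 * GG\<^sup>2 * (1 + Tn) + 1"
        using data_pos Tn0 by (intro add_nonneg_pos) auto
      moreover have "p / ((8 / nu) * p) = nu / 8" if "0 < p" for p
        using that nu by simp
      ultimately show ?thesis unfolding B_def by blast
    qed
    finally show ?thesis .
  qed
  also have "prob {\<omega> \<in> space M. \<bar>main \<omega>\<bar> \<le> y + 2 * sqrt eta + kp\<^sup>2 * GG * eta}
      \<le> prob ?S"
  proof (rule finite_measure_mono)
    have dv: "gr ^ (N - 1) * (q1 \<bullet> v0) / (sqrt eta * sg)
        + (\<Sum>j\<in>{1..<N}. (gr ^ (N - 1 - j) * (kp * sqrt eta) * s / sg) * ((X j \<omega> \<bullet> q1) * (X j \<omega> \<bullet> q2)))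
        = main \<omega> / (sqrt eta * sg)" for \<omega>
    proof -
      have split: "p * (kp * eta * (s * t)) / (x * sg) = (eta / x) * (p * kp * s * t / sg)" for p t x
        by (simp add: mult_ac)
      have "gr ^ (N - 1 - j) * (kp * eta * ms.xi j \<omega>) / (sqrt eta * sg)
          = (gr ^ (N - 1 - j) * (kp * sqrt eta) * s / sg) * ((X j \<omega> \<bullet> q1) * (X j \<omega> \<bullet> q2))" for j
        unfolding ms.xi_def split using eta by (simp add: real_div_sqrt mult_ac)
      then show ?thesis
        unfolding main_def disc_def add_divide_distrib sum_divide_distrib by simp
    qed
    show "{\<omega> \<in> space M. \<bar>main \<omega>\<bar> \<le> y + 2 * sqrt eta + kp\<^sup>2 * GG * eta} \<subseteq> ?S"
      unfolding dv
    proof safe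
      fix \<omega> assume "\<bar>main \<omega>\<bar> \<le> y + 2 * sqrt eta + kp\<^sup>2 * GG * eta"
      also have "kp\<^sup>2 * GG * eta = (kp\<^sup>2 * GG * sqrt eta) * sqrt eta"
        using eta by simp
      also have "\<dots> \<le> 1 * sqrt eta"
        using sm5 eta by (intro mult_right_mono) auto
      finally have "\<bar>main \<omega>\<bar> \<le> (k + (excess + 4)) * sqrt eta"
        using eta by (simp add: y_def k_def algebra_simps)
      also have "\<dots> \<le> ((1 + h) * k) * sqrt eta"
        using h eta by (intro mult_right_mono) (auto simp: algebra_simps)
      \<comment> \<open>One factor \<open>1 + h\<close> pays for the additive errors, the other for
        \<open>sg\<close> falling short of \<open>k / z\<close>.\<close>
      also have "\<dots> = (z * (1 + h)\<^sup>2) * (sqrt eta * (k / (z * (1 + h))))"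
      proof -
        have "((1 + h) * k) * x = ((1 + h) * t) * (x * (k / t))" if "t \<noteq> 0" for t x
          using that by simp
        from this[of "z * (1 + h)" "sqrt eta"] show ?thesis
          using z h by (simp add: power2_eq_square mult_ac)
      qed
      also have "\<dots> \<le> (z * (1 + h)\<^sup>2) * (sqrt eta * sg)"
        using sg eta z by (intro mult_left_mono) auto
      finally show "\<bar>main \<omega> / (sqrt eta * sg)\<bar> \<le> z * (1 + h)\<^sup>2"
        using sgp eta by (simp add: abs_mult pos_divide_le_eq)
    qed
    show "?S \<in> events"
      by measurable
  qed
  finally show ?thesis
    using sm4 by linarith
qed

end

section \<open>The limit along sequences of step sizes\<close>

context oja_data
begin

lemma X_meas [measurable]: "X k \<in> borel_measurable M"
  using indep by (auto simp: indep_vars_def)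

lemma gr_power_le:
  assumes "0 < eta" "0 < delta"
  shows "(1 + kp * eta * gap) ^ nat \<lfloor>T_exit eta delta / eta\<rfloor> \<le> exp (kp * gap * T_exit eta delta)"
proof -
  let ?N = "nat \<lfloor>T_exit eta delta / eta\<rfloor>"
  have "(1 + kp * eta * gap) ^ ?N \<le> exp (kp * eta * gap) ^ ?N"
    using data_pos assms exp_ge_add_one_self[of "kp * eta * gap"] by (intro power_mono) auto
  also have "\<dots> = exp (kp * gap * (real ?N * eta))"
    by (simp add: exp_of_nat_mult[symmetric] mult_ac)
  also have "\<dots> \<le> exp (kp * gap * T_exit eta delta)"
  proof -
    have "real ?N \<le> T_exit eta delta / eta"
      using T_exit_bounds(1)[OF assms] assms by (simp add: of_nat_nat)
    then have "real ?N * eta \<le> T_exit eta delta"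
      using assms by (simp add: field_simps)
    then show ?thesis
      using data_pos by (simp add: mult_left_mono)
  qed
  finally show ?thesis .
qed

text \<open>The continuity theorem for characteristic functions speaks of sequences, so the limit is
  taken along a sequence of step sizes. Each requirement of the bound at fixed \<open>eta\<close>
  becomes an eventual inequality in \<open>n\<close>.\<close>

lemma exit_sequence:
  fixes eta delta :: "nat \<Rightarrow> real" and tau :: "nat \<Rightarrow> nat \<Rightarrow> nat" and m :: "nat \<Rightarrow> nat"
    and v0 :: "nat \<Rightarrow> real^'n" and h R :: real
  defines "N n \<equiv> nat \<lfloor>T_exit (eta n) (delta n) / eta n\<rfloor>"
  assumes h: "0 < h" "Phi (z * (1 + h)\<^sup>2) \<le> Phi z + nu / 16"
    and eta: "\<And>n. 0 < eta n" "eta \<longlonglongrightarrow> 0"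
    and delta: "\<And>n. 0 < delta n" "\<forall>\<^sub>F n in sequentially. (excess + 4) / h * sqrt (eta n) \<le> delta n"
      "\<forall>\<^sub>F n in sequentially. delta n \<le> R * sqrt (eta n)"
    and tau: "\<And>n k. 1 \<le> k \<Longrightarrow> tau n k \<le> m n" "(\<lambda>n. real (m n) * sqrt (eta n)) \<longlonglongrightarrow> 0"
    and v0: "\<And>n. norm (v0 n) = 1" "\<And>n. 1 - (delta n)\<^sup>2 \<le> (q2 \<bullet> v0 n)\<^sup>2"
  shows "\<forall>\<^sub>F n in sequentially.
    1 - nu \<le> prob {\<omega> \<in> space M. (q2 \<bullet> msgd (eta n) (tau n) (v0 n) (N n) \<omega>)\<^sup>2 \<le> 1 - (delta n)\<^sup>2}"
proof -
  define k where "k n = delta n / sqrt (eta n)" for n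
  define c0 where "c0 = (excess + 4) / h"
  define Tn where "Tn n = T_exit (eta n) (delta n)" for n
  define Tm where "Tm = 1 + slope * R"
  define rho where "rho n = eta n * (real (m n) + 1)" for n
  define gr where "gr n = 1 + kp * eta n * gap" for n
  define s where "s n = (if 0 \<le> q2 \<bullet> v0 n then 1 else -1 :: real)" for n
  define sg where "sg n = sqrt (noise_var (eta n) (N n))" for n
  define x0 where "x0 = growth * c0\<^sup>2"
  define L where "L = 1 / (1 + h)\<^sup>2"
  define r where "r n = 2 * (kp * eta n * gap) * (2 + Tm * (kp * gap))" for n
  define b where "b = z * (1 + h)\<^sup>2"
  define \<xi> where "\<xi> j \<omega> = (X j \<omega> \<bullet> q1) * (X j \<omega> \<bullet> q2)" for j \<omega>
  define c where "c n j = gr n ^ (N n - 1 - j) * (kp * sqrt (eta n)) * s n / sg n" for n j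
  define W where "W n \<omega> = (\<Sum>j\<in>{1..<N n}. c n j * \<xi> j \<omega>)" for n \<omega>
  define mm where "mm n = gr n ^ (N n - 1) * (q1 \<bullet> v0 n) / (sqrt (eta n) * sg n)" for n
  define E0 where "E0 = exp (kp * gap * Tm)"
  have c0: "0 < c0" using data_pos h by (simp add: c0_def)
  have x0: "0 < x0" using c0 data_pos by (simp add: x0_def)
  have k0: "0 < k n" for n using eta(1) delta(1) by (simp add: k_def)
  have gr1: "1 \<le> gr n" for n
    using data_pos eta(1)[of n] by (auto simp: gr_def intro!: mult_nonneg_nonneg)
  have sq0: "(\<lambda>n. sqrt (eta n)) \<longlonglongrightarrow> 0"
    using tendsto_real_sqrt[OF eta(2)] by simp
  have rho0: "(\<lambda>n. rho n / sqrt (eta n)) \<longlonglongrightarrow> 0"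
  proof -
    have "(\<lambda>n. real (m n) * sqrt (eta n) + sqrt (eta n)) \<longlonglongrightarrow> 0 + 0"
      by (intro tendsto_add tau(2) sq0)
    moreover have "rho n / sqrt (eta n) = real (m n) * sqrt (eta n) + sqrt (eta n)" for n
    proof -
      have "rho n / sqrt (eta n) = (eta n / sqrt (eta n)) * (real (m n) + 1)"
        by (simp only: rho_def times_divide_eq_left)
      also have "eta n / sqrt (eta n) = sqrt (eta n)"
        using eta(1)[of n] by (intro real_div_sqrt) simp
      finally show ?thesis by (simp add: algebra_simps)
    qed
    ultimately show ?thesis by simp
  qed
  have rho0': "rho \<longlonglongrightarrow> 0"
  proof -
    have "(\<lambda>n. (rho n / sqrt (eta n)) * sqrt (eta n)) \<longlonglongrightarrow> 0 * 0"
      by (intro tendsto_mult rho0 sq0)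
    moreover have "(rho n / sqrt (eta n)) * sqrt (eta n) = rho n" for n
      using eta(1)[of n] by simp
    ultimately show ?thesis by simp
  qed
  have r0: "r \<longlonglongrightarrow> 0"
  proof -
    have "r \<longlonglongrightarrow> 2 * (kp * 0 * gap) * (2 + Tm * (kp * gap))"
      unfolding r_def by (intro tendsto_intros eta(2))
    then show ?thesis by simp
  qed
  have ev_k: "\<forall>\<^sub>F n in sequentially. c0 \<le> k n \<and> k n \<le> R"
    using delta(2,3)
  proof eventually_elim
    case (elim n)
    then show ?case
      using eta(1)[of n] by (simp add: k_def c0_def pos_le_divide_eq pos_divide_le_eq)
  qed
  have ev_T: "\<forall>\<^sub>F n in sequentially. 0 \<le> Tn n \<and> 1 + Tn n \<le> Tm \<and> ln (1 + x0) / (2 * (kp * gap)) \<le> Tn n \<and> x0 \<le> growth * (k n)\<^sup>2"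
    using ev_k
  proof eventually_elim
    case (elim n)
    have "Tn n \<le> slope * k n"
      using T_exit_bounds(2)[OF eta(1) delta(1)] by (simp add: Tn_def k_def)
    also have "\<dots> \<le> slope * R"
      using elim data_pos by (intro mult_left_mono) auto
    finally have T: "1 + Tn n \<le> Tm" by (simp add: Tm_def)
    have x: "x0 \<le> growth * (k n)\<^sup>2"
      unfolding x0_def using elim c0 data_pos by (intro mult_left_mono power_mono) auto
    then have "ln (1 + x0) \<le> ln (1 + growth * (k n)\<^sup>2)"
      using x0 by (intro ln_mono) auto
    then have "ln (1 + x0) / (2 * (kp * gap)) \<le> Tn n"
      unfolding Tn_def T_exit_eq[OF eta(1)] k_def using data_pos by (intro divide_right_mono) auto
    then show ?case
      using T x T_exit_bounds(1)[OF eta(1) delta(1)] by (simp add: Tn_def)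
  qed
  have ev_N: "\<forall>\<^sub>F n in sequentially. 1 \<le> N n"
  proof -
    have "0 < ln (1 + x0) / (2 * (kp * gap))"
      using x0 data_pos by (intro divide_pos_pos ln_gt_zero) auto
    then have "\<forall>\<^sub>F n in sequentially. eta n < ln (1 + x0) / (2 * (kp * gap))"
      by (rule order_tendstoD(2)[OF eta(2)])
    then show ?thesis
      using ev_T
    proof eventually_elim
      case (elim n)
      then have "1 \<le> Tn n / eta n"
        using eta(1)[of n] by (simp add: pos_le_divide_eq)
      then have "1 \<le> \<lfloor>Tn n / eta n\<rfloor>"
        by simp
      then show ?case
        unfolding N_def Tn_def by linarith
    qed
  qed
  have ev_sg: "\<forall>\<^sub>F n in sequentially. k n / (z * (1 + h)) \<le> sg n"
  proof -
    \<comment> \<open>The limit is \<open>2 - 2 * L\<close>, which is positive because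
      \<open>L = 1 / (1 + h)\<^sup>2\<close> is below 1.\<close>
    have "(\<lambda>n. 2 * (exp (- r n) - (1 - exp (- r n)) / x0) - L * (2 + kp * eta n * gap))
        \<longlonglongrightarrow> 2 * (exp (- 0) - (1 - exp (- 0)) / x0) - L * (2 + kp * 0 * gap)"
      using x0 by (intro tendsto_intros r0 eta(2)) auto
    moreover have "L < 1"
      unfolding L_def using h by (simp add: one_less_power)
    ultimately have evL: "\<forall>\<^sub>F n in sequentially. 0 < 2 * (exp (- r n) - (1 - exp (- r n)) / x0) - L * (2 + kp * eta n * gap)"
      by (intro order_tendstoD(1)) auto
    have "(\<lambda>n. kp * eta n * gap) \<longlonglongrightarrow> kp * 0 * gap"
      by (intro tendsto_intros eta(2))
    then have evg: "\<forall>\<^sub>F n in sequentially. kp * eta n * gap < 1"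
      by (intro order_tendstoD(2)) auto
    show ?thesis
      using evL evg ev_T ev_N ev_k
    proof eventually_elim
      case (elim n)
      have "L * (k n / z)\<^sup>2 \<le> noise_var (eta n) (N n)"
        unfolding k_def
        using elim x0 h
        by (intro noise_var_ge[of _ _ Tm _ x0 "r n"] eta(1) delta(1))
          (auto simp: N_def Tn_def k_def r_def L_def)
      moreover have "L * (k n / z)\<^sup>2 = (k n / (z * (1 + h)))\<^sup>2"
        by (simp add: L_def power_divide power_mult_distrib)
      ultimately have "(k n / (z * (1 + h)))\<^sup>2 \<le> noise_var (eta n) (N n)"
        by simp
      then show ?case
        unfolding sg_def by (rule real_le_rsqrt)
    qed
  qed
  have kz: "0 < k n / (z * (1 + h))" for n
    using k0 z h by simp
  have ev_gr: "\<forall>\<^sub>F n in sequentially. gr n ^ N n \<le> E0"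
    using ev_T
  proof eventually_elim
    case (elim n)
    have "gr n ^ N n \<le> exp (kp * gap * Tn n)"
      using gr_power_le[OF eta(1) delta(1)] by (simp add: gr_def N_def Tn_def)
    also have "\<dots> \<le> E0"
      unfolding E0_def using elim data_pos by (auto intro!: mult_left_mono)
    finally show ?case .
  qed
  have W_meas [measurable]: "W n \<in> borel_measurable M" for n
    unfolding W_def \<xi>_def by measurable
  have clt: "weak_conv_m (\<lambda>n. distr M borel (W n)) std_normal_distribution"
    unfolding W_def[abs_def]
  proof (rule weighted_clt)
    show "indep_vars (\<lambda>_. borel) \<xi> UNIV"
      unfolding \<xi>_def[abs_def] by (rule indep_vars_compose2[OF indep]) measurable
    have ab: "\<bar>X j \<omega> \<bullet> q1\<bar> \<le> C" "\<bar>X j \<omega> \<bullet> q2\<bar> \<le> C" for j \<omega>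
      using Cauchy_Schwarz_ineq2[of "X j \<omega>" q1] Cauchy_Schwarz_ineq2[of "X j \<omega>" q2] X_bound[of j \<omega>] q by auto
    show "\<bar>\<xi> j \<omega>\<bar> \<le> C * C" for j \<omega>
      unfolding \<xi>_def abs_mult using ab C by (intro mult_mono) auto
    show "expectation (\<xi> j) = 0" for j
      unfolding \<xi>_def[abs_def] using cov[of j q1 q2] eig q by simp
    show "expectation (\<lambda>\<omega>. (\<xi> j \<omega>)\<^sup>2) = al\<^sup>2" for j
      unfolding \<xi>_def by (rule fourth)
    have sgn: "0 \<le> sg n" for n
      unfolding sg_def noise_var_def disc_def using eta(1)[of n]
      by (intro real_sqrt_ge_zero mult_nonneg_nonneg sum_nonneg) auto
    show "\<bar>c n j\<bar> \<le> gr n ^ N n * (kp * sqrt (eta n)) / sg n" if "j \<in> {1..<N n}" for n j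
    proof -
      have "\<bar>c n j\<bar> = gr n ^ (N n - 1 - j) * (kp * sqrt (eta n)) / sg n"
        using gr1[of n] data_pos eta(1)[of n] sgn[of n] by (simp add: c_def abs_mult s_def)
      also have "\<dots> \<le> gr n ^ N n * (kp * sqrt (eta n)) / sg n"
        using gr1[of n] data_pos eta(1)[of n] sgn[of n]
        by (intro divide_right_mono mult_right_mono power_increasing) auto
      finally show ?thesis .
    qed
    have "(\<lambda>n. (E0 * kp * (z * (1 + h) / c0)) * sqrt (eta n)) \<longlonglongrightarrow> (E0 * kp * (z * (1 + h) / c0)) * 0"
      by (intro tendsto_mult tendsto_const sq0)
    then have lim: "(\<lambda>n. (E0 * kp * (z * (1 + h) / c0)) * sqrt (eta n)) \<longlonglongrightarrow> 0"
      by simp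
    show "(\<lambda>n. gr n ^ N n * (kp * sqrt (eta n)) / sg n) \<longlonglongrightarrow> 0"
    proof (rule Lim_null_comparison[OF _ lim])
      show "\<forall>\<^sub>F n in sequentially. norm (gr n ^ N n * (kp * sqrt (eta n)) / sg n) \<le> (E0 * kp * (z * (1 + h) / c0)) * sqrt (eta n)"
        using ev_gr ev_sg ev_k
      proof eventually_elim
        case (elim n)
        have "c0 / (z * (1 + h)) \<le> sg n"
          using elim z h by (intro order_trans[OF divide_right_mono[of c0 "k n" "z * (1 + h)"]]) auto
        then have "gr n ^ N n * (kp * sqrt (eta n)) / sg n \<le> E0 * (kp * sqrt (eta n)) / (c0 / (z * (1 + h)))"
          using elim(1) gr1[of n] data_pos eta(1)[of n] z h c0
          by (intro frac_le mult_right_mono mult_nonneg_nonneg) (auto simp: E0_def)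
        also have "\<dots> = (E0 * kp * (z * (1 + h) / c0)) * sqrt (eta n)"
          by simp
        finally show ?case
          using gr1[of n] data_pos eta(1)[of n] sgn[of n] by (simp add: abs_mult)
      qed
    qed
    have "\<forall>\<^sub>F n in sequentially. al\<^sup>2 * (\<Sum>j\<in>{1..<N n}. (c n j)\<^sup>2) = 1"
      using ev_sg
    proof eventually_elim
      case (elim n)
      then have sp: "0 < sg n"
        using kz[of n] by linarith
      have s2: "(s n)\<^sup>2 = 1" by (simp add: s_def)
      have "(c n j)\<^sup>2 = ((gr n)\<^sup>2) ^ (N n - 1 - j) * 1 * (kp\<^sup>2 * eta n / (sg n)\<^sup>2)" for j
        using eta(1)[of n] by (simp add: c_def power_mult_distrib power_divide s2 power_mult[symmetric] mult.commute)
      then have "al\<^sup>2 * (\<Sum>j\<in>{1..<N n}. (c n j)\<^sup>2) = al\<^sup>2 * (disc ((gr n)\<^sup>2) (\<lambda>_. 1) (N n) * (kp\<^sup>2 * eta n / (sg n)\<^sup>2))"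
        by (simp only: disc_def sum_distrib_right)
      also have "\<dots> = noise_var (eta n) (N n) / (sg n)\<^sup>2"
        by (simp add: noise_var_def gr_def power_mult_distrib mult_ac)
      \<comment> \<open>\<open>(sg n)\<^sup>2\<close> is the noise variance itself, so the
        normalisation is exact and not only asymptotic.\<close>
      also have "\<dots> = 1"
        using sp by (simp add: sg_def)
      finally show ?case .
    qed
    then show "(\<lambda>n. al\<^sup>2 * (\<Sum>j\<in>{1..<N n}. (c n j)\<^sup>2)) \<longlonglongrightarrow> 1"
      by (rule tendsto_eventually)
  qed
  \<comment> \<open>The radius bounds the normalised mean \<open>mm n\<close>: initially
    \<open>\<bar>q1 \<bullet> v0 n\<bar> \<le> delta n\<close>, the growth is at most
    \<open>E0\<close>, and \<open>k n / sg n \<le> z * (1 + h)\<close>.\<close>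
  have ball: "\<forall>\<^sub>F n in sequentially. \<forall>y. \<bar>y\<bar> \<le> E0 * (z * (1 + h)) \<longrightarrow>
      prob {\<omega> \<in> space M. \<bar>y + W n \<omega>\<bar> \<le> b} \<le> 2 * Phi b - 1 + nu / 8"
    using z h nu by (intro shifted_small_ball clt) (auto simp: b_def)
  have ev_sm1: "\<forall>\<^sub>F n in sequentially. 8 * kp ^ 3 * GG\<^sup>2 * Tm * rho n < 1"
  proof -
    have "(\<lambda>n. 8 * kp ^ 3 * GG\<^sup>2 * Tm * rho n) \<longlonglongrightarrow> 8 * kp ^ 3 * GG\<^sup>2 * Tm * 0"
      by (intro tendsto_mult tendsto_const rho0')
    then show ?thesis by (intro order_tendstoD(2)) auto
  qed
  have ev_sm2: "\<forall>\<^sub>F n in sequentially. rho n / sqrt (eta n) < 1"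
    by (rule order_tendstoD(2)[OF rho0]) simp
  have ev_sm3: "\<forall>\<^sub>F n in sequentially. e_fac0 Tm R * (rho n / sqrt (eta n)) < 1"
  proof -
    have "(\<lambda>n. e_fac0 Tm R * (rho n / sqrt (eta n))) \<longlonglongrightarrow> e_fac0 Tm R * 0"
      by (intro tendsto_mult tendsto_const rho0)
    then show ?thesis by (intro order_tendstoD(2)) auto
  qed
  have ev_sm4: "\<forall>\<^sub>F n in sequentially. zp_fac0 Tm R * (sqrt (eta n) + rho n / sqrt (eta n)) + zq_fac0 Tm R * eta n < nu / 8"
  proof -
    have "(\<lambda>n. zp_fac0 Tm R * (sqrt (eta n) + rho n / sqrt (eta n)) + zq_fac0 Tm R * eta n) \<longlonglongrightarrow> zp_fac0 Tm R * (0 + 0) + zq_fac0 Tm R * 0"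
      by (intro tendsto_add tendsto_mult tendsto_const rho0 sq0 eta(2))
    then show ?thesis using nu by (intro order_tendstoD(2)) auto
  qed
  have ev_sm5: "\<forall>\<^sub>F n in sequentially. kp\<^sup>2 * GG * sqrt (eta n) < 1"
  proof -
    have "(\<lambda>n. kp\<^sup>2 * GG * sqrt (eta n)) \<longlonglongrightarrow> kp\<^sup>2 * GG * 0"
      by (intro tendsto_mult tendsto_const sq0)
    then show ?thesis by (intro order_tendstoD(2)) auto
  qed
  show ?thesis
    using delta(3) ev_k ev_T ev_N ev_sg ev_gr ball ev_sm1 ev_sm2 ev_sm3 ev_sm4 ev_sm5
  proof eventually_elim
    case (elim n)
    have rp: "0 \<le> rho n" using eta(1)[of n] by (simp add: rho_def)
    have sp: "0 < sg n"
      using kz[of n] elim(5) by linarith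
    let ?bad = "{\<omega> \<in> space M. 1 - (delta n)\<^sup>2 < (q2 \<bullet> msgd (eta n) (tau n) (v0 n) (N n) \<omega>)\<^sup>2}"
    have "prob ?bad \<le> nu / 4 + prob {\<omega> \<in> space M. \<bar>mm n + W n \<omega>\<bar> \<le> b}"
      unfolding mm_def W_def c_def \<xi>_def b_def s_def gr_def sg_def N_def
    proof (rule exit_bound_pointwise[where m = "m n" and R = R and Tm = Tm])
      show "8 * kp ^ 3 * GG\<^sup>2 * (1 + T_exit (eta n) (delta n)) * (eta n * (real (m n) + 1)) \<le> 1"
      proof -
        have "8 * kp ^ 3 * GG\<^sup>2 * (1 + Tn n) * rho n \<le> 8 * kp ^ 3 * GG\<^sup>2 * Tm * rho n"
          using elim(3) data_pos rp by (intro mult_right_mono mult_left_mono) auto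
        then show ?thesis using elim(8) by (simp add: Tn_def rho_def)
      qed
      show "(eta n * (real (m n) + 1))\<^sup>2 \<le> eta n"
      proof -
        have "rho n \<le> sqrt (eta n)"
          using elim(9) eta(1)[of n] by (simp add: pos_divide_less_eq)
        then have "(rho n)\<^sup>2 \<le> (sqrt (eta n))\<^sup>2"
          using rp by (intro power_mono)
        then show ?thesis using eta(1)[of n] by (simp add: rho_def)
      qed
      show "excess + 4 \<le> h * (delta n / sqrt (eta n))"
        using elim(2) h by (simp add: c0_def k_def pos_divide_le_eq mult.commute)
      show "delta n / sqrt (eta n) / (z * (1 + h)) \<le> sqrt (noise_var (eta n) (nat \<lfloor>T_exit (eta n) (delta n) / eta n\<rfloor>))"
        using elim(5) by (simp add: k_def sg_def N_def)
      show "1 \<le> nat \<lfloor>T_exit (eta n) (delta n) / eta n\<rfloor>"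
        using elim(4) by (simp add: N_def)
      show "1 + T_exit (eta n) (delta n) \<le> Tm"
        using elim(3) by (simp add: Tn_def)
      show "e_fac0 Tm R * (eta n * (real (m n) + 1) / sqrt (eta n)) \<le> 1"
        using elim(10) by (simp add: rho_def)
      show "zp_fac0 Tm R * (sqrt (eta n) + eta n * (real (m n) + 1) / sqrt (eta n)) + zq_fac0 Tm R * eta n \<le> nu / 8"
        using elim(11) by (simp add: rho_def)
      show "kp\<^sup>2 * GG * sqrt (eta n) \<le> 1"
        using elim(12) by simp
    qed (use eta(1) delta(1) elim(1) tau(1) v0 h(1) in auto)
    also have "prob {\<omega> \<in> space M. \<bar>mm n + W n \<omega>\<bar> \<le> b} \<le> 2 * Phi b - 1 + nu / 8"
    proof -
      have "(q1 \<bullet> v0 n)\<^sup>2 \<le> (delta n)\<^sup>2"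
        using bessel_two[OF q, of "v0 n"] v0[of n] by simp
      then have "\<bar>q1 \<bullet> v0 n\<bar> \<le> delta n"
        using delta(1)[of n] abs_le_square_iff[of "q1 \<bullet> v0 n" "delta n"] by simp
      moreover have "gr n ^ (N n - 1) \<le> E0"
        using gr1[of n] by (intro order_trans[OF power_increasing elim(6)]) auto
      ultimately have "\<bar>mm n\<bar> \<le> E0 * delta n / (sqrt (eta n) * sg n)"
        unfolding mm_def abs_divide abs_mult
        using gr1[of n] eta(1)[of n] sp by (auto intro!: divide_right_mono mult_mono simp: E0_def)
      also have "\<dots> = E0 * (k n / sg n)"
        by (simp add: k_def)
      also have "\<dots> \<le> E0 * (z * (1 + h))"
      proof (intro mult_left_mono)
        have "0 < z * (1 + h)" using z h by simp
        then have "k n \<le> sg n * (z * (1 + h))"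
          using elim(5) by (simp only: pos_divide_le_eq)
        then show "k n / sg n \<le> z * (1 + h)"
          using sp by (simp only: pos_divide_le_eq mult.commute)
      qed (simp add: E0_def)
      finally show ?thesis
        using elim(7) by blast
    qed
    \<comment> \<open>The \<open>nu / 16\<close> allowed in the choice of \<open>h\<close> is
      doubled here, and the total is
      \<open>nu / 4 + nu / 8 + (nu / 2 + nu / 8) = nu\<close>.\<close>
    also have "2 * Phi b - 1 \<le> nu / 2 + nu / 8"
      using h(2) z(2) by (simp add: b_def)
    finally have bad: "prob ?bad \<le> nu"
      by simp
    have [measurable]: "(\<lambda>\<omega>. msgd (eta n) (tau n) (v0 n) (N n) \<omega>) \<in> borel_measurable M"
      unfolding msgd_def by (intro borel_measurable_async_msgd X_meas)
    have "{\<omega> \<in> space M. (q2 \<bullet> msgd (eta n) (tau n) (v0 n) (N n) \<omega>)\<^sup>2 \<le> 1 - (delta n)\<^sup>2} = space M - ?bad"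
      by auto
    moreover have "prob (space M - ?bad) = 1 - prob ?bad"
      by (rule prob_compl) measurable
    ultimately show ?case
      using bad by simp
  qed
qed

lemma threshold_exists:
  obtains h where "0 < h" "Phi (z * (1 + h)\<^sup>2) \<le> Phi z + nu / 16"
proof -
  have "((\<lambda>h. Phi (z * (1 + h)\<^sup>2)) \<longlongrightarrow> Phi (z * (1 + 0)\<^sup>2)) (at_right 0)"
    by (intro isCont_tendsto_compose[OF Phi_isCont] tendsto_intros)
  then have "\<forall>\<^sub>F h in at_right 0. Phi (z * (1 + h)\<^sup>2) < Phi z + nu / 16"
    using nu by (intro order_tendstoD(2)) auto
  then have "\<forall>\<^sub>F h in at_right 0. Phi (z * (1 + h)\<^sup>2) < Phi z + nu / 16 \<and> 0 < h"
    by (intro eventually_conj eventually_at_right_less)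
  then obtain h where "Phi (z * (1 + h)\<^sup>2) < Phi z + nu / 16" "0 < h"
    using eventually_happens'[OF trivial_limit_at_right_real] by blast
  then show ?thesis
    by (intro that[of h]) auto
qed

end

section \<open>The main theorem\<close>

text \<open>The inner product of matrices is the Frobenius one. Pairing with
  \<open>outer u w\<close> reads off a bilinear form and so turns the matrix-valued second moment
  into a scalar identity.\<close>

lemma inner_outer: "outer x y \<bullet> outer u w = (x \<bullet> u) * (y \<bullet> w)"
  by (simp add: inner_vec_def outer_def sum_product mult_ac)

lemma inner_matrix_outer: "A \<bullet> outer u w = u \<bullet> (A *v w)"
  by (simp add: inner_vec_def outer_def matrix_vector_mult_def sum_distrib_left mult_ac)

lemma continuous_on_outer: "continuous_on A (\<lambda>x. outer x x)"
  unfolding outer_def by (intro continuous_intros)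

lemma transpose_mult_vec_nth: "(transpose Q *v x) $ i = column i Q \<bullet> x"
  by (simp add: matrix_vector_mult_def transpose_def column_def inner_vec_def)

lemma column_inner_column:
  assumes "transpose Q ** Q = (mat 1 :: real^'n^'n)"
  shows "column i Q \<bullet> column j Q = (if i = j then 1 else 0)"
proof -
  have "column i Q \<bullet> column j Q = (transpose Q ** Q) $ i $ j"
    by (simp add: matrix_matrix_mult_def transpose_def column_def inner_vec_def)
  then show ?thesis
    by (simp add: assms mat_def)
qed

lemma eigencolumn:
  fixes Q :: "real^'n^'n"
  assumes "transpose Q ** Q = mat 1"
  shows "(Q ** diag_mat l ** transpose Q) *v column i Q = l i *\<^sub>R column i Q"
proof -
  have c: "column i Q = Q *v axis i 1"
    by (simp add: matrix_vector_mult_basis)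
  have d: "diag_mat l *v axis i 1 = l i *\<^sub>R axis i 1"
    unfolding matrix_vector_mult_basis by (simp add: vec_eq_iff column_def diag_mat_def axis_def)
  have "(Q ** diag_mat l ** transpose Q) *v column i Q = (Q ** diag_mat l ** (transpose Q ** Q)) *v axis i 1"
    unfolding c by (simp add: matrix_vector_mul_assoc matrix_mul_assoc)
  also have "\<dots> = Q *v (diag_mat l *v axis i 1)"
    by (simp add: assms matrix_vector_mul_assoc)
  also have "\<dots> = l i *\<^sub>R column i Q"
    unfolding d c by (simp add: matrix_vector_mult_scaleR)
  finally show ?thesis .
qed

text \<open>The pairing may be moved into the integral because \<open>outer x x\<close> is
  integrable: it is continuous in \<open>x\<close>, and almost every \<open>x\<close> lies in a
  compact ball.\<close>

lemma second_moment_form: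
  fixes D :: "(real^'n) measure" and A :: "real^'n^'n"
  assumes "prob_space D" and sets: "sets D = sets borel" and bounded: "AE x in D. norm x \<le> C"
    and cov: "(LINT x|D. outer x x) = A"
  shows "(LINT x|D. (x \<bullet> u) * (x \<bullet> w)) = u \<bullet> (A *v w)"
proof -
  interpret D: prob_space D by fact
  have meas: "(\<lambda>x. outer x x) \<in> borel_measurable D"
    unfolding measurable_cong_sets[OF sets refl]
    by (intro borel_measurable_continuous_onI continuous_on_outer)
  have "compact ((\<lambda>x. outer x x) ` cball (0 :: real^'n) C)"
    by (intro compact_continuous_image continuous_on_outer compact_cball)
  then have "bounded ((\<lambda>x. outer x x) ` cball (0 :: real^'n) C)"
    by (rule compact_imp_bounded)
  then obtain B where "\<forall>y\<in>(\<lambda>x. outer x x) ` cball (0 :: real^'n) C. norm y \<le> B"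
    unfolding bounded_iff by blast
  then have B: "norm (outer x x) \<le> B" if "norm x \<le> C" for x :: "real^'n"
    using that by auto
  have "integrable D (\<lambda>x. outer x x)"
    using bounded B by (intro D.integrable_const_bound[of _ B] meas) (auto elim: eventually_mono)
  then have "(LINT x|D. outer x x \<bullet> outer u w) = (LINT x|D. outer x x) \<bullet> outer u w"
    by (rule integral_inner_left)
  then show ?thesis
    unfolding inner_outer unfolding cov inner_matrix_outer .
qed

lemma bigo_null_at_right:
  fixes f g :: "real \<Rightarrow> real"
  assumes "f \<in> O[F](g)" "(g \<longlongrightarrow> 0) F"
  shows "(f \<longlongrightarrow> 0) F"
proof -
  obtain c where "\<forall>\<^sub>F x in F. norm (f x) \<le> c * norm (g x)"
    using assms(1) by (rule landau_o.bigE)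
  moreover have "((\<lambda>x. c * norm (g x)) \<longlongrightarrow> 0) F"
    using tendsto_mult[OF tendsto_const tendsto_norm[OF assms(2)], of c] by simp
  ultimately show ?thesis
    by (rule Lim_null_comparison)
qed

lemma rot_interp_nth: "rot_interp Q eta v t $ i = column i Q \<bullet> v (nat \<lfloor>t / eta\<rfloor>)"
  unfolding rot_interp_def by (rule transpose_mult_vec_nth)

theorem proposition3p11:
  fixes M :: "'a measure"
    and X :: "nat \<Rightarrow> 'a \<Rightarrow> real^'n"
    and D :: "(real^'n) measure"
    and Sigma Q :: "real^'n^'n"
    and p :: "nat \<Rightarrow> 'n"
    and lam :: "'n \<Rightarrow> real"
    and C_d mu nu :: real
  assumes dim: "CARD('n) \<ge> 2"
    and numbering: "bij_betw p {1..CARD('n)} UNIV"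
    and prob: "prob_space M"
    and indep: "prob_space.indep_vars M (\<lambda>_. borel) X UNIV"
    and law: "\<And>k. distr M borel (X k) = D"
    and mean: "(LINT x|D. x) = 0"
    and cov: "(LINT x|D. outer x x) = Sigma"
    and bounded: "AE x in D. norm x \<le> C_d"
    and gap: "lam (p 1) > lam (p 2)"
    and sorted: "\<And>i. i \<in> {2..<CARD('n)} \<Longrightarrow> lam (p i) \<ge> lam (p (Suc i))"
    and pos: "\<And>i. lam i > 0"
    and orth: "transpose Q ** Q = mat 1"
    and eigendecomp: "Sigma = Q ** diag_mat lam ** transpose Q"
    and alpha12: "alpha D Q (p 1) (p 2) > 0"
    and mu: "0 \<le> mu" "mu < 1"
    and nu: "0 < nu" "nu < 1"
  shows "\<exists>c0>0. \<forall>(eta :: real \<Rightarrow> real) (delta :: real \<Rightarrow> real)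
            (tau :: real \<Rightarrow> nat \<Rightarrow> nat) (v0 :: real \<Rightarrow> real^'n) gamma.
     (\<forall>eps>0. 0 < eta eps \<and> 0 < delta eps \<and> norm (v0 eps) = 1 \<and> finite (tau eps ` {1..})) \<longrightarrow>
     eta \<in> \<Theta>[at_right 0](\<lambda>eps. eps * (lam (p 1) - lam (p 2)) / (\<Sum>j\<in>UNIV. (alpha D Q (p 1) j)\<^sup>2)) \<longrightarrow>
     delta \<in> \<Theta>[at_right 0](\<lambda>eps. sqrt (eta eps)) \<longrightarrow>
     (\<forall>\<^sub>F eps in at_right 0. delta eps \<ge> c0 * sqrt (eta eps)) \<longrightarrow>
     0 < gamma \<longrightarrow> gamma \<le> 1 / 2 \<longrightarrow>
     (\<lambda>eps. real (Max (tau eps ` {1..})))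
        \<in> \<Theta>[at_right 0](\<lambda>eps. (1 - mu)\<^sup>2 / ((lam (p 1) + C_d) * eta eps powr (1 / 2 - gamma))) \<longrightarrow>
     (\<forall>eps>0. \<forall>\<omega>\<in>space M.
        (rot_interp Q (eta eps) (async_msgd (eta eps) mu (tau eps) (\<lambda>k. X k \<omega>) (v0 eps)) 0 $ p 2)\<^sup>2
          \<ge> 1 - (delta eps)\<^sup>2) \<longrightarrow>
     (\<forall>\<^sub>F eps in at_right 0.
        measure M {\<omega> \<in> space M.
          (rot_interp Q (eta eps) (async_msgd (eta eps) mu (tau eps) (\<lambda>k. X k \<omega>) (v0 eps))
             (T1 mu nu (lam (p 1)) (lam (p 2)) (alpha D Q (p 1) (p 2)) (eta eps) (delta eps)) $ p 2)\<^sup>2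
            \<le> 1 - (delta eps)\<^sup>2}
        \<ge> 1 - nu)"
proof -
  interpret prob_space M by fact
  have X_meas [measurable]: "X k \<in> borel_measurable M" for k
    using indep by (auto simp: indep_vars_def)
  have D: "prob_space D" and setsD: "sets D = sets borel"
    using prob_space_distr[OF X_meas] law[of 0] by (auto simp: law[of 0, symmetric])
  define C where "C = max 1 C_d"
  \<comment> \<open>Truncation changes each sample on a null set only, preserves independence, and
    gives the bound on every path that the path estimates require.\<close>
  define X' where "X' k \<omega> = (if norm (X k \<omega>) \<le> C then X k \<omega> else 0)" for k \<omega>
  have boundedC: "AE x in D. norm x \<le> C"
    using bounded by eventually_elim (simp add: C_def)
  have ae: "AE \<omega> in M. norm (X k \<omega>) \<le> C" for k
    using boundedC unfolding law[of k, symmetric] by (subst (asm) AE_distr_iff) auto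
  have eq: "AE \<omega> in M. X' k \<omega> = X k \<omega>" for k
    using ae[of k] by eventually_elim (simp add: X'_def)
  have X'_meas [measurable]: "X' k \<in> borel_measurable M" for k
    unfolding X'_def by measurable
  have moment: "expectation (\<lambda>\<omega>. g (X' k \<omega>)) = (LINT x|D. g x)"
    if [measurable]: "g \<in> borel_measurable borel" for g :: "real^'n \<Rightarrow> real" and k
  proof -
    have "expectation (\<lambda>\<omega>. g (X' k \<omega>)) = expectation (\<lambda>\<omega>. g (X k \<omega>))"
      using eq[of k] by (intro integral_cong_AE) auto
    also have "\<dots> = (LINT x|D. g x)"
      unfolding law[of k, symmetric] by (subst integral_distr) auto
    finally show ?thesis .
  qed
  define q1 where "q1 = column (p 1) Q"
  define q2 where "q2 = column (p 2) Q"
  define al where "al = alpha D Q (p 1) (p 2)"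
  have "p 1 \<noteq> p 2"
    using numbering dim inj_onD[of p "{1..CARD('n)}" 1 2] by (auto simp: bij_betw_def)
  then have q: "q1 \<bullet> q1 = 1" "q2 \<bullet> q2 = 1" "q1 \<bullet> q2 = 0"
    using column_inner_column[OF orth] by (auto simp: q1_def q2_def)
  interpret oja_data M X' "\<lambda>x. Sigma *v x" C mu "lam (p 1)" "lam (p 2)" al nu q1 q2
  proof unfold_locales
    show "norm (X' k \<omega>) \<le> C" for k \<omega>
      by (simp add: X'_def C_def le_max_iff_disj)
    show "1 \<le> C" by (simp add: C_def)
    show "indep_vars (\<lambda>_. borel) X' UNIV"
      unfolding X'_def[abs_def]
      by (rule indep_vars_compose2[OF indep, of "\<lambda>_ x. if norm x \<le> C then x else 0"]) measurable
    show "expectation (\<lambda>\<omega>. (X' k \<omega> \<bullet> u) * (X' k \<omega> \<bullet> w)) = u \<bullet> (Sigma *v w)" for k u w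
      using moment[of "\<lambda>x. (x \<bullet> u) * (x \<bullet> w)" k] second_moment_form[OF D setsD boundedC cov] by simp
    show "norm q1 = 1" "norm q2 = 1" "q1 \<bullet> q2 = 0"
      using q by (auto simp: norm_eq_sqrt_inner)
    show "Sigma *v q1 = lam (p 1) *\<^sub>R q1" "Sigma *v q2 = lam (p 2) *\<^sub>R q2"
      unfolding q1_def q2_def eigendecomp by (rule eigencolumn[OF orth])+
    show "expectation (\<lambda>\<omega>. ((X' k \<omega> \<bullet> q1) * (X' k \<omega> \<bullet> q2))\<^sup>2) = al\<^sup>2" for k
    proof -
      have "expectation (\<lambda>\<omega>. ((X' k \<omega> \<bullet> q1) * (X' k \<omega> \<bullet> q2))\<^sup>2) = (LINT x|D. ((x \<bullet> q1) * (x \<bullet> q2))\<^sup>2)"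
        by (rule moment) measurable
      also have "\<dots> = al\<^sup>2"
        unfolding al_def alpha_def transpose_mult_vec_nth q1_def q2_def
        by (simp add: power_mult_distrib inner_commute)
      finally show ?thesis .
    qed
    show "0 < al" using alpha12 by (simp add: al_def)
  qed (use mu nu gap pos in \<open>auto simp: matrix_vector_right_distrib matrix_vector_mult_scaleR\<close>)
  obtain h where h: "0 < h" "Phi (z * (1 + h)\<^sup>2) \<le> Phi z + nu / 16"
    by (rule threshold_exists)
  show ?thesis
  \<comment> \<open>The additive errors amount to \<open>(excess + 4) * sqrt eta\<close>, with
    \<open>4 = 1 + 2 + 1\<close> for the slack in \<open>y\<close>, the two remainders, and
    \<open>Z\<close> against \<open>V\<close>. From this threshold on they are at most
    \<open>h * delta\<close>.\<close>
  proof (intro exI[of _ "(excess + 4) / h"] conjI allI impI)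
    show "0 < (excess + 4) / h"
      using data_pos h by simp
    fix eta delta :: "real \<Rightarrow> real" and tau :: "real \<Rightarrow> nat \<Rightarrow> nat" and v0 :: "real \<Rightarrow> real^'n" and gamma :: real
    assume all: "\<forall>eps>0. 0 < eta eps \<and> 0 < delta eps \<and> norm (v0 eps) = 1 \<and> finite (tau eps ` {1..})"
      and eta: "eta \<in> \<Theta>[at_right 0](\<lambda>eps. eps * (lam (p 1) - lam (p 2)) / (\<Sum>j\<in>UNIV. (alpha D Q (p 1) j)\<^sup>2))"
      and delta: "delta \<in> \<Theta>[at_right 0](\<lambda>eps. sqrt (eta eps))"
      and delta_ge: "\<forall>\<^sub>F eps in at_right 0. (excess + 4) / h * sqrt (eta eps) \<le> delta eps"
      and gamma: "0 < gamma" "gamma \<le> 1 / 2"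
      and tau: "(\<lambda>eps. real (Max (tau eps ` {1..})))
        \<in> \<Theta>[at_right 0](\<lambda>eps. (1 - mu)\<^sup>2 / ((lam (p 1) + C_d) * eta eps powr (1 / 2 - gamma)))"
      and start: "\<forall>eps>0. \<forall>\<omega>\<in>space M.
        1 - (delta eps)\<^sup>2 \<le> (rot_interp Q (eta eps) (async_msgd (eta eps) mu (tau eps) (\<lambda>k. X k \<omega>) (v0 eps)) 0 $ p 2)\<^sup>2"
    define m where "m eps = Max (tau eps ` {1..})" for eps
    have pos_ev: "\<forall>\<^sub>F eps in at_right (0 :: real). 0 < eps"
      by (rule eventually_at_right_less)
    have eta0: "(eta \<longlongrightarrow> 0) (at_right 0)"
    proof (rule bigo_null_at_right[OF bigthetaD1[OF eta]])
      let ?a = "\<Sum>j\<in>UNIV. (alpha D Q (p 1) j)\<^sup>2"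
      have "((\<lambda>eps. eps * (lam (p 1) - lam (p 2)) * (1 / ?a)) \<longlongrightarrow> 0 * (lam (p 1) - lam (p 2)) * (1 / ?a)) (at_right 0)"
        by (intro tendsto_mult tendsto_const tendsto_ident_at)
      then show "((\<lambda>eps. eps * (lam (p 1) - lam (p 2)) / ?a) \<longlongrightarrow> 0) (at_right 0)"
        by simp
    qed
    obtain R where R: "\<forall>\<^sub>F eps in at_right 0. norm (delta eps) \<le> R * norm (sqrt (eta eps))"
      using bigthetaD1[OF delta] by (rule landau_o.bigE)
    have delta_le: "\<forall>\<^sub>F eps in at_right 0. delta eps \<le> R * sqrt (eta eps)"
      using R pos_ev
    proof eventually_elim
      case (elim eps)
      then have "0 \<le> eta eps" using all by (meson less_imp_le)
      then show ?case using elim(1) by simp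
    qed
    have m0: "((\<lambda>eps. real (m eps) * sqrt (eta eps)) \<longlongrightarrow> 0) (at_right 0)"
    proof -
      let ?K = "(1 - mu)\<^sup>2 / (lam (p 1) + C_d)"
      obtain c where c: "\<forall>\<^sub>F eps in at_right 0. norm (real (m eps)) \<le> c * norm ((1 - mu)\<^sup>2 / ((lam (p 1) + C_d) * eta eps powr (1 / 2 - gamma)))"
        using bigthetaD1[OF tau] unfolding m_def by (rule landau_o.bigE)
      have "((\<lambda>eps. eta eps powr gamma) \<longlongrightarrow> 0) (at_right 0)"
        using pos_ev all gamma
        by (intro tendsto_zero_powrI[OF eta0 tendsto_const]) (auto elim!: eventually_mono intro: less_imp_le)
      then have lim: "((\<lambda>eps. (c * \<bar>?K\<bar>) * eta eps powr gamma) \<longlongrightarrow> 0) (at_right 0)"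
        using tendsto_mult[OF tendsto_const, of "\<lambda>eps. eta eps powr gamma" 0 "at_right 0" "c * \<bar>?K\<bar>"] by simp
      show ?thesis
      proof (rule Lim_null_comparison[OF _ lim])
        show "\<forall>\<^sub>F eps in at_right 0. norm (real (m eps) * sqrt (eta eps)) \<le> (c * \<bar>?K\<bar>) * eta eps powr gamma"
          using c pos_ev
        proof eventually_elim
          case (elim eps)
          then have e: "0 < eta eps" using all by blast
          \<comment> \<open>The delay times \<open>sqrt eta\<close> is of order
            \<open>eta powr gamma\<close>, which tends to 0 because \<open>gamma\<close> is
            positive.\<close>
          have "eta eps powr gamma * eta eps powr (1 / 2 - gamma) = sqrt (eta eps)"
            using e by (simp add: powr_add[symmetric] powr_half_sqrt)
          then have pw: "sqrt (eta eps) / eta eps powr (1 / 2 - gamma) = eta eps powr gamma"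
            using e by (simp add: field_simps)
          have "norm (real (m eps) * sqrt (eta eps)) = norm (real (m eps)) * sqrt (eta eps)"
            using e by simp
          also have "\<dots> \<le> (c * norm ((1 - mu)\<^sup>2 / ((lam (p 1) + C_d) * eta eps powr (1 / 2 - gamma)))) * sqrt (eta eps)"
            using elim(1) e by (intro mult_right_mono) auto
          also have "\<dots> = (c * \<bar>?K\<bar>) * (sqrt (eta eps) / eta eps powr (1 / 2 - gamma))"
            using e by (simp add: abs_mult)
          finally show ?case unfolding pw .
        qed
      qed
    qed
    have start': "1 - (delta eps)\<^sup>2 \<le> (q2 \<bullet> v0 eps)\<^sup>2" if "0 < eps" for eps
    proof -
      \<comment> \<open>The iterate with index 0 is \<open>v0\<close> on every path, so any point of
        the nonempty space yields the condition on \<open>v0\<close>.\<close>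
      obtain \<omega> where "\<omega> \<in> space M" using not_empty by blast
      then show ?thesis
        using start[rule_format, OF that, of \<omega>] by (simp add: rot_interp_nth q2_def)
    qed
    have meas_eq: "measure M {\<omega> \<in> space M.
          (rot_interp Q (eta eps) (async_msgd (eta eps) mu (tau eps) (\<lambda>k. X k \<omega>) (v0 eps))
             (T1 mu nu (lam (p 1)) (lam (p 2)) (alpha D Q (p 1) (p 2)) (eta eps) (delta eps)) $ p 2)\<^sup>2
            \<le> 1 - (delta eps)\<^sup>2}
        = prob {\<omega> \<in> space M. (q2 \<bullet> msgd (eta eps) (tau eps) (v0 eps) (nat \<lfloor>T_exit (eta eps) (delta eps) / eta eps\<rfloor>) \<omega>)\<^sup>2
            \<le> 1 - (delta eps)\<^sup>2}"
      (is "measure M ?A = prob ?B") for eps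
    proof (rule finite_measure_eq_AE)
      \<comment> \<open>One null set serves all indices \<open>k\<close>, so outside it the whole
        iterations driven by \<open>X\<close> and \<open>X'\<close> coincide.\<close>
      have "AE \<omega> in M. \<forall>k. X' k \<omega> = X k \<omega>"
        using eq by (simp add: AE_all_countable)
      then show "AE \<omega> in M. (\<omega> \<in> ?A) = (\<omega> \<in> ?B)"
        unfolding T_exit_def unfolding al_def by eventually_elim (simp add: rot_interp_nth q2_def msgd_def)
      have [measurable]: "(\<lambda>\<omega>. async_msgd e mu' t (\<lambda>k. X k \<omega>) v N) \<in> borel_measurable M"
        "(\<lambda>\<omega>. async_msgd e mu' t (\<lambda>k. X' k \<omega>) v N) \<in> borel_measurable M" for e mu' t v N
        by (rule borel_measurable_async_msgd, measurable)+
      show "?A \<in> events"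
        unfolding rot_interp_nth by measurable
      show "?B \<in> events"
        unfolding msgd_def by measurable
    qed
    show "\<forall>\<^sub>F eps in at_right 0.
        measure M {\<omega> \<in> space M.
          (rot_interp Q (eta eps) (async_msgd (eta eps) mu (tau eps) (\<lambda>k. X k \<omega>) (v0 eps))
             (T1 mu nu (lam (p 1)) (lam (p 2)) (alpha D Q (p 1) (p 2)) (eta eps) (delta eps)) $ p 2)\<^sup>2
            \<le> 1 - (delta eps)\<^sup>2}
        \<ge> 1 - nu"
      unfolding meas_eq
    \<comment> \<open>The one-sided limit is tested along sequences of positive numbers tending to
      0, as the central limit theorem requires.\<close>
    proof (rule sequentially_imp_eventually_at_right[of 0 "1 :: real"])
      fix eps :: "nat \<Rightarrow> real"
      assume e: "\<And>n. 0 < eps n" "eps \<longlonglongrightarrow> 0"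
      have f: "filterlim eps (at_right 0) sequentially"
        using e by (intro tendsto_imp_filterlim_at_right) auto
      show "\<forall>\<^sub>F n in sequentially. 1 - nu \<le> prob {\<omega> \<in> space M. (q2 \<bullet> msgd (eta (eps n)) (tau (eps n)) (v0 (eps n))
          (nat \<lfloor>T_exit (eta (eps n)) (delta (eps n)) / eta (eps n)\<rfloor>) \<omega>)\<^sup>2 \<le> 1 - (delta (eps n))\<^sup>2}"
      proof (rule exit_sequence[OF h, where m = "\<lambda>n. m (eps n)" and R = R])
        show "(\<lambda>n. eta (eps n)) \<longlonglongrightarrow> 0"
          by (rule filterlim_compose[OF eta0 f])
        show "(\<lambda>n. real (m (eps n)) * sqrt (eta (eps n))) \<longlonglongrightarrow> 0"
          by (rule filterlim_compose[OF m0 f])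
        show "\<forall>\<^sub>F n in sequentially. (excess + 4) / h * sqrt (eta (eps n)) \<le> delta (eps n)"
          by (rule eventually_compose_filterlim[OF delta_ge f])
        show "\<forall>\<^sub>F n in sequentially. delta (eps n) \<le> R * sqrt (eta (eps n))"
          by (rule eventually_compose_filterlim[OF delta_le f])
        show "tau (eps n) k \<le> m (eps n)" if "1 \<le> k" for n k
          unfolding m_def using that all e(1)[of n] by (intro Max_ge) auto
        show "1 - (delta (eps n))\<^sup>2 \<le> (q2 \<bullet> v0 (eps n))\<^sup>2" for n
          by (rule start'[OF e(1)])
      qed (use all e(1) in auto)
    qed simp
  qed
qed

end
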